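(* Let $R$ be a commutative ring and let $A$ be a cogroup in the category $\mathcal{A}$ of connected graded $R$-algebras. Let $\nu$ be the inverse of $A$ and $\chi$ the antipode of the underlying Hopf algebra of $A$. Then the following are equivalent: (i) $\nu=\chi$. (ii) $\chi$ is a homomorphism of graded algebras. (iii) $A$ is commutative as a graded algebra.
   Context: $R$ is a commutative ring; graded modules are graded by the non-negative integers, and tensor products are over $R$ with the usual sign rule. A connected graded algebra is an associative unital graded $R$-algebra $B$ with $B_0=R$; these form the category $\mathcal{A}$, in which $R$ is a zero object. The categorical coproduct in $\mathcal{A}$ is denoted $\ast$ (free product). For $x\in A$, $x'$ and $x''$ denote the images of $x$ in $A\ast A$ under the canonical inclusions of $A$ as the first and second factor. A comonoid in $\mathcal{A}$ is an object $A$ with a coassociative, counital morphism $\Phi:A\to A\ast A$ in $\mathcal{A}$ (counital: the composites of $\Phi$ with the maps $A\ast A\to A$ given by the identity on one factor and the trivial map $A\to R\to A$ on the other are the identity). A cogroup in $\mathcal{A}$ is a comonoid having an inverse: a morphism $\nu:A\to A$ in $\mathcal{A}$ such that the composites of $\Phi$ with $(1_A,\nu),(\nu,1_A):A\ast A\to A$ are both the trivial map $A\to R\to A$. The underlying Hopf algebra of $A$ is the graded algebra $A$ with coproduct $\Delta$ the composite $A\xrightarrow{\Phi}A\ast A\to A\otimes A$, where the second map is the algebra homomorphism with $a'\mapsto a\otimes 1$, $a''\mapsto 1\otimes a$, and with counit the projection $A\to A_0=R$. Its antipode $\chi:A\to A$ is the inverse of $1_A$ under the convolution product $f\ast g=\mu\circ(f\otimes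 g)\circ\Delta$ on degree-preserving $R$-linear maps $A\to A$ that are the identity in degree $0$ ($\mu$ the multiplication of $A$). Commutative as a graded algebra means $ab=(-1)^{pq}ba$ for $a\in A_p$, $b\in A_q$ (no condition that odd elements square to zero is imposed). *)

theory Defs
  imports "HOL-Algebra.QuotRing" "HOL-Algebra.Module"
begin

section \<open>Connected graded algebras\<close>

record ('r, 'a) gralg = "('r, 'a) module" +
  grade :: "nat \<Rightarrow> 'a set"

text \<open>A graded module is the internal direct sum of its homogeneous pieces \<open>grade M n\<close>;
  \<open>homog_decomp M x c\<close> says that \<open>c n\<close> is the degree-\<open>n\<close> part of \<open>x\<close>.\<close>

definition homog_decomp :: "('r, 'a, 'n) gralg_scheme \<Rightarrow> 'a \<Rightarrow> (nat \<Rightarrow> 'a) \<Rightarrow> bool" where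
  "homog_decomp M x c \<longleftrightarrow>
     (\<forall>n. c n \<in> grade M n) \<and> finite {n. c n \<noteq> \<zero>\<^bsub>M\<^esub>} \<and>
     x = (\<Oplus>\<^bsub>M\<^esub>n\<in>{n. c n \<noteq> \<zero>\<^bsub>M\<^esub>}. c n)"

definition component :: "('r, 'a, 'n) gralg_scheme \<Rightarrow> nat \<Rightarrow> 'a \<Rightarrow> 'a" where
  "component M n x = (THE c. homog_decomp M x c) n"

locale graded_algebra = module R A + ring A
  for R :: "('r, 'm) ring_scheme" and A :: "('r, 'a, 'n) gralg_scheme" +
  assumes smult_mult_left:
      "\<lbrakk>r \<in> carrier R; x \<in> carrier A; y \<in> carrier A\<rbrakk>
        \<Longrightarrow> (r \<odot>\<^bsub>A\<^esub> x) \<otimes>\<^bsub>A\<^esub> y = r \<odot>\<^bsub>A\<^esub> (x \<otimes>\<^bsub>A\<^esub> y)"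
    and smult_mult_right:
      "\<lbrakk>r \<in> carrier R; x \<in> carrier A; y \<in> carrier A\<rbrakk>
        \<Longrightarrow> x \<otimes>\<^bsub>A\<^esub> (r \<odot>\<^bsub>A\<^esub> y) = r \<odot>\<^bsub>A\<^esub> (x \<otimes>\<^bsub>A\<^esub> y)"
    and grade_submodule: "submodule (grade A n) R A"
    and grade_decomp: "x \<in> carrier A \<Longrightarrow> \<exists>!c. homog_decomp A x c"
    and grade_one: "\<one>\<^bsub>A\<^esub> \<in> grade A 0"
    and grade_mult:
      "\<lbrakk>x \<in> grade A p; y \<in> grade A q\<rbrakk> \<Longrightarrow> x \<otimes>\<^bsub>A\<^esub> y \<in> grade A (p + q)"

locale connected_graded_algebra = graded_algebra R A
  for R :: "('r, 'm) ring_scheme" and A :: "('r, 'a, 'n) gralg_scheme" +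
  assumes connected: "bij_betw (\<lambda>r. r \<odot>\<^bsub>A\<^esub> \<one>\<^bsub>A\<^esub>) (carrier R) (grade A 0)"

definition graded_linear ::
  "('r, 'm) ring_scheme \<Rightarrow> ('r, 'a, 'n) gralg_scheme \<Rightarrow> ('r, 'b, 'k) gralg_scheme \<Rightarrow> ('a \<Rightarrow> 'b) set"
where
  "graded_linear R A B =
     {f. f \<in> carrier A \<rightarrow> carrier B \<and>
         (\<forall>x\<in>carrier A. \<forall>y\<in>carrier A. f (x \<oplus>\<^bsub>A\<^esub> y) = f x \<oplus>\<^bsub>B\<^esub> f y) \<and>
         (\<forall>r\<in>carrier R. \<forall>x\<in>carrier A. f (r \<odot>\<^bsub>A\<^esub> x) = r \<odot>\<^bsub>B\<^esub> f x) \<and>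
         (\<forall>n. f ` grade A n \<subseteq> grade B n)}"

definition galg_hom ::
  "('r, 'm) ring_scheme \<Rightarrow> ('r, 'a, 'n) gralg_scheme \<Rightarrow> ('r, 'b, 'k) gralg_scheme \<Rightarrow> ('a \<Rightarrow> 'b) set"
where
  "galg_hom R A B = ring_hom A B \<inter> graded_linear R A B"

text \<open>The augmentation \<open>A \<rightarrow> A\<^sub>0 = R\<close> and the trivial map \<open>A \<rightarrow> R \<rightarrow> B\<close>.\<close>

definition augmentation :: "('r, 'm) ring_scheme \<Rightarrow> ('r, 'a, 'n) gralg_scheme \<Rightarrow> 'a \<Rightarrow> 'r" where
  "augmentation R A x = (THE r. r \<in> carrier R \<and> r \<odot>\<^bsub>A\<^esub> \<one>\<^bsub>A\<^esub> = component A 0 x)"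

definition trivial_map ::
  "('r, 'm) ring_scheme \<Rightarrow> ('r, 'a, 'n) gralg_scheme \<Rightarrow> ('r, 'b, 'k) gralg_scheme \<Rightarrow> 'a \<Rightarrow> 'b"
where
  "trivial_map R A B x = augmentation R A x \<odot>\<^bsub>B\<^esub> \<one>\<^bsub>B\<^esub>"

text \<open>\<open>koszul M k x\<close> is \<open>(-1)^k x\<close>.\<close>

definition koszul :: "('a, 'n) ring_scheme \<Rightarrow> nat \<Rightarrow> 'a \<Rightarrow> 'a" where
  "koszul M k x = (if even k then x else \<ominus>\<^bsub>M\<^esub> x)"

definition graded_commutative :: "('r, 'a, 'n) gralg_scheme \<Rightarrow> bool" where
  "graded_commutative A \<longleftrightarrow>
     (\<forall>p q. \<forall>a\<in>grade A p. \<forall>b\<in>grade A q. a \<otimes>\<^bsub>A\<^esub> b = koszul A (p * q) (b \<otimes>\<^bsub>A\<^esub> a))"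


section \<open>Free modules, free algebras and their quotients\<close>

text \<open>The free module on \<open>X\<close>: finitely supported functions. Its multiplicative fields carry no
  information.\<close>

definition free_module :: "('r, 'm) ring_scheme \<Rightarrow> 'x set \<Rightarrow> ('r, 'x \<Rightarrow> 'r) module" where
  "free_module R X =
     \<lparr>carrier = {p. (\<forall>x. p x \<in> carrier R) \<and> finite {x. p x \<noteq> \<zero>\<^bsub>R\<^esub>} \<and> {x. p x \<noteq> \<zero>\<^bsub>R\<^esub>} \<subseteq> X},
      mult = undefined, one = undefined,
      zero = (\<lambda>x. \<zero>\<^bsub>R\<^esub>), add = (\<lambda>p q x. p x \<oplus>\<^bsub>R\<^esub> q x),
      smult = (\<lambda>r p x. r \<otimes>\<^bsub>R\<^esub> p x)\<rparr>"

definition basis_elt :: "('r, 'm) ring_scheme \<Rightarrow> 'x \<Rightarrow> 'x \<Rightarrow> 'r" where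
  "basis_elt R x = (\<lambda>y. if y = x then \<one>\<^bsub>R\<^esub> else \<zero>\<^bsub>R\<^esub>)"

definition linear_ext ::
  "('r, 'm) ring_scheme \<Rightarrow> ('r, 'c, 'n) module_scheme \<Rightarrow> ('x \<Rightarrow> 'c) \<Rightarrow> ('x \<Rightarrow> 'r) \<Rightarrow> 'c"
where
  "linear_ext R C f p = (\<Oplus>\<^bsub>C\<^esub>x\<in>{x. p x \<noteq> \<zero>\<^bsub>R\<^esub>}. p x \<odot>\<^bsub>C\<^esub> f x)"

text \<open>The free associative unital algebra on \<open>X\<close>, with the words over \<open>X\<close> as basis and
  concatenation as product.\<close>

definition free_algebra :: "('r, 'm) ring_scheme \<Rightarrow> 'x set \<Rightarrow> ('r, 'x list \<Rightarrow> 'r) module" where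
  "free_algebra R X = (free_module R (lists X))
     \<lparr>mult := (\<lambda>p q w. \<Oplus>\<^bsub>R\<^esub>i\<in>{..length w}. p (take i w) \<otimes>\<^bsub>R\<^esub> q (drop i w)),
      one := basis_elt R []\<rparr>"

text \<open>The quotient of \<open>M\<close> by \<open>N\<close>, where the degree-\<open>n\<close> part consists of the classes of the
  elements of \<open>G n\<close>; compare \<^const>\<open>FactRing\<close>.\<close>

definition graded_quot ::
  "('r, 'b, 'n) module_scheme \<Rightarrow> 'b set \<Rightarrow> (nat \<Rightarrow> 'b set) \<Rightarrow> ('r, 'b set) gralg"
where
  "graded_quot M N G =
     \<lparr>carrier = a_rcosets\<^bsub>M\<^esub> N, mult = rcoset_mult M N, one = N +>\<^bsub>M\<^esub> \<one>\<^bsub>M\<^esub>,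
      zero = N, add = set_add M,
      smult = (\<lambda>r X. \<Union>x\<in>X. N +>\<^bsub>M\<^esub> (r \<odot>\<^bsub>M\<^esub> x)),
      grade = (\<lambda>n. (\<lambda>x. N +>\<^bsub>M\<^esub> x) ` G n)\<rparr>"

text \<open>The map induced on a quotient by a map that is constant on cosets.\<close>

definition quot_map :: "('b \<Rightarrow> 'c) \<Rightarrow> 'b set \<Rightarrow> 'c" where
  "quot_map h X = the_elem (h ` X)"


section \<open>Free products\<close>

text \<open>The relations making \<open>\<iota>\<close>, a map from \<open>A\<close> into the free algebra \<open>F\<close>, an algebra
  homomorphism.\<close>

definition hom_relations ::
  "('r, 'm) ring_scheme \<Rightarrow> ('r, 'b, 'k) module_scheme \<Rightarrow> ('r, 'a, 'n) gralg_scheme \<Rightarrow> ('a \<Rightarrow> 'b) \<Rightarrow> 'b set"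
where
  "hom_relations R F A \<iota> =
     {\<iota> (x \<oplus>\<^bsub>A\<^esub> y) \<ominus>\<^bsub>F\<^esub> (\<iota> x \<oplus>\<^bsub>F\<^esub> \<iota> y) | x y. x \<in> carrier A \<and> y \<in> carrier A} \<union>
     {\<iota> (r \<odot>\<^bsub>A\<^esub> x) \<ominus>\<^bsub>F\<^esub> (r \<odot>\<^bsub>F\<^esub> \<iota> x) | r x. r \<in> carrier R \<and> x \<in> carrier A} \<union>
     {\<iota> (x \<otimes>\<^bsub>A\<^esub> y) \<ominus>\<^bsub>F\<^esub> (\<iota> x \<otimes>\<^bsub>F\<^esub> \<iota> y) | x y. x \<in> carrier A \<and> y \<in> carrier A} \<union>
     {\<iota> \<one>\<^bsub>A\<^esub> \<ominus>\<^bsub>F\<^esub> \<one>\<^bsub>F\<^esub>}"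

definition fp_words ::
  "('r, 'm) ring_scheme \<Rightarrow> ('r, 'a, 'n) gralg_scheme \<Rightarrow> ('r, 'b, 'k) gralg_scheme
    \<Rightarrow> ('r, ('a + 'b) list \<Rightarrow> 'r) module"
where
  "fp_words R A B = free_algebra R (Inl ` carrier A \<union> Inr ` carrier B)"

definition fp_ideal ::
  "('r, 'm) ring_scheme \<Rightarrow> ('r, 'a, 'n) gralg_scheme \<Rightarrow> ('r, 'b, 'k) gralg_scheme
    \<Rightarrow> (('a + 'b) list \<Rightarrow> 'r) set"
where
  "fp_ideal R A B =
     Idl\<^bsub>fp_words R A B\<^esub>
       (hom_relations R (fp_words R A B) A (\<lambda>a. basis_elt R [Inl a]) \<union>
        hom_relations R (fp_words R A B) B (\<lambda>b. basis_elt R [Inr b]))"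

text \<open>Degree \<open>n\<close> is spanned by the words in homogeneous letters whose degrees add up to \<open>n\<close>.\<close>

definition fp_homog ::
  "('r, 'm) ring_scheme \<Rightarrow> ('r, 'a, 'n) gralg_scheme \<Rightarrow> ('r, 'b, 'k) gralg_scheme
    \<Rightarrow> nat \<Rightarrow> (('a + 'b) list \<Rightarrow> 'r) set"
where
  "fp_homog R A B n =
     {p \<in> carrier (fp_words R A B). \<forall>w. p w \<noteq> \<zero>\<^bsub>R\<^esub> \<longrightarrow>
        (\<exists>ds. sum_list ds = n \<and>
          list_all2 (\<lambda>l d. case l of Inl a \<Rightarrow> a \<in> grade A d | Inr b \<Rightarrow> b \<in> grade B d) w ds)}"

definition free_product ::
  "('r, 'm) ring_scheme \<Rightarrow> ('r, 'a, 'n) gralg_scheme \<Rightarrow> ('r, 'b, 'k) gralg_scheme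
    \<Rightarrow> ('r, (('a + 'b) list \<Rightarrow> 'r) set) gralg"
where
  "free_product R A B = graded_quot (fp_words R A B) (fp_ideal R A B) (fp_homog R A B)"

definition fp_in1 ::
  "('r, 'm) ring_scheme \<Rightarrow> ('r, 'a, 'n) gralg_scheme \<Rightarrow> ('r, 'b, 'k) gralg_scheme
    \<Rightarrow> 'a \<Rightarrow> (('a + 'b) list \<Rightarrow> 'r) set"
where
  "fp_in1 R A B a = fp_ideal R A B +>\<^bsub>fp_words R A B\<^esub> basis_elt R [Inl a]"

definition fp_in2 ::
  "('r, 'm) ring_scheme \<Rightarrow> ('r, 'a, 'n) gralg_scheme \<Rightarrow> ('r, 'b, 'k) gralg_scheme
    \<Rightarrow> 'b \<Rightarrow> (('a + 'b) list \<Rightarrow> 'r) set"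
where
  "fp_in2 R A B b = fp_ideal R A B +>\<^bsub>fp_words R A B\<^esub> basis_elt R [Inr b]"

text \<open>For algebra homomorphisms \<open>f : A \<rightarrow> C\<close> and \<open>g : B \<rightarrow> C\<close>, \<open>fp_copair R C f g\<close> is the
  homomorphism \<open>(f, g) : A \<ast> B \<rightarrow> C\<close> restricting to \<open>f\<close> and \<open>g\<close>: evaluate words in \<open>C\<close>.\<close>

definition fp_copair ::
  "('r, 'm) ring_scheme \<Rightarrow> ('r, 'c, 'n) gralg_scheme \<Rightarrow> ('a \<Rightarrow> 'c) \<Rightarrow> ('b \<Rightarrow> 'c)
    \<Rightarrow> (('a + 'b) list \<Rightarrow> 'r) set \<Rightarrow> 'c"
where
  "fp_copair R C f g =
     quot_map (linear_ext R C (\<lambda>w. foldr (\<lambda>x y. x \<otimes>\<^bsub>C\<^esub> y) (map (case_sum f g) w) \<one>\<^bsub>C\<^esub>))"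

text \<open>\<open>f \<ast> g : A \<ast> B \<rightarrow> C \<ast> D\<close>, and the canonical isomorphism
  \<open>(A \<ast> B) \<ast> C \<rightarrow> A \<ast> (B \<ast> C)\<close>.\<close>

definition fp_map ::
  "('r, 'm) ring_scheme \<Rightarrow> ('r, 'c, 'n) gralg_scheme \<Rightarrow> ('r, 'd, 'k) gralg_scheme
    \<Rightarrow> ('a \<Rightarrow> 'c) \<Rightarrow> ('b \<Rightarrow> 'd) \<Rightarrow> (('a + 'b) list \<Rightarrow> 'r) set \<Rightarrow> (('c + 'd) list \<Rightarrow> 'r) set"
where
  "fp_map R C D f g =
     fp_copair R (free_product R C D) (fp_in1 R C D \<circ> f) (fp_in2 R C D \<circ> g)"

definition fp_assoc ::
  "('r, 'm) ring_scheme \<Rightarrow> ('r, 'a, 'n) gralg_scheme \<Rightarrow> ('r, 'b, 'k) gralg_scheme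
    \<Rightarrow> ('r, 'c, 'l) gralg_scheme
    \<Rightarrow> (((('a + 'b) list \<Rightarrow> 'r) set + 'c) list \<Rightarrow> 'r) set
    \<Rightarrow> (('a + (('b + 'c) list \<Rightarrow> 'r) set) list \<Rightarrow> 'r) set"
where
  "fp_assoc R A B C =
     (let BC = free_product R B C; P = free_product R A BC
      in fp_copair R P
           (fp_copair R P (fp_in1 R A BC) (fp_in2 R A BC \<circ> fp_in1 R B C))
           (fp_in2 R A BC \<circ> fp_in2 R B C))"


section \<open>Comonoids and cogroups\<close>

definition comonoid ::
  "('r, 'm) ring_scheme \<Rightarrow> ('r, 'a, 'n) gralg_scheme
    \<Rightarrow> ('a \<Rightarrow> (('a + 'a) list \<Rightarrow> 'r) set) \<Rightarrow> bool"
where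
  "comonoid R A \<Phi> \<longleftrightarrow>
     connected_graded_algebra R A \<and>
     \<Phi> \<in> galg_hom R A (free_product R A A) \<and>
     (\<forall>x\<in>carrier A.
        fp_assoc R A A A (fp_map R (free_product R A A) A \<Phi> id (\<Phi> x)) =
        fp_map R A (free_product R A A) id \<Phi> (\<Phi> x)) \<and>
     (\<forall>x\<in>carrier A. fp_copair R A id (trivial_map R A A) (\<Phi> x) = x) \<and>
     (\<forall>x\<in>carrier A. fp_copair R A (trivial_map R A A) id (\<Phi> x) = x)"

definition cogroup_inverse ::
  "('r, 'm) ring_scheme \<Rightarrow> ('r, 'a, 'n) gralg_scheme
    \<Rightarrow> ('a \<Rightarrow> (('a + 'a) list \<Rightarrow> 'r) set) \<Rightarrow> ('a \<Rightarrow> 'a) \<Rightarrow> bool"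
where
  "cogroup_inverse R A \<Phi> \<nu> \<longleftrightarrow>
     \<nu> \<in> galg_hom R A A \<and>
     (\<forall>x\<in>carrier A. fp_copair R A id \<nu> (\<Phi> x) = trivial_map R A A x) \<and>
     (\<forall>x\<in>carrier A. fp_copair R A \<nu> id (\<Phi> x) = trivial_map R A A x)"

definition cogroup ::
  "('r, 'm) ring_scheme \<Rightarrow> ('r, 'a, 'n) gralg_scheme
    \<Rightarrow> ('a \<Rightarrow> (('a + 'a) list \<Rightarrow> 'r) set) \<Rightarrow> bool"
where
  "cogroup R A \<Phi> \<longleftrightarrow> comonoid R A \<Phi> \<and> (\<exists>\<nu>. cogroup_inverse R A \<Phi> \<nu>)"


section \<open>Tensor products\<close>

definition tensor_pairs ::
  "('r, 'm) ring_scheme \<Rightarrow> ('r, 'a, 'n) gralg_scheme \<Rightarrow> ('r, 'b, 'k) gralg_scheme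
    \<Rightarrow> ('r, 'a \<times> 'b \<Rightarrow> 'r) module"
where
  "tensor_pairs R A B = free_module R (carrier A \<times> carrier B)"

definition bilinear_relations ::
  "('r, 'm) ring_scheme \<Rightarrow> ('r, 'a, 'n) gralg_scheme \<Rightarrow> ('r, 'b, 'k) gralg_scheme
    \<Rightarrow> ('a \<times> 'b \<Rightarrow> 'r) set"
where
  "bilinear_relations R A B =
     (let M = tensor_pairs R A B; e = (\<lambda>a b. basis_elt R (a, b)) in
     {e (a \<oplus>\<^bsub>A\<^esub> a') b \<ominus>\<^bsub>M\<^esub> (e a b \<oplus>\<^bsub>M\<^esub> e a' b) | a a' b.
        a \<in> carrier A \<and> a' \<in> carrier A \<and> b \<in> carrier B} \<union>
     {e a (b \<oplus>\<^bsub>B\<^esub> b') \<ominus>\<^bsub>M\<^esub> (e a b \<oplus>\<^bsub>M\<^esub> e a b') | a b b'.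
        a \<in> carrier A \<and> b \<in> carrier B \<and> b' \<in> carrier B} \<union>
     {e (r \<odot>\<^bsub>A\<^esub> a) b \<ominus>\<^bsub>M\<^esub> (r \<odot>\<^bsub>M\<^esub> e a b) | r a b.
        r \<in> carrier R \<and> a \<in> carrier A \<and> b \<in> carrier B} \<union>
     {e a (r \<odot>\<^bsub>B\<^esub> b) \<ominus>\<^bsub>M\<^esub> (r \<odot>\<^bsub>M\<^esub> e a b) | r a b.
        r \<in> carrier R \<and> a \<in> carrier A \<and> b \<in> carrier B})"

definition tensor_null ::
  "('r, 'm) ring_scheme \<Rightarrow> ('r, 'a, 'n) gralg_scheme \<Rightarrow> ('r, 'b, 'k) gralg_scheme
    \<Rightarrow> ('a \<times> 'b \<Rightarrow> 'r) set"
where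
  "tensor_null R A B =
     \<Inter>{N. submodule N R (tensor_pairs R A B) \<and> bilinear_relations R A B \<subseteq> N}"

definition tensor_homog ::
  "('r, 'm) ring_scheme \<Rightarrow> ('r, 'a, 'n) gralg_scheme \<Rightarrow> ('r, 'b, 'k) gralg_scheme
    \<Rightarrow> nat \<Rightarrow> ('a \<times> 'b \<Rightarrow> 'r) set"
where
  "tensor_homog R A B n =
     {p \<in> carrier (tensor_pairs R A B). \<forall>a b. p (a, b) \<noteq> \<zero>\<^bsub>R\<^esub> \<longrightarrow>
        (\<exists>i j. i + j = n \<and> a \<in> grade A i \<and> b \<in> grade B j)}"

definition tens ::
  "('r, 'm) ring_scheme \<Rightarrow> ('r, 'a, 'n) gralg_scheme \<Rightarrow> ('r, 'b, 'k) gralg_scheme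
    \<Rightarrow> 'a \<Rightarrow> 'b \<Rightarrow> ('a \<times> 'b \<Rightarrow> 'r) set"
where
  "tens R A B a b = tensor_null R A B +>\<^bsub>tensor_pairs R A B\<^esub> basis_elt R (a, b)"

text \<open>The graded module \<open>A \<otimes> B\<close>, whose multiplicative fields are filled in only in
  \<open>tensor_algebra\<close>; \<open>tensor_lift R C f\<close> is the linear map \<open>A \<otimes> B \<rightarrow> C\<close> induced by a bilinear
  map \<open>f\<close>.\<close>

definition tensor_module ::
  "('r, 'm) ring_scheme \<Rightarrow> ('r, 'a, 'n) gralg_scheme \<Rightarrow> ('r, 'b, 'k) gralg_scheme
    \<Rightarrow> ('r, ('a \<times> 'b \<Rightarrow> 'r) set) gralg"
where
  "tensor_module R A B = graded_quot (tensor_pairs R A B) (tensor_null R A B) (tensor_homog R A B)"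

definition tensor_lift ::
  "('r, 'm) ring_scheme \<Rightarrow> ('r, 'c, 'n) gralg_scheme \<Rightarrow> ('a \<Rightarrow> 'b \<Rightarrow> 'c)
    \<Rightarrow> ('a \<times> 'b \<Rightarrow> 'r) set \<Rightarrow> 'c"
where
  "tensor_lift R C f = quot_map (linear_ext R C (\<lambda>(a, b). f a b))"

text \<open>The product \<open>(a \<otimes> b)(c \<otimes> d)\<close>; for homogeneous \<open>b\<close> of degree \<open>i\<close> and \<open>c\<close> of degree \<open>j\<close> it is
  \<open>(-1)^(i j) a c \<otimes> b d\<close>, and in general one sums over the homogeneous components of \<open>b\<close> and
  \<open>c\<close>.\<close>

definition tens_mult ::
  "('r, 'm) ring_scheme \<Rightarrow> ('r, 'a, 'n) gralg_scheme \<Rightarrow> ('r, 'b, 'k) gralg_scheme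
    \<Rightarrow> 'a \<Rightarrow> 'b \<Rightarrow> 'a \<Rightarrow> 'b \<Rightarrow> ('a \<times> 'b \<Rightarrow> 'r) set"
where
  "tens_mult R A B a b c d =
     (\<Oplus>\<^bsub>tensor_module R A B\<^esub>i\<in>{i. component B i b \<noteq> \<zero>\<^bsub>B\<^esub>}.
        \<Oplus>\<^bsub>tensor_module R A B\<^esub>j\<in>{j. component A j c \<noteq> \<zero>\<^bsub>A\<^esub>}.
          koszul (tensor_module R A B) (i * j)
            (tens R A B (a \<otimes>\<^bsub>A\<^esub> component A j c) (component B i b \<otimes>\<^bsub>B\<^esub> d)))"

definition tensor_algebra ::
  "('r, 'm) ring_scheme \<Rightarrow> ('r, 'a, 'n) gralg_scheme \<Rightarrow> ('r, 'b, 'k) gralg_scheme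
    \<Rightarrow> ('r, ('a \<times> 'b \<Rightarrow> 'r) set) gralg"
where
  "tensor_algebra R A B = (tensor_module R A B)
     \<lparr>mult := (\<lambda>X Y. tensor_lift R (tensor_module R A B)
                (\<lambda>a b. tensor_lift R (tensor_module R A B) (\<lambda>c d. tens_mult R A B a b c d) Y) X),
      one := tens R A B \<one>\<^bsub>A\<^esub> \<one>\<^bsub>B\<^esub>\<rparr>"

text \<open>\<open>f \<otimes> g : A \<otimes> B \<rightarrow> C \<otimes> D\<close> for degree-preserving \<open>f\<close> and \<open>g\<close>, so that no sign occurs.\<close>

definition tensor_map ::
  "('r, 'm) ring_scheme \<Rightarrow> ('r, 'c, 'n) gralg_scheme \<Rightarrow> ('r, 'd, 'k) gralg_scheme
    \<Rightarrow> ('a \<Rightarrow> 'c) \<Rightarrow> ('b \<Rightarrow> 'd) \<Rightarrow> ('a \<times> 'b \<Rightarrow> 'r) set \<Rightarrow> ('c \<times> 'd \<Rightarrow> 'r) set"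
where
  "tensor_map R C D f g =
     tensor_lift R (tensor_algebra R C D) (\<lambda>a b. tens R C D (f a) (g b))"

definition mult_map ::
  "('r, 'm) ring_scheme \<Rightarrow> ('r, 'a, 'n) gralg_scheme \<Rightarrow> ('a \<times> 'a \<Rightarrow> 'r) set \<Rightarrow> 'a"
where
  "mult_map R A = tensor_lift R A (\<lambda>a b. a \<otimes>\<^bsub>A\<^esub> b)"


section \<open>The underlying Hopf algebra and its antipode\<close>

definition hopf_coproduct ::
  "('r, 'm) ring_scheme \<Rightarrow> ('r, 'a, 'n) gralg_scheme
    \<Rightarrow> ('a \<Rightarrow> (('a + 'a) list \<Rightarrow> 'r) set) \<Rightarrow> 'a \<Rightarrow> ('a \<times> 'a \<Rightarrow> 'r) set"
where
  "hopf_coproduct R A \<Phi> =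
     fp_copair R (tensor_algebra R A A) (\<lambda>a. tens R A A a \<one>\<^bsub>A\<^esub>) (\<lambda>a. tens R A A \<one>\<^bsub>A\<^esub> a) \<circ> \<Phi>"

definition convolution ::
  "('r, 'm) ring_scheme \<Rightarrow> ('r, 'a, 'n) gralg_scheme
    \<Rightarrow> ('a \<Rightarrow> (('a + 'a) list \<Rightarrow> 'r) set) \<Rightarrow> ('a \<Rightarrow> 'a) \<Rightarrow> ('a \<Rightarrow> 'a) \<Rightarrow> 'a \<Rightarrow> 'a"
where
  "convolution R A \<Phi> f g = mult_map R A \<circ> tensor_map R A A f g \<circ> hopf_coproduct R A \<Phi>"

text \<open>The unit for convolution is the composite \<open>A \<rightarrow> R \<rightarrow> A\<close> of counit and unit.\<close>

definition is_antipode ::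
  "('r, 'm) ring_scheme \<Rightarrow> ('r, 'a, 'n) gralg_scheme
    \<Rightarrow> ('a \<Rightarrow> (('a + 'a) list \<Rightarrow> 'r) set) \<Rightarrow> ('a \<Rightarrow> 'a) \<Rightarrow> bool"
where
  "is_antipode R A \<Phi> \<chi> \<longleftrightarrow>
     \<chi> \<in> graded_linear R A A \<and>
     (\<forall>x\<in>grade A 0. \<chi> x = x) \<and>
     (\<forall>x\<in>carrier A. convolution R A \<Phi> id \<chi> x = trivial_map R A A x) \<and>
     (\<forall>x\<in>carrier A. convolution R A \<Phi> \<chi> id x = trivial_map R A A x)"

text \<open>Maps are determined only by their values on the carrier; extensionality makes the antipode
  unique as a HOL function.\<close>

definition antipode ::
  "('r, 'm) ring_scheme \<Rightarrow> ('r, 'a, 'n) gralg_scheme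
    \<Rightarrow> ('a \<Rightarrow> (('a + 'a) list \<Rightarrow> 'r) set) \<Rightarrow> 'a \<Rightarrow> 'a"
where
  "antipode R A \<Phi> = (THE \<chi>. \<chi> \<in> extensional (carrier A) \<and> is_antipode R A \<Phi> \<chi>)"

end

theory Submission
  imports Defs
begin

text \<open>
  The implications are proved in the cycle (i) to (ii) to (iii) to (i), the first being immediate
  because \<open>\<nu>\<close> is a homomorphism.

  From (iii) to (i). If the images of two homomorphisms \<open>f, g : A \<rightarrow> C\<close> commute in the graded sense,
  then \<open>(f, g) : A \<ast> A \<rightarrow> C\<close> factors as \<open>A \<ast> A \<rightarrow> A \<otimes> A \<rightarrow> C\<close>, the second map being
  \<open>a \<otimes> b \<mapsto> f a \<cdot> g b\<close> (\<open>fp_copair_factor\<close>). Hence for such \<open>f\<close> and \<open>g\<close> the product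
  \<open>(f, g) \<circ> \<Phi>\<close> formed with the comonoid structure is the convolution product formed with \<open>\<Delta>\<close>
  (\<open>hom_pair_convolution\<close>). If \<open>A\<close> is commutative this applies to \<open>id\<close> and \<open>\<nu>\<close>, so \<open>\<nu>\<close> is a
  convolution inverse of \<open>id\<close>, and such an inverse is unique.

  From (ii) to (iii). Let \<open>\<chi>\<close> be multiplicative, and let \<open>x\<close>, \<open>y\<close> be homogeneous of total degree
  \<open>n\<close>, where elements of smaller total degree are known to commute. Write \<open>m (a \<otimes> b) = a \<cdot> \<chi> b\<close>. The
  values \<open>m (\<Delta> x \<cdot> \<Delta> y)\<close> and \<open>m (\<Delta> x) \<cdot> m (\<Delta> y)\<close> coincide, both being the constant part of
  \<open>x y\<close>. Expanded on \<open>\<Delta> x = \<Sum> a \<otimes> b\<close> and \<open>\<Delta> y = \<Sum> c \<otimes> d\<close>, they differ by the interchange of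
  \<open>\<chi> b\<close> and \<open>c\<close>, which commute by induction except in the single term with \<open>b = x\<close> and
  \<open>c = y\<close>. So \<open>\<chi> x\<close> and \<open>y\<close> commute. Finally, for \<open>x\<close> of positive degree, \<open>m (\<Delta> x) = 0\<close>
  expresses \<open>x\<close> through products \<open>a \<cdot> \<chi> b\<close> with \<open>a\<close> of smaller degree, and these commute with
  \<open>y\<close> (\<open>hom_antipode_commutative\<close>).

  Both arguments presuppose that the antipode exists. It is obtained as the geometric series
  \<open>\<Sum> (\<epsilon> - id)^k\<close> for the convolution product (\<open>conv_id_chi\<close>), where \<open>\<epsilon>\<close> is the composite
  \<open>A \<rightarrow> R \<rightarrow> A\<close>; it terminates in each degree because \<open>A\<close> is connected. That it gives a two-sided
  inverse needs associativity of convolution (\<open>conv_assoc\<close>), which is deduced from coassociativity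
  of \<open>\<Phi>\<close> by mapping \<open>A \<ast> A \<ast> A\<close> to \<open>(A \<otimes> A) \<otimes> A\<close>. The constructions used on the way, with
  their universal properties, are the free product as a quotient of a free algebra and the tensor
  product of graded algebras with its signs.
\<close>

section \<open>Modules, algebras and linear maps\<close>

text \<open>Associative unital algebras without a grading. The universal property of the free product does
  not involve the gradings, and free algebras carry none.\<close>

locale ralg = module R A + ring A
  for R :: "('r, 'm) ring_scheme" and A :: "('r, 'a, 'n) module_scheme" +
  assumes smult_mult_left:
      "\<lbrakk>r \<in> carrier R; x \<in> carrier A; y \<in> carrier A\<rbrakk>
        \<Longrightarrow> (r \<odot>\<^bsub>A\<^esub> x) \<otimes>\<^bsub>A\<^esub> y = r \<odot>\<^bsub>A\<^esub> (x \<otimes>\<^bsub>A\<^esub> y)"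
    and smult_mult_right:
      "\<lbrakk>r \<in> carrier R; x \<in> carrier A; y \<in> carrier A\<rbrakk>
        \<Longrightarrow> x \<otimes>\<^bsub>A\<^esub> (r \<odot>\<^bsub>A\<^esub> y) = r \<odot>\<^bsub>A\<^esub> (x \<otimes>\<^bsub>A\<^esub> y)"

lemma (in ralg) is_module: "module R A" ..

lemma (in ralg) is_ring: "ring A" ..

definition lin ::
  "('r, 'm) ring_scheme \<Rightarrow> ('r, 'a, 'n) module_scheme \<Rightarrow> ('r, 'b, 'k) module_scheme \<Rightarrow> ('a \<Rightarrow> 'b) set"
where
  "lin R M N =
     {f. f \<in> carrier M \<rightarrow> carrier N \<and>
         (\<forall>x\<in>carrier M. \<forall>y\<in>carrier M. f (x \<oplus>\<^bsub>M\<^esub> y) = f x \<oplus>\<^bsub>N\<^esub> f y) \<and>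
         (\<forall>r\<in>carrier R. \<forall>x\<in>carrier M. f (r \<odot>\<^bsub>M\<^esub> x) = r \<odot>\<^bsub>N\<^esub> f x)}"

definition ralg_hom ::
  "('r, 'm) ring_scheme \<Rightarrow> ('r, 'a, 'n) module_scheme \<Rightarrow> ('r, 'b, 'k) module_scheme \<Rightarrow> ('a \<Rightarrow> 'b) set"
where
  "ralg_hom R A B = ring_hom A B \<inter> lin R A B"

lemma linI:
  assumes "\<And>x. x \<in> carrier M \<Longrightarrow> f x \<in> carrier N"
    and "\<And>x y. \<lbrakk>x \<in> carrier M; y \<in> carrier M\<rbrakk> \<Longrightarrow> f (x \<oplus>\<^bsub>M\<^esub> y) = f x \<oplus>\<^bsub>N\<^esub> f y"
    and "\<And>r x. \<lbrakk>r \<in> carrier R; x \<in> carrier M\<rbrakk> \<Longrightarrow> f (r \<odot>\<^bsub>M\<^esub> x) = r \<odot>\<^bsub>N\<^esub> f x"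
  shows "f \<in> lin R M N"
  using assms by (auto simp: lin_def)

lemma lin_closed: "\<lbrakk>f \<in> lin R M N; x \<in> carrier M\<rbrakk> \<Longrightarrow> f x \<in> carrier N"
  and lin_add: "\<lbrakk>f \<in> lin R M N; x \<in> carrier M; y \<in> carrier M\<rbrakk> \<Longrightarrow> f (x \<oplus>\<^bsub>M\<^esub> y) = f x \<oplus>\<^bsub>N\<^esub> f y"
  and lin_smult: "\<lbrakk>f \<in> lin R M N; r \<in> carrier R; x \<in> carrier M\<rbrakk> \<Longrightarrow> f (r \<odot>\<^bsub>M\<^esub> x) = r \<odot>\<^bsub>N\<^esub> f x"
  by (auto simp: lin_def)

lemma lin_zero:
  assumes "module R M" "module R N" "f \<in> lin R M N"
  shows "f \<zero>\<^bsub>M\<^esub> = \<zero>\<^bsub>N\<^esub>"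
proof -
  interpret M: module R M by fact
  interpret N: module R N by fact
  have "f (\<zero>\<^bsub>R\<^esub> \<odot>\<^bsub>M\<^esub> \<zero>\<^bsub>M\<^esub>) = \<zero>\<^bsub>R\<^esub> \<odot>\<^bsub>N\<^esub> f \<zero>\<^bsub>M\<^esub>"
    by (rule lin_smult[OF assms(3)]) auto
  then show ?thesis
    using lin_closed[OF assms(3)] by simp
qed

lemma lin_minus:
  assumes "module R M" "module R N" "f \<in> lin R M N" "x \<in> carrier M"
  shows "f (\<ominus>\<^bsub>M\<^esub> x) = \<ominus>\<^bsub>N\<^esub> f x"
proof -
  interpret M: module R M by fact
  interpret N: module R N by fact
  have "f x \<oplus>\<^bsub>N\<^esub> f (\<ominus>\<^bsub>M\<^esub> x) = \<zero>\<^bsub>N\<^esub>"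
    using assms lin_add[OF assms(3), of x "\<ominus>\<^bsub>M\<^esub> x"] lin_zero[OF assms(1-3)]
    by (simp add: M.M.r_neg)
  then show ?thesis
    using assms lin_closed[OF assms(3)] by (metis M.M.a_inv_closed N.M.minus_equality N.M.a_comm)
qed

lemma lin_diff:
  assumes "module R M" "module R N" "f \<in> lin R M N" "x \<in> carrier M" "y \<in> carrier M"
  shows "f (x \<ominus>\<^bsub>M\<^esub> y) = f x \<ominus>\<^bsub>N\<^esub> f y"
proof -
  interpret M: module R M by fact
  show ?thesis
    using assms lin_minus[OF assms(1-3)] lin_add[OF assms(3)] by (simp add: a_minus_def)
qed

lemma lin_finsum:
  assumes "module R M" "module R N" "f \<in> lin R M N" "g \<in> S \<rightarrow> carrier M"
  shows "f (\<Oplus>\<^bsub>M\<^esub>i\<in>S. g i) = (\<Oplus>\<^bsub>N\<^esub>i\<in>S. f (g i))"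
proof -
  interpret M: module R M by fact
  interpret N: module R N by fact
  show ?thesis
  proof (cases "finite S")
    case True
    then show ?thesis
      using assms(4)
    proof (induction S)
      case empty
      then show ?case
        using lin_zero[OF assms(1-3)] by simp
    next
      case (insert i S)
      then have "g \<in> S \<rightarrow> carrier M" "g i \<in> carrier M"
        by auto
      moreover have "(\<lambda>i. f (g i)) \<in> S \<rightarrow> carrier N" "f (g i) \<in> carrier N"
        using insert lin_closed[OF assms(3)] by auto
      ultimately show ?case
        using insert lin_add[OF assms(3)] by simp
    qed
  next
    case False
    then show ?thesis
      using lin_zero[OF assms(1-3)] by (simp add: M.M.finsum_infinite N.M.finsum_infinite)
  qed
qed

lemma lin_comp: "\<lbrakk>f \<in> lin R M N; g \<in> lin R N K\<rbrakk> \<Longrightarrow> (\<lambda>x. g (f x)) \<in> lin R M K"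
  by (auto simp: lin_def Pi_iff)

lemma lin_id: "(\<lambda>x. x) \<in> lin R M M"
  by (auto simp: lin_def)

lemma lin_plus:
  assumes "module R N" "f \<in> lin R M N" "g \<in> lin R M N"
  shows "(\<lambda>x. f x \<oplus>\<^bsub>N\<^esub> g x) \<in> lin R M N"
proof -
  interpret N: module R N by fact
  show ?thesis
    using lin_closed[OF assms(2)] lin_closed[OF assms(3)]
    by (intro linI)
      (simp_all add: lin_add[OF assms(2)] lin_add[OF assms(3)] lin_smult[OF assms(2)]
        lin_smult[OF assms(3)] N.smult_r_distr N.M.a_ac)
qed

lemma lin_scaled:
  assumes "module R N" "f \<in> lin R M N" "s \<in> carrier R"
  shows "(\<lambda>x. s \<odot>\<^bsub>N\<^esub> f x) \<in> lin R M N"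
proof -
  interpret N: module R N by fact
  show ?thesis
    using lin_closed[OF assms(2)] assms(3)
    by (intro linI)
      (simp_all add: lin_add[OF assms(2)] lin_smult[OF assms(2)] N.smult_r_distr
        N.smult_assoc1[symmetric] N.R.m_comm)
qed

lemma lin_uminus:
  assumes "module R N" "f \<in> lin R M N"
  shows "(\<lambda>x. \<ominus>\<^bsub>N\<^esub> f x) \<in> lin R M N"
proof -
  interpret N: module R N by fact
  show ?thesis
    using lin_closed[OF assms(2)]
    by (intro linI)
      (simp_all add: lin_add[OF assms(2)] lin_smult[OF assms(2)] N.smult_r_minus N.M.minus_add)
qed

lemma lin_sum:
  assumes "module R N" "finite S" "\<And>i. i \<in> S \<Longrightarrow> f i \<in> lin R M N"
  shows "(\<lambda>x. \<Oplus>\<^bsub>N\<^esub>i\<in>S. f i x) \<in> lin R M N"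
proof -
  interpret N: module R N by fact
  have c: "(\<lambda>i. f i x) \<in> S \<rightarrow> carrier N" if "x \<in> carrier M" for x
    using that assms(3) lin_closed by fastforce
  show ?thesis
  proof (rule linI)
    fix x y assume xy: "x \<in> carrier M" "y \<in> carrier M"
    have "(\<Oplus>\<^bsub>N\<^esub>i\<in>S. f i (x \<oplus>\<^bsub>M\<^esub> y)) = (\<Oplus>\<^bsub>N\<^esub>i\<in>S. f i x \<oplus>\<^bsub>N\<^esub> f i y)"
      using c[OF xy(1)] c[OF xy(2)] lin_add[OF assms(3) xy] by (intro N.M.finsum_cong') auto
    then show "(\<Oplus>\<^bsub>N\<^esub>i\<in>S. f i (x \<oplus>\<^bsub>M\<^esub> y)) = (\<Oplus>\<^bsub>N\<^esub>i\<in>S. f i x) \<oplus>\<^bsub>N\<^esub> (\<Oplus>\<^bsub>N\<^esub>i\<in>S. f i y)"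
      using N.M.finsum_addf[OF c[OF xy(1)] c[OF xy(2)]] by simp
  next
    fix r x assume rx: "r \<in> carrier R" "x \<in> carrier M"
    have "(\<Oplus>\<^bsub>N\<^esub>i\<in>S. f i (r \<odot>\<^bsub>M\<^esub> x)) = (\<Oplus>\<^bsub>N\<^esub>i\<in>S. r \<odot>\<^bsub>N\<^esub> f i x)"
      using c[OF rx(2)] rx lin_smult[OF assms(3) rx] by (intro N.M.finsum_cong') auto
    then show "(\<Oplus>\<^bsub>N\<^esub>i\<in>S. f i (r \<odot>\<^bsub>M\<^esub> x)) = r \<odot>\<^bsub>N\<^esub> (\<Oplus>\<^bsub>N\<^esub>i\<in>S. f i x)"
      using N.finsum_smult_ldistr[OF assms(2) rx(1) c[OF rx(2)]] by simp
  qed (use c in \<open>auto intro: N.M.finsum_closed\<close>)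
qed

lemma ralg_homI:
  assumes "f \<in> lin R A B"
    and "\<And>x y. \<lbrakk>x \<in> carrier A; y \<in> carrier A\<rbrakk> \<Longrightarrow> f (x \<otimes>\<^bsub>A\<^esub> y) = f x \<otimes>\<^bsub>B\<^esub> f y"
    and "f \<one>\<^bsub>A\<^esub> = \<one>\<^bsub>B\<^esub>"
  shows "f \<in> ralg_hom R A B"
  using assms by (auto simp: ralg_hom_def ring_hom_def lin_def)

lemma ralg_hom_lin: "f \<in> ralg_hom R A B \<Longrightarrow> f \<in> lin R A B"
  and ralg_hom_mult:
    "\<lbrakk>f \<in> ralg_hom R A B; x \<in> carrier A; y \<in> carrier A\<rbrakk> \<Longrightarrow> f (x \<otimes>\<^bsub>A\<^esub> y) = f x \<otimes>\<^bsub>B\<^esub> f y"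
  and ralg_hom_one: "f \<in> ralg_hom R A B \<Longrightarrow> f \<one>\<^bsub>A\<^esub> = \<one>\<^bsub>B\<^esub>"
  by (auto simp: ralg_hom_def ring_hom_def)

lemmas ralg_hom_closed = lin_closed[OF ralg_hom_lin]

lemma ralg_hom_comp: "\<lbrakk>f \<in> ralg_hom R A B; g \<in> ralg_hom R B C\<rbrakk> \<Longrightarrow> (\<lambda>x. g (f x)) \<in> ralg_hom R A C"
  using lin_comp[OF ralg_hom_lin ralg_hom_lin]
  by (intro ralg_homI) (simp_all add: ralg_hom_mult ralg_hom_one ralg_hom_closed)

lemma ralg_hom_id: "(\<lambda>x. x) \<in> ralg_hom R A A"
  by (intro ralg_homI lin_id) auto

subsection \<open>Transport of structure along surjections\<close>

text \<open>The free product and the tensor product are quotients. Their laws follow from those of the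
  objects above them, because every element is in the image of the projection.\<close>

lemma module_surj:
  assumes M: "module R M"
    and carr: "carrier Q = \<pi> ` carrier M"
    and add: "\<And>x y. \<lbrakk>x \<in> carrier M; y \<in> carrier M\<rbrakk> \<Longrightarrow> \<pi> x \<oplus>\<^bsub>Q\<^esub> \<pi> y = \<pi> (x \<oplus>\<^bsub>M\<^esub> y)"
    and zero: "\<zero>\<^bsub>Q\<^esub> = \<pi> \<zero>\<^bsub>M\<^esub>"
    and smult: "\<And>r x. \<lbrakk>r \<in> carrier R; x \<in> carrier M\<rbrakk> \<Longrightarrow> r \<odot>\<^bsub>Q\<^esub> \<pi> x = \<pi> (r \<odot>\<^bsub>M\<^esub> x)"
  shows "module R Q"
proof -
  interpret M: module R M by fact
  have neg: "\<exists>y\<in>carrier Q. y \<oplus>\<^bsub>Q\<^esub> \<pi> x = \<zero>\<^bsub>Q\<^esub>" if x: "x \<in> carrier M" for x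
    using x by (intro bexI[of _ "\<pi> (\<ominus>\<^bsub>M\<^esub> x)"]) (auto simp: carr add zero M.M.l_neg)
  show ?thesis
    by (intro moduleI abelian_groupI M.R.is_cring)
      (use neg in \<open>auto simp: carr add zero smult M.M.a_ac M.smult_l_distr M.smult_r_distr
        M.smult_assoc1\<close>)
qed

lemma ralg_surj:
  assumes A: "ralg R A" and Q: "module R Q"
    and carr: "carrier Q = \<pi> ` carrier A"
    and add: "\<And>x y. \<lbrakk>x \<in> carrier A; y \<in> carrier A\<rbrakk> \<Longrightarrow> \<pi> x \<oplus>\<^bsub>Q\<^esub> \<pi> y = \<pi> (x \<oplus>\<^bsub>A\<^esub> y)"
    and smult: "\<And>r x. \<lbrakk>r \<in> carrier R; x \<in> carrier A\<rbrakk> \<Longrightarrow> r \<odot>\<^bsub>Q\<^esub> \<pi> x = \<pi> (r \<odot>\<^bsub>A\<^esub> x)"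
    and mult: "\<And>x y. \<lbrakk>x \<in> carrier A; y \<in> carrier A\<rbrakk> \<Longrightarrow> \<pi> x \<otimes>\<^bsub>Q\<^esub> \<pi> y = \<pi> (x \<otimes>\<^bsub>A\<^esub> y)"
    and one: "\<one>\<^bsub>Q\<^esub> = \<pi> \<one>\<^bsub>A\<^esub>"
  shows "ralg R Q"
proof -
  interpret A: ralg R A by fact
  interpret Q: module R Q by fact
  show ?thesis
    by (intro ralg.intro ralg_axioms.intro Q ringI Q.M.abelian_group_axioms monoidI)
      (auto simp: carr add mult one smult A.smult_mult_left A.smult_mult_right A.m_assoc
        A.l_distr A.r_distr)
qed

section \<open>Free modules and free algebras\<close>

lemma free_module_carrier:
  "p \<in> carrier (free_module R X) \<longleftrightarrow>
    (\<forall>x. p x \<in> carrier R) \<and> finite {x. p x \<noteq> \<zero>\<^bsub>R\<^esub>} \<and> {x. p x \<noteq> \<zero>\<^bsub>R\<^esub>} \<subseteq> X"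
  and free_module_zero: "\<zero>\<^bsub>free_module R X\<^esub> = (\<lambda>x. \<zero>\<^bsub>R\<^esub>)"
  and free_module_add: "p \<oplus>\<^bsub>free_module R X\<^esub> q = (\<lambda>x. p x \<oplus>\<^bsub>R\<^esub> q x)"
  and free_module_smult: "r \<odot>\<^bsub>free_module R X\<^esub> p = (\<lambda>x. r \<otimes>\<^bsub>R\<^esub> p x)"
  by (auto simp: free_module_def)

lemmas free_module_simps = free_module_zero free_module_add free_module_smult

lemma free_module_add_closed:
  assumes "cring R" "p \<in> carrier (free_module R X)" "q \<in> carrier (free_module R X)"
  shows "p \<oplus>\<^bsub>free_module R X\<^esub> q \<in> carrier (free_module R X)"
proof -
  interpret cring R by fact
  have "{x. p x \<oplus>\<^bsub>R\<^esub> q x \<noteq> \<zero>\<^bsub>R\<^esub>} \<subseteq> {x. p x \<noteq> \<zero>\<^bsub>R\<^esub>} \<union> {x. q x \<noteq> \<zero>\<^bsub>R\<^esub>}"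
    by auto
  moreover have "finite ({x. p x \<noteq> \<zero>\<^bsub>R\<^esub>} \<union> {x. q x \<noteq> \<zero>\<^bsub>R\<^esub>})"
    using assms by (simp add: free_module_carrier)
  ultimately show ?thesis
    using assms finite_subset unfolding free_module_carrier free_module_add
    by (blast intro: a_closed)
qed

lemma free_module_smult_closed:
  assumes "cring R" "r \<in> carrier R" "p \<in> carrier (free_module R X)"
  shows "r \<odot>\<^bsub>free_module R X\<^esub> p \<in> carrier (free_module R X)"
proof -
  interpret cring R by fact
  have "{x. r \<otimes>\<^bsub>R\<^esub> p x \<noteq> \<zero>\<^bsub>R\<^esub>} \<subseteq> {x. p x \<noteq> \<zero>\<^bsub>R\<^esub>}"
    using assms by auto
  then show ?thesis
    using assms finite_subset unfolding free_module_carrier free_module_smult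
    by (blast intro: m_closed)
qed

lemma free_module_is_module:
  assumes "cring R"
  shows "module R (free_module R X)"
proof -
  interpret cring R by fact
  let ?F = "free_module R X"
  have c: "p x \<in> carrier R" if "p \<in> carrier ?F" for p x
    using that by (simp add: free_module_carrier)
  show ?thesis
  proof (intro moduleI abelian_groupI assms)
    fix p assume p: "p \<in> carrier ?F"
    show "\<exists>q\<in>carrier ?F. q \<oplus>\<^bsub>?F\<^esub> p = \<zero>\<^bsub>?F\<^esub>"
    proof (intro bexI[of _ "(\<ominus>\<^bsub>R\<^esub> \<one>\<^bsub>R\<^esub>) \<odot>\<^bsub>?F\<^esub> p"] free_module_smult_closed assms p)
      have "(\<ominus>\<^bsub>R\<^esub> \<one>\<^bsub>R\<^esub>) \<otimes>\<^bsub>R\<^esub> p x \<oplus>\<^bsub>R\<^esub> p x = \<zero>\<^bsub>R\<^esub>" for x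
        using c[OF p] by (simp add: l_minus l_neg)
      then show "(\<ominus>\<^bsub>R\<^esub> \<one>\<^bsub>R\<^esub>) \<odot>\<^bsub>?F\<^esub> p \<oplus>\<^bsub>?F\<^esub> p = \<zero>\<^bsub>?F\<^esub>"
        by (simp add: free_module_simps)
    qed simp
  next
    show "\<zero>\<^bsub>?F\<^esub> \<in> carrier ?F"
      by (simp add: free_module_carrier free_module_zero)
  qed (use c in \<open>simp_all add: free_module_add_closed[OF assms] free_module_smult_closed[OF assms],
      simp_all add: free_module_simps a_ac l_distr r_distr m_assoc\<close>)
qed

lemma basis_elt_closed:
  assumes "cring R" "x \<in> X"
  shows "basis_elt R x \<in> carrier (free_module R X)"
proof -
  interpret cring R by fact
  have "{y. basis_elt R x y \<noteq> \<zero>\<^bsub>R\<^esub>} \<subseteq> {x}"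
    by (auto simp: basis_elt_def)
  moreover have "\<forall>y. basis_elt R x y \<in> carrier R"
    by (auto simp: basis_elt_def)
  ultimately show ?thesis
    using assms(2) finite_subset[of _ "{x}"] unfolding free_module_carrier by blast
qed

text \<open>Induction along the support: strip off one coefficient at a time.\<close>

lemma free_module_induct [consumes 2, case_names zero step]:
  assumes "cring R" and p: "p \<in> carrier (free_module R X)"
    and zero: "P \<zero>\<^bsub>free_module R X\<^esub>"
    and step: "\<And>q r x. \<lbrakk>q \<in> carrier (free_module R X); r \<in> carrier R; x \<in> X; P q\<rbrakk>
        \<Longrightarrow> P (q \<oplus>\<^bsub>free_module R X\<^esub> r \<odot>\<^bsub>free_module R X\<^esub> basis_elt R x)"
  shows "P p"
proof -
  interpret cring R by fact
  have "P p" if "finite S" "p \<in> carrier (free_module R X)" "{x. p x \<noteq> \<zero>\<^bsub>R\<^esub>} = S" for S p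
    using that
  proof (induction S arbitrary: p)
    case empty
    then have "p = \<zero>\<^bsub>free_module R X\<^esub>"
      by (auto simp: free_module_zero)
    then show ?case using zero by simp
  next
    case (insert x S)
    define q where "q = p(x := \<zero>\<^bsub>R\<^esub>)"
    have pc: "p y \<in> carrier R" for y
      using insert.prems by (simp add: free_module_carrier)
    have S: "{y. q y \<noteq> \<zero>\<^bsub>R\<^esub>} = S"
      using insert.prems(2) insert.hyps by (auto simp: q_def)
    then have qc: "q \<in> carrier (free_module R X)"
      using insert.prems insert.hyps by (auto simp: free_module_carrier q_def)
    have "x \<in> X"
      using insert.prems by (auto simp: free_module_carrier)
    moreover have "p = q \<oplus>\<^bsub>free_module R X\<^esub> p x \<odot>\<^bsub>free_module R X\<^esub> basis_elt R x"
      using pc by (auto simp: free_module_simps q_def basis_elt_def fun_eq_iff)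
    ultimately show ?case
      using step[OF qc, of "p x" x] insert.IH[OF qc S] pc by simp
  qed
  then show ?thesis
    using p by (auto simp: free_module_carrier)
qed

lemma lin_eq_on_basis:
  assumes "cring R" "module R N" "f \<in> lin R (free_module R X) N" "g \<in> lin R (free_module R X) N"
    and eq: "\<And>x. x \<in> X \<Longrightarrow> f (basis_elt R x) = g (basis_elt R x)"
    and p: "p \<in> carrier (free_module R X)"
  shows "f p = g p"
  using assms(1) p
proof (induction rule: free_module_induct)
  case zero
  show ?case
    using lin_zero[OF free_module_is_module[OF assms(1)] assms(2) assms(3)]
      lin_zero[OF free_module_is_module[OF assms(1)] assms(2) assms(4)] by simp
next
  case (step q r x)
  note b = basis_elt_closed[OF assms(1) step.hyps(3)]
  show ?case
    using step b eq free_module_smult_closed[OF assms(1) step.hyps(2) b]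
    by (simp add: lin_add[OF assms(3)] lin_add[OF assms(4)] lin_smult[OF assms(3)]
        lin_smult[OF assms(4)])
qed

text \<open>The sum defining \<^const>\<open>linear_ext\<close> runs over the support of \<open>p\<close>; two such sums can be
  added only after both have been extended to a common finite index set.\<close>

lemma linear_ext_sum:
  assumes "module R C" "f \<in> X \<rightarrow> carrier C" "p \<in> carrier (free_module R X)"
    and S: "finite S" "{x. p x \<noteq> \<zero>\<^bsub>R\<^esub>} \<subseteq> S" "S \<subseteq> X"
  shows "linear_ext R C f p = (\<Oplus>\<^bsub>C\<^esub>x\<in>S. p x \<odot>\<^bsub>C\<^esub> f x)"
proof -
  interpret C: module R C by fact
  show ?thesis
    unfolding linear_ext_def
    using assms by (intro C.M.add.finprod_mono_neutral_cong_left)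
      (auto simp: free_module_carrier Pi_iff subset_iff)
qed

lemma linear_ext_lin:
  assumes "module R C" "f \<in> X \<rightarrow> carrier C"
  shows "linear_ext R C f \<in> lin R (free_module R X) C"
proof -
  interpret C: module R C by fact
  let ?F = "free_module R X"
  have cl: "(\<lambda>x. p x \<odot>\<^bsub>C\<^esub> f x) \<in> S \<rightarrow> carrier C" if "p \<in> carrier ?F" "S \<subseteq> X" for p S
    using that assms(2) by (auto simp: free_module_carrier)
  show ?thesis
  proof (rule linI)
    fix p q assume pq: "p \<in> carrier ?F" "q \<in> carrier ?F"
    define S where "S = {x. p x \<noteq> \<zero>\<^bsub>R\<^esub>} \<union> {x. q x \<noteq> \<zero>\<^bsub>R\<^esub>}"
    have S: "finite S" "S \<subseteq> X" "{x. p x \<noteq> \<zero>\<^bsub>R\<^esub>} \<subseteq> S" "{x. q x \<noteq> \<zero>\<^bsub>R\<^esub>} \<subseteq> S"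
      using pq by (auto simp: S_def free_module_carrier)
    have Sa: "{x. (p \<oplus>\<^bsub>?F\<^esub> q) x \<noteq> \<zero>\<^bsub>R\<^esub>} \<subseteq> S"
      by (auto simp: S_def free_module_simps)
    have "linear_ext R C f (p \<oplus>\<^bsub>?F\<^esub> q) = (\<Oplus>\<^bsub>C\<^esub>x\<in>S. (p \<oplus>\<^bsub>?F\<^esub> q) x \<odot>\<^bsub>C\<^esub> f x)"
      by (intro linear_ext_sum[OF assms] free_module_add_closed C.R.is_cring pq S Sa)
    also have "\<dots> = (\<Oplus>\<^bsub>C\<^esub>x\<in>S. p x \<odot>\<^bsub>C\<^esub> f x \<oplus>\<^bsub>C\<^esub> q x \<odot>\<^bsub>C\<^esub> f x)"
      using pq S(2) assms(2)
      by (intro C.M.finsum_cong')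
        (auto simp: free_module_simps free_module_carrier subset_iff Pi_iff C.smult_l_distr)
    also have "\<dots> = (\<Oplus>\<^bsub>C\<^esub>x\<in>S. p x \<odot>\<^bsub>C\<^esub> f x) \<oplus>\<^bsub>C\<^esub> (\<Oplus>\<^bsub>C\<^esub>x\<in>S. q x \<odot>\<^bsub>C\<^esub> f x)"
      by (intro C.M.finsum_addf cl pq S)
    finally show "linear_ext R C f (p \<oplus>\<^bsub>?F\<^esub> q) = linear_ext R C f p \<oplus>\<^bsub>C\<^esub> linear_ext R C f q"
      using linear_ext_sum[OF assms pq(1) S(1,3,2)] linear_ext_sum[OF assms pq(2) S(1,4,2)] by simp
  next
    fix r p assume rp: "r \<in> carrier R" "p \<in> carrier ?F"
    define S where "S = {x. p x \<noteq> \<zero>\<^bsub>R\<^esub>}"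
    have S: "finite S" "S \<subseteq> X" "{x. p x \<noteq> \<zero>\<^bsub>R\<^esub>} \<subseteq> S"
      using rp by (auto simp: S_def free_module_carrier)
    have Sa: "{x. (r \<odot>\<^bsub>?F\<^esub> p) x \<noteq> \<zero>\<^bsub>R\<^esub>} \<subseteq> S"
      using rp by (auto simp: S_def free_module_simps)
    have "linear_ext R C f (r \<odot>\<^bsub>?F\<^esub> p) = (\<Oplus>\<^bsub>C\<^esub>x\<in>S. (r \<odot>\<^bsub>?F\<^esub> p) x \<odot>\<^bsub>C\<^esub> f x)"
      by (intro linear_ext_sum[OF assms] free_module_smult_closed C.R.is_cring rp S Sa)
    also have "\<dots> = (\<Oplus>\<^bsub>C\<^esub>x\<in>S. r \<odot>\<^bsub>C\<^esub> (p x \<odot>\<^bsub>C\<^esub> f x))"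
      using rp S(2) assms(2)
      by (intro C.M.finsum_cong')
        (auto simp: free_module_simps free_module_carrier subset_iff Pi_iff C.smult_assoc1)
    also have "\<dots> = r \<odot>\<^bsub>C\<^esub> (\<Oplus>\<^bsub>C\<^esub>x\<in>S. p x \<odot>\<^bsub>C\<^esub> f x)"
      by (intro C.finsum_smult_ldistr[symmetric] cl rp S)
    finally show "linear_ext R C f (r \<odot>\<^bsub>?F\<^esub> p) = r \<odot>\<^bsub>C\<^esub> linear_ext R C f p"
      using linear_ext_sum[OF assms rp(2) S(1,3,2)] by simp
  next
    fix p assume p: "p \<in> carrier ?F"
    then show "linear_ext R C f p \<in> carrier C"
      unfolding linear_ext_def by (intro C.M.finsum_closed cl) (auto simp: free_module_carrier)
  qed
qed

lemma linear_ext_basis: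
  assumes "module R C" "f \<in> X \<rightarrow> carrier C" "x \<in> X"
  shows "linear_ext R C f (basis_elt R x) = f x"
proof -
  interpret C: module R C by fact
  have "linear_ext R C f (basis_elt R x) = (\<Oplus>\<^bsub>C\<^esub>y\<in>{x}. basis_elt R x y \<odot>\<^bsub>C\<^esub> f y)"
    using assms
    by (intro linear_ext_sum[OF assms(1,2)] basis_elt_closed C.R.is_cring)
      (auto simp: basis_elt_def)
  also have "\<dots> = (\<Oplus>\<^bsub>C\<^esub>y\<in>{x}. f y)"
    using assms C.smult_one by (intro C.M.finsum_cong') (auto simp: basis_elt_def Pi_iff)
  finally show ?thesis
    using assms by (auto simp: Pi_iff)
qed

subsection \<open>The free algebra\<close>

lemma free_algebra_fields:
  "carrier (free_algebra R X) = carrier (free_module R (lists X))"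
  "add (free_algebra R X) = add (free_module R (lists X))"
  "zero (free_algebra R X) = zero (free_module R (lists X))"
  "smult (free_algebra R X) = smult (free_module R (lists X))"
  "one (free_algebra R X) = basis_elt R []"
  "mult (free_algebra R X) =
    (\<lambda>p q w. \<Oplus>\<^bsub>R\<^esub>i\<in>{..length w}. p (take i w) \<otimes>\<^bsub>R\<^esub> q (drop i w))"
  by (simp_all add: free_algebra_def free_module_def)

lemma free_algebra_lin:
  "lin R (free_algebra R X) N = lin R (free_module R (lists X)) N"
  "lin R N (free_algebra R X) = lin R N (free_module R (lists X))"
  by (simp_all add: lin_def free_algebra_fields)

lemma free_algebra_is_module:
  assumes "cring R"
  shows "module R (free_algebra R X)"
  using free_module_is_module[OF assms, of "lists X"]
  by (rule module_surj[where \<pi> = "\<lambda>x. x"]) (simp_all add: free_algebra_fields)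

lemma free_algebra_mult_closed:
  assumes "cring R" "p \<in> carrier (free_algebra R X)" "q \<in> carrier (free_algebra R X)"
  shows "p \<otimes>\<^bsub>free_algebra R X\<^esub> q \<in> carrier (free_algebra R X)"
proof -
  interpret cring R by fact
  let ?pq = "p \<otimes>\<^bsub>free_algebra R X\<^esub> q"
  have c: "p w \<in> carrier R" "q w \<in> carrier R" for w
    using assms by (auto simp: free_algebra_fields free_module_carrier)
  define P Q where "P = {w. p w \<noteq> \<zero>\<^bsub>R\<^esub>}" and "Q = {w. q w \<noteq> \<zero>\<^bsub>R\<^esub>}"
  have PQ: "finite P" "finite Q" "P \<subseteq> lists X" "Q \<subseteq> lists X"
    using assms by (auto simp: P_def Q_def free_algebra_fields free_module_carrier)
  have supp: "w \<in> (\<lambda>(u, v). u @ v) ` (P \<times> Q)" if "?pq w \<noteq> \<zero>\<^bsub>R\<^esub>" for w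
  proof -
    have "\<exists>i\<le>length w. p (take i w) \<otimes>\<^bsub>R\<^esub> q (drop i w) \<noteq> \<zero>\<^bsub>R\<^esub>"
    proof (rule ccontr)
      assume "\<not> ?thesis"
      then have "?pq w = \<zero>\<^bsub>R\<^esub>"
        unfolding free_algebra_fields by (intro add.finprod_one_eqI) auto
      then show False using that by simp
    qed
    then obtain i where "p (take i w) \<otimes>\<^bsub>R\<^esub> q (drop i w) \<noteq> \<zero>\<^bsub>R\<^esub>"
      by auto
    then have "take i w \<in> P" "drop i w \<in> Q"
      using c by (auto simp: P_def Q_def)
    then show ?thesis
      by (intro image_eqI[of _ _ "(take i w, drop i w)"]) auto
  qed
  have "?pq w \<in> carrier R" for w
    unfolding free_algebra_fields using c by (intro finsum_closed) auto
  moreover have "finite {w. ?pq w \<noteq> \<zero>\<^bsub>R\<^esub>}"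
    by (rule finite_subset[of _ "(\<lambda>(u, v). u @ v) ` (P \<times> Q)"])
      (use supp in blast, use PQ in simp)
  moreover have "{w. ?pq w \<noteq> \<zero>\<^bsub>R\<^esub>} \<subseteq> lists X"
  proof
    fix w assume "w \<in> {w. ?pq w \<noteq> \<zero>\<^bsub>R\<^esub>}"
    then have "w \<in> (\<lambda>(u, v). u @ v) ` (P \<times> Q)"
      by (intro supp) simp
    then obtain u v where "w = u @ v" "u \<in> P" "v \<in> Q"
      by (elim imageE SigmaE) simp
    then show "w \<in> lists X"
      using PQ by auto
  qed
  ultimately show ?thesis
    by (simp add: free_algebra_fields(1) free_module_carrier)
qed

lemma free_algebra_mult_lin:
  assumes "cring R"
  shows "q \<in> carrier (free_algebra R X) \<Longrightarrow>
      (\<lambda>p. p \<otimes>\<^bsub>free_algebra R X\<^esub> q) \<in> lin R (free_algebra R X) (free_algebra R X)"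
    and "p \<in> carrier (free_algebra R X) \<Longrightarrow>
      (\<lambda>q. p \<otimes>\<^bsub>free_algebra R X\<^esub> q) \<in> lin R (free_algebra R X) (free_algebra R X)"
proof -
  interpret cring R by fact
  let ?F = "free_algebra R X"
  have c: "p w \<in> carrier R" if "p \<in> carrier ?F" for p w
    using that by (auto simp: free_algebra_fields free_module_carrier)
  note simps = free_algebra_fields(2-4,6) free_module_simps fun_eq_iff
  {
    assume q: "q \<in> carrier ?F"
    show "(\<lambda>p. p \<otimes>\<^bsub>?F\<^esub> q) \<in> lin R ?F ?F"
    proof (rule linI)
      fix x y assume xy: "x \<in> carrier ?F" "y \<in> carrier ?F"
      have "(\<Oplus>\<^bsub>R\<^esub>i\<in>{..length w}. (x (take i w) \<oplus>\<^bsub>R\<^esub> y (take i w)) \<otimes>\<^bsub>R\<^esub> q (drop i w)) =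
        (\<Oplus>\<^bsub>R\<^esub>i\<in>{..length w}. x (take i w) \<otimes>\<^bsub>R\<^esub> q (drop i w)) \<oplus>\<^bsub>R\<^esub>
        (\<Oplus>\<^bsub>R\<^esub>i\<in>{..length w}. y (take i w) \<otimes>\<^bsub>R\<^esub> q (drop i w))" for w
        using c[OF xy(1)] c[OF xy(2)] c[OF q]
        by (simp add: l_distr Pi_iff flip: finsum_addf)
      then show "(x \<oplus>\<^bsub>?F\<^esub> y) \<otimes>\<^bsub>?F\<^esub> q = x \<otimes>\<^bsub>?F\<^esub> q \<oplus>\<^bsub>?F\<^esub> y \<otimes>\<^bsub>?F\<^esub> q"
        by (simp add: simps)
    next
      fix r x assume rx: "r \<in> carrier R" "x \<in> carrier ?F"
      have "(\<Oplus>\<^bsub>R\<^esub>i\<in>{..length w}. (r \<otimes>\<^bsub>R\<^esub> x (take i w)) \<otimes>\<^bsub>R\<^esub> q (drop i w)) =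
        r \<otimes>\<^bsub>R\<^esub> (\<Oplus>\<^bsub>R\<^esub>i\<in>{..length w}. x (take i w) \<otimes>\<^bsub>R\<^esub> q (drop i w))" for w
        using c[OF rx(2)] c[OF q] rx by (simp add: m_assoc finsum_rdistr Pi_iff)
      then show "(r \<odot>\<^bsub>?F\<^esub> x) \<otimes>\<^bsub>?F\<^esub> q = r \<odot>\<^bsub>?F\<^esub> (x \<otimes>\<^bsub>?F\<^esub> q)"
        by (simp add: simps)
    qed (rule free_algebra_mult_closed[OF assms _ q])
  }
  {
    assume p: "p \<in> carrier ?F"
    show "(\<lambda>q. p \<otimes>\<^bsub>?F\<^esub> q) \<in> lin R ?F ?F"
    proof (rule linI)
      fix x y assume xy: "x \<in> carrier ?F" "y \<in> carrier ?F"
      have "(\<Oplus>\<^bsub>R\<^esub>i\<in>{..length w}. p (take i w) \<otimes>\<^bsub>R\<^esub> (x (drop i w) \<oplus>\<^bsub>R\<^esub> y (drop i w))) =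
        (\<Oplus>\<^bsub>R\<^esub>i\<in>{..length w}. p (take i w) \<otimes>\<^bsub>R\<^esub> x (drop i w)) \<oplus>\<^bsub>R\<^esub>
        (\<Oplus>\<^bsub>R\<^esub>i\<in>{..length w}. p (take i w) \<otimes>\<^bsub>R\<^esub> y (drop i w))" for w
        using c[OF xy(1)] c[OF xy(2)] c[OF p]
        by (simp add: r_distr Pi_iff flip: finsum_addf)
      then show "p \<otimes>\<^bsub>?F\<^esub> (x \<oplus>\<^bsub>?F\<^esub> y) = p \<otimes>\<^bsub>?F\<^esub> x \<oplus>\<^bsub>?F\<^esub> p \<otimes>\<^bsub>?F\<^esub> y"
        by (simp add: simps)
    next
      fix r x assume rx: "r \<in> carrier R" "x \<in> carrier ?F"
      have "(\<Oplus>\<^bsub>R\<^esub>i\<in>{..length w}. p (take i w) \<otimes>\<^bsub>R\<^esub> (r \<otimes>\<^bsub>R\<^esub> x (drop i w))) =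
        r \<otimes>\<^bsub>R\<^esub> (\<Oplus>\<^bsub>R\<^esub>i\<in>{..length w}. p (take i w) \<otimes>\<^bsub>R\<^esub> x (drop i w))" for w
        using c[OF rx(2)] c[OF p] rx by (simp add: m_lcomm finsum_rdistr Pi_iff)
      then show "p \<otimes>\<^bsub>?F\<^esub> (r \<odot>\<^bsub>?F\<^esub> x) = r \<odot>\<^bsub>?F\<^esub> (p \<otimes>\<^bsub>?F\<^esub> x)"
        by (simp add: simps)
    qed (rule free_algebra_mult_closed[OF assms p])
  }
qed

lemma free_algebra_mult_basis:
  assumes "cring R"
  shows "basis_elt R u \<otimes>\<^bsub>free_algebra R X\<^esub> basis_elt R v = basis_elt R (u @ v)"
proof
  fix w
  interpret cring R by fact
  define d where "d = basis_elt R (u @ v) w"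
  have d: "d \<in> carrier R"
    by (simp add: d_def basis_elt_def)
  have term_eq: "basis_elt R u (take i w) \<otimes>\<^bsub>R\<^esub> basis_elt R v (drop i w) =
      (if length u = i then d else \<zero>\<^bsub>R\<^esub>)" if "i \<in> {..length w}" for i
  proof -
    have "take i w = u \<and> drop i w = v \<longleftrightarrow> length u = i \<and> w = u @ v"
    proof
      assume uv: "take i w = u \<and> drop i w = v"
      then have "w = u @ v" by (metis append_take_drop_id)
      moreover have "length u = i" using uv that by (metis atMost_iff length_take min.absorb2)
      ultimately show "length u = i \<and> w = u @ v" by simp
    qed simp
    then show ?thesis
      by (auto simp: basis_elt_def d_def)
  qed
  have "(basis_elt R u \<otimes>\<^bsub>free_algebra R X\<^esub> basis_elt R v) w =
    (\<Oplus>\<^bsub>R\<^esub>i\<in>{..length w}. if length u = i then d else \<zero>\<^bsub>R\<^esub>)"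
    unfolding free_algebra_fields by (intro finsum_cong' term_eq) (use d in simp_all)
  also have "\<dots> = d"
  proof (cases "length u \<le> length w")
    case True
    then show ?thesis
      using finsum_singleton[of "length u" "{..length w}" "\<lambda>i. d"] d by simp
  next
    case False
    have "(\<Oplus>\<^bsub>R\<^esub>i\<in>{..length w}. if length u = i then d else \<zero>\<^bsub>R\<^esub>) = \<zero>\<^bsub>R\<^esub>"
      using False by (intro add.finprod_one_eqI) simp
    then show ?thesis
      using False by (auto simp: d_def basis_elt_def)
  qed
  finally show "(basis_elt R u \<otimes>\<^bsub>free_algebra R X\<^esub> basis_elt R v) w = basis_elt R (u @ v) w"
    by (simp add: d_def)
qed

lemma free_algebra_basis_closed:
  "\<lbrakk>cring R; w \<in> lists X\<rbrakk> \<Longrightarrow> basis_elt R w \<in> carrier (free_algebra R X)"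
  by (simp add: free_algebra_fields basis_elt_closed)

lemma free_algebra_lin_eq:
  assumes "cring R" "module R N" "f \<in> lin R (free_algebra R X) N" "g \<in> lin R (free_algebra R X) N"
    and eq: "\<And>w. w \<in> lists X \<Longrightarrow> f (basis_elt R w) = g (basis_elt R w)"
    and p: "p \<in> carrier (free_algebra R X)"
  shows "f p = g p"
  by (rule lin_eq_on_basis[OF assms(1,2), where X = "lists X"])
    (use assms(3,4) p eq in \<open>simp_all add: free_algebra_lin free_algebra_fields\<close>)

text \<open>Multiplication is bilinear and concatenates words, so the laws need only be checked on
  words.\<close>

lemma free_algebra_is_ralg:
  assumes "cring R"
  shows "ralg R (free_algebra R X)"
proof -
  let ?F = "free_algebra R X"
  interpret F: module R ?F
    using free_algebra_is_module[OF assms] .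
  note L = free_algebra_mult_lin(1)[OF assms, where X = X] and Rt = free_algebra_mult_lin(2)[OF assms, where X = X]
  note bas = free_algebra_mult_basis[OF assms, where X = X]
  note bc = free_algebra_basis_closed[OF assms, where X = X]
  note mc = free_algebra_mult_closed[OF assms, where X = X]
  note eqI = free_algebra_lin_eq[OF assms F.module_axioms]
  have one: "\<one>\<^bsub>?F\<^esub> = basis_elt R []" "\<one>\<^bsub>?F\<^esub> \<in> carrier ?F"
    using bc[of "[]"] by (auto simp: free_algebra_fields(5))
  have l_one: "\<one>\<^bsub>?F\<^esub> \<otimes>\<^bsub>?F\<^esub> p = p" if p: "p \<in> carrier ?F" for p
    by (rule eqI[OF Rt[OF one(2)] lin_id _ p]) (simp add: one(1) bas)
  have r_one: "p \<otimes>\<^bsub>?F\<^esub> \<one>\<^bsub>?F\<^esub> = p" if p: "p \<in> carrier ?F" for p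
    by (rule eqI[OF L[OF one(2)] lin_id _ p]) (simp add: one(1) bas)
  have assoc2: "(basis_elt R u \<otimes>\<^bsub>?F\<^esub> basis_elt R v) \<otimes>\<^bsub>?F\<^esub> r = basis_elt R u \<otimes>\<^bsub>?F\<^esub> (basis_elt R v \<otimes>\<^bsub>?F\<^esub> r)"
    if "u \<in> lists X" "v \<in> lists X" "r \<in> carrier ?F" for u v r
    by (rule eqI[OF Rt lin_comp[OF Rt Rt] _ that(3)])
      (use that in \<open>auto simp: bas intro!: bc\<close>)
  have assoc1: "(basis_elt R u \<otimes>\<^bsub>?F\<^esub> q) \<otimes>\<^bsub>?F\<^esub> r = basis_elt R u \<otimes>\<^bsub>?F\<^esub> (q \<otimes>\<^bsub>?F\<^esub> r)"
    if "u \<in> lists X" "q \<in> carrier ?F" "r \<in> carrier ?F" for u q r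
    by (rule eqI[OF lin_comp[OF Rt L] lin_comp[OF L Rt] _ that(2)])
      (use that assoc2 in \<open>auto intro!: bc\<close>)
  have assoc: "(p \<otimes>\<^bsub>?F\<^esub> q) \<otimes>\<^bsub>?F\<^esub> r = p \<otimes>\<^bsub>?F\<^esub> (q \<otimes>\<^bsub>?F\<^esub> r)"
    if "p \<in> carrier ?F" "q \<in> carrier ?F" "r \<in> carrier ?F" for p q r
    by (rule eqI[OF lin_comp[OF L L] L _ that(1)])
      (use that assoc1 mc in auto)
  show ?thesis
    by (intro ralg.intro F.module_axioms ringI monoidI ralg_axioms.intro F.M.abelian_group_axioms)
      (simp_all add: one(2) l_one r_one assoc mc lin_add[OF L] lin_add[OF Rt] lin_smult[OF L]
        lin_smult[OF Rt])
qed

text \<open>The evaluation of words in the definition of \<^const>\<open>fp_copair\<close>.\<close>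

definition eval_word :: "('c, 'n) ring_scheme \<Rightarrow> ('x \<Rightarrow> 'c) \<Rightarrow> 'x list \<Rightarrow> 'c" where
  "eval_word C \<phi> w = foldr (\<lambda>x y. x \<otimes>\<^bsub>C\<^esub> y) (map \<phi> w) \<one>\<^bsub>C\<^esub>"

lemma eval_word_simps [simp]:
  "eval_word C \<phi> [] = \<one>\<^bsub>C\<^esub>"
  "eval_word C \<phi> (x # w) = \<phi> x \<otimes>\<^bsub>C\<^esub> eval_word C \<phi> w"
  by (simp_all add: eval_word_def)

lemma eval_word_closed:
  assumes "ring C" "\<phi> \<in> X \<rightarrow> carrier C" "w \<in> lists X"
  shows "eval_word C \<phi> w \<in> carrier C"
proof -
  interpret ring C by fact
  show ?thesis
    using assms(3,2) by (induction w) (auto simp: Pi_iff)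
qed

lemma eval_word_append:
  assumes "ring C" "\<phi> \<in> X \<rightarrow> carrier C" "u \<in> lists X" "v \<in> lists X"
  shows "eval_word C \<phi> (u @ v) = eval_word C \<phi> u \<otimes>\<^bsub>C\<^esub> eval_word C \<phi> v"
proof -
  interpret ring C by fact
  show ?thesis
    using assms(3)
  proof (induction u)
    case Nil
    then show ?case
      using eval_word_closed[OF assms(1,2,4)] by simp
  next
    case (Cons x u)
    then show ?case
      using eval_word_closed[OF assms(1,2,4)] eval_word_closed[OF assms(1,2), of u] assms(2)
      by (auto simp: m_assoc Pi_iff)
  qed
qed

text \<open>Evaluation turns concatenation into multiplication, and both products are bilinear.\<close>

lemma free_algebra_eval_hom:
  assumes "ralg R C" "\<phi> \<in> X \<rightarrow> carrier C"
  shows "linear_ext R C (eval_word C \<phi>) \<in> ralg_hom R (free_algebra R X) C"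
proof -
  interpret C: ralg R C by fact
  let ?F = "free_algebra R X" and ?h = "linear_ext R C (eval_word C \<phi>)"
  have R_cring: "cring R" by (rule C.R.is_cring)
  interpret F: ralg R ?F using free_algebra_is_ralg[OF R_cring] .
  have ev: "eval_word C \<phi> \<in> lists X \<rightarrow> carrier C"
    using eval_word_closed[OF C.is_ring assms(2)] by auto
  have h: "?h \<in> lin R ?F C"
    using linear_ext_lin[OF C.is_module ev] by (simp add: free_algebra_lin)
  have hb: "?h (basis_elt R w) = eval_word C \<phi> w" if "w \<in> lists X" for w
    by (rule linear_ext_basis[OF C.is_module ev that])
  note bc = free_algebra_basis_closed[OF R_cring, where X = X]
  note eqI = free_algebra_lin_eq[OF R_cring C.is_module]
  note L = free_algebra_mult_lin(1)[OF R_cring, where X = X] and Rt = free_algebra_mult_lin(2)[OF R_cring, where X = X]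
  have CL: "(\<lambda>x. x \<otimes>\<^bsub>C\<^esub> y) \<in> lin R C C" and CR: "(\<lambda>x. y \<otimes>\<^bsub>C\<^esub> x) \<in> lin R C C"
    if "y \<in> carrier C" for y
    using that by (auto intro!: linI simp: C.l_distr C.r_distr C.smult_mult_left C.smult_mult_right)
  have hc: "?h p \<in> carrier C" if "p \<in> carrier ?F" for p
    using lin_closed[OF h that] .
  have 1: "?h (basis_elt R u \<otimes>\<^bsub>?F\<^esub> q) = ?h (basis_elt R u) \<otimes>\<^bsub>C\<^esub> ?h q"
    if "u \<in> lists X" "q \<in> carrier ?F" for u q
    by (rule eqI[OF lin_comp[OF Rt h] lin_comp[OF h CR] _ that(2)])
      (use that in \<open>auto simp: free_algebra_mult_basis[OF R_cring] hb eval_word_append[OF C.is_ring assms(2)]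
        intro!: bc eval_word_closed[OF C.is_ring assms(2)]\<close>)
  show ?thesis
  proof (rule ralg_homI[OF h])
    fix p q assume pq: "p \<in> carrier ?F" "q \<in> carrier ?F"
    show "?h (p \<otimes>\<^bsub>?F\<^esub> q) = ?h p \<otimes>\<^bsub>C\<^esub> ?h q"
      by (rule eqI[OF lin_comp[OF L h] lin_comp[OF h CL] _ pq(1)]) (use 1 pq hc in auto)
  next
    show "?h \<one>\<^bsub>?F\<^esub> = \<one>\<^bsub>C\<^esub>"
      using hb[of "[]"] by (simp add: free_algebra_fields(5))
  qed
qed

section \<open>Quotients\<close>

lemma submodule_abelian_subgroup:
  assumes "module R M" "submodule N R M"
  shows "abelian_subgroup N M"
proof -
  interpret M: module R M by fact
  show ?thesis
    using assms(2)
    by (intro abelian_subgroupI3 M.M.abelian_group_axioms additive_subgroupI submodule.axioms)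
qed

text \<open>In an algebra \<open>r x = (r 1) x\<close>, so that the two notions of quotient, by an ideal and by a
  submodule, are compatible.\<close>

lemma ideal_is_submodule:
  assumes "ralg R A" "ideal I A"
  shows "submodule I R A"
proof -
  interpret A: ralg R A by fact
  interpret I: ideal I A by fact
  have "r \<odot>\<^bsub>A\<^esub> x \<in> I" if "r \<in> carrier R" "x \<in> I" for r x
  proof -
    have "(r \<odot>\<^bsub>A\<^esub> \<one>\<^bsub>A\<^esub>) \<otimes>\<^bsub>A\<^esub> x \<in> I"
      using that by (intro I.I_l_closed) auto
    then show ?thesis
      using that I.a_Hcarr by (simp add: A.smult_mult_left)
  qed
  then show ?thesis
    using I.a_subset by (intro A.submoduleI) auto
qed

lemma graded_quot_fields:
  "carrier (graded_quot M N G) = (\<lambda>x. N +>\<^bsub>M\<^esub> x) ` carrier M"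
  "mult (graded_quot M N G) = rcoset_mult M N"
  "one (graded_quot M N G) = N +>\<^bsub>M\<^esub> \<one>\<^bsub>M\<^esub>"
  "zero (graded_quot M N G) = N"
  "add (graded_quot M N G) = set_add M"
  "smult (graded_quot M N G) = (\<lambda>r X. \<Union>x\<in>X. N +>\<^bsub>M\<^esub> (r \<odot>\<^bsub>M\<^esub> x))"
  "grade (graded_quot M N G) = (\<lambda>n. (\<lambda>x. N +>\<^bsub>M\<^esub> x) ` G n)"
  by (auto simp: graded_quot_def A_RCOSETS_def' a_r_coset_def')

lemma coset_eqI:
  assumes "module R M" "submodule N R M" "x \<in> carrier M" "y \<in> carrier M" "x \<ominus>\<^bsub>M\<^esub> y \<in> N"
  shows "N +>\<^bsub>M\<^esub> x = N +>\<^bsub>M\<^esub> y"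
proof -
  interpret M: module R M by fact
  interpret N: abelian_subgroup N M
    using submodule_abelian_subgroup assms by blast
  have "x \<in> N +>\<^bsub>M\<^esub> y"
    using N.a_rcos_module_rev[of y x] assms by (simp add: a_minus_def)
  then show ?thesis
    using N.a_repr_independence' assms(4) by simp
qed

lemma coset_smult:
  assumes "module R M" "submodule N R M" "r \<in> carrier R" "a \<in> carrier M"
  shows "(\<Union>x\<in>N +>\<^bsub>M\<^esub> a. N +>\<^bsub>M\<^esub> (r \<odot>\<^bsub>M\<^esub> x)) = N +>\<^bsub>M\<^esub> (r \<odot>\<^bsub>M\<^esub> a)"
proof -
  interpret M: module R M by fact
  interpret N: abelian_subgroup N M
    using submodule_abelian_subgroup assms by blast
  have "N +>\<^bsub>M\<^esub> (r \<odot>\<^bsub>M\<^esub> x) = N +>\<^bsub>M\<^esub> (r \<odot>\<^bsub>M\<^esub> a)" if x: "x \<in> N +>\<^bsub>M\<^esub> a" for x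
  proof -
    obtain n where n: "n \<in> N" "x = n \<oplus>\<^bsub>M\<^esub> a"
      using x by (auto simp: a_r_coset_def')
    have nc: "n \<in> carrier M" using n by simp
    have "r \<odot>\<^bsub>M\<^esub> x \<ominus>\<^bsub>M\<^esub> r \<odot>\<^bsub>M\<^esub> a = r \<odot>\<^bsub>M\<^esub> n"
      using n nc assms by (simp add: M.smult_r_distr a_minus_def M.M.a_assoc M.M.r_neg)
    moreover have "r \<odot>\<^bsub>M\<^esub> n \<in> N"
      using assms n by (simp add: submodule.smult_closed)
    ultimately show ?thesis
      using assms n nc by (intro coset_eqI[OF assms(1,2)]) auto
  qed
  moreover have "a \<in> N +>\<^bsub>M\<^esub> a"
    using N.a_rcos_self assms by blast
  ultimately show ?thesis
    by blast
qed

lemma graded_quot_proj: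
  assumes "module R M" "submodule N R M"
  shows "\<lbrakk>x \<in> carrier M; y \<in> carrier M\<rbrakk> \<Longrightarrow>
      (N +>\<^bsub>M\<^esub> x) \<oplus>\<^bsub>graded_quot M N G\<^esub> (N +>\<^bsub>M\<^esub> y) = N +>\<^bsub>M\<^esub> (x \<oplus>\<^bsub>M\<^esub> y)"
    and "\<zero>\<^bsub>graded_quot M N G\<^esub> = N +>\<^bsub>M\<^esub> \<zero>\<^bsub>M\<^esub>"
    and "\<lbrakk>r \<in> carrier R; x \<in> carrier M\<rbrakk> \<Longrightarrow>
      r \<odot>\<^bsub>graded_quot M N G\<^esub> (N +>\<^bsub>M\<^esub> x) = N +>\<^bsub>M\<^esub> (r \<odot>\<^bsub>M\<^esub> x)"
proof -
  interpret M: module R M by fact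
  interpret N: abelian_subgroup N M
    using submodule_abelian_subgroup assms by blast
  show "\<lbrakk>x \<in> carrier M; y \<in> carrier M\<rbrakk> \<Longrightarrow>
      (N +>\<^bsub>M\<^esub> x) \<oplus>\<^bsub>graded_quot M N G\<^esub> (N +>\<^bsub>M\<^esub> y) = N +>\<^bsub>M\<^esub> (x \<oplus>\<^bsub>M\<^esub> y)"
    by (simp add: graded_quot_fields N.a_rcos_sum)
  show "\<zero>\<^bsub>graded_quot M N G\<^esub> = N +>\<^bsub>M\<^esub> \<zero>\<^bsub>M\<^esub>"
    using N.a_subset by (simp add: graded_quot_fields)
  show "\<lbrakk>r \<in> carrier R; x \<in> carrier M\<rbrakk> \<Longrightarrow>
      r \<odot>\<^bsub>graded_quot M N G\<^esub> (N +>\<^bsub>M\<^esub> x) = N +>\<^bsub>M\<^esub> (r \<odot>\<^bsub>M\<^esub> x)"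
    by (simp add: graded_quot_fields coset_smult[OF assms])
qed

lemma graded_quot_is_module:
  assumes "module R M" "submodule N R M"
  shows "module R (graded_quot M N G)"
  by (rule module_surj[OF assms(1), where \<pi> = "\<lambda>x. N +>\<^bsub>M\<^esub> x"])
    (simp_all add: graded_quot_fields(1) graded_quot_proj[OF assms])

lemma graded_quot_proj_lin:
  assumes "module R M" "submodule N R M"
  shows "(\<lambda>x. N +>\<^bsub>M\<^esub> x) \<in> lin R M (graded_quot M N G)"
  by (rule linI) (simp_all add: graded_quot_fields(1) graded_quot_proj[OF assms])

lemma graded_quot_mult:
  assumes "ideal I A" "x \<in> carrier A" "y \<in> carrier A"
  shows "(I +>\<^bsub>A\<^esub> x) \<otimes>\<^bsub>graded_quot A I G\<^esub> (I +>\<^bsub>A\<^esub> y) = I +>\<^bsub>A\<^esub> (x \<otimes>\<^bsub>A\<^esub> y)"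
  using ideal.rcoset_mult_add[OF assms] by (simp add: graded_quot_fields)

lemma graded_quot_is_ralg:
  assumes "ralg R A" "ideal I A"
  shows "ralg R (graded_quot A I G)"
proof -
  interpret A: ralg R A by fact
  note s = ideal_is_submodule[OF assms]
  show ?thesis
    by (rule ralg_surj[OF assms(1) graded_quot_is_module[OF A.is_module s],
          where \<pi> = "\<lambda>x. I +>\<^bsub>A\<^esub> x"])
      (simp_all add: graded_quot_fields(1,3) graded_quot_proj[OF A.is_module s]
        graded_quot_mult[OF assms(2)])
qed

lemma graded_quot_proj_hom:
  assumes "ralg R A" "ideal I A"
  shows "(\<lambda>x. I +>\<^bsub>A\<^esub> x) \<in> ralg_hom R A (graded_quot A I G)"
proof -
  interpret A: ralg R A by fact
  show ?thesis
    by (intro ralg_homI graded_quot_proj_lin A.is_module ideal_is_submodule[OF assms])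
      (simp_all add: graded_quot_mult[OF assms(2)] graded_quot_fields(3))
qed

lemma quot_map_coset:
  assumes "module R M" "submodule N R M" "module R C" "h \<in> lin R M C"
    and "\<And>n. n \<in> N \<Longrightarrow> h n = \<zero>\<^bsub>C\<^esub>" and x: "x \<in> carrier M"
  shows "quot_map h (N +>\<^bsub>M\<^esub> x) = h x"
proof -
  interpret M: module R M by fact
  interpret C: module R C by fact
  interpret N: abelian_subgroup N M
    using submodule_abelian_subgroup assms by blast
  have "h y = h x" if y: "y \<in> N +>\<^bsub>M\<^esub> x" for y
  proof -
    obtain n where n: "n \<in> N" "y = n \<oplus>\<^bsub>M\<^esub> x"
      using y by (auto simp: a_r_coset_def')
    then show ?thesis
      using assms(5)[OF n(1)] x lin_add[OF assms(4), of n x] lin_closed[OF assms(4) x] by simp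
  qed
  moreover have "x \<in> N +>\<^bsub>M\<^esub> x"
    using N.a_rcos_self x by blast
  ultimately have "h ` (N +>\<^bsub>M\<^esub> x) = {h x}"
    by blast
  then show ?thesis
    by (simp add: quot_map_def)
qed

lemma quot_map_lin:
  assumes "module R M" "submodule N R M" "module R C" "h \<in> lin R M C"
    and "\<And>n. n \<in> N \<Longrightarrow> h n = \<zero>\<^bsub>C\<^esub>"
  shows "quot_map h \<in> lin R (graded_quot M N G) C"
proof -
  interpret M: module R M by fact
  note q = quot_map_coset[OF assms]
  show ?thesis
    by (rule linI)
      (auto simp: graded_quot_fields(1) graded_quot_proj[OF assms(1,2)] q lin_closed[OF assms(4)]
        lin_add[OF assms(4)] lin_smult[OF assms(4)])
qed

lemma quot_map_hom:
  assumes "ralg R A" "ideal I A" "ralg R C" "h \<in> ralg_hom R A C"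
    and "\<And>n. n \<in> I \<Longrightarrow> h n = \<zero>\<^bsub>C\<^esub>"
  shows "quot_map h \<in> ralg_hom R (graded_quot A I G) C"
proof -
  interpret A: ralg R A by fact
  interpret C: ralg R C by fact
  note s = ideal_is_submodule[OF assms(1,2)]
  note q = quot_map_coset[OF A.is_module s C.is_module ralg_hom_lin[OF assms(4)] assms(5)]
  show ?thesis
    by (intro ralg_homI quot_map_lin[OF A.is_module s C.is_module ralg_hom_lin[OF assms(4)] assms(5)])
      (auto simp: graded_quot_fields(1,3) graded_quot_mult[OF assms(2)] q
        ralg_hom_mult[OF assms(4)] ralg_hom_one[OF assms(4)])
qed

section \<open>The universal property of the free product\<close>

lemma ralg_hom_kernel_ideal:
  assumes "ralg R A" "ralg R C" "h \<in> ralg_hom R A C"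
  shows "ideal {x \<in> carrier A. h x = \<zero>\<^bsub>C\<^esub>} A"
proof -
  interpret A: ralg R A by fact
  interpret C: ralg R C by fact
  have "h \<in> ring_hom A C"
    using assms(3) unfolding ralg_hom_def by blast
  then have "ideal (a_kernel A C h) A"
    by (intro ring_hom_ring.kernel_is_ideal ring_hom_ringI2 A.is_ring C.is_ring)
  then show ?thesis
    unfolding a_kernel_def' .
qed

lemma hom_relations_closed:
  assumes "ralg R F" "ralg R A" "\<iota> \<in> carrier A \<rightarrow> carrier F"
  shows "hom_relations R F A \<iota> \<subseteq> carrier F"
proof -
  interpret F: ralg R F by fact
  interpret A: ralg R A by fact
  have [simp, intro]: "\<iota> a \<in> carrier F" if "a \<in> carrier A" for a
    using assms(3) that by auto
  show ?thesis
    by (auto simp: hom_relations_def)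
qed

text \<open>A map out of \<open>F\<close> that restricts to a homomorphism along \<open>\<iota>\<close> respects the relations. Together
  with the next lemma this is the universal property of the relations.\<close>

lemma hom_relations_in_kernel:
  assumes "ralg R F" "ralg R A" "ralg R C" "\<iota> \<in> carrier A \<rightarrow> carrier F"
    and h: "h \<in> ralg_hom R F C" and f: "f \<in> ralg_hom R A C"
    and eq: "\<And>a. a \<in> carrier A \<Longrightarrow> h (\<iota> a) = f a"
  shows "hom_relations R F A \<iota> \<subseteq> {x \<in> carrier F. h x = \<zero>\<^bsub>C\<^esub>}"
proof -
  interpret F: ralg R F by fact
  interpret A: ralg R A by fact
  interpret C: ralg R C by fact
  note hl = ralg_hom_lin[OF h] and fl = ralg_hom_lin[OF f]
  have [simp, intro]: "\<iota> a \<in> carrier F" if "a \<in> carrier A" for a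
    using assms(4) that by auto
  have d: "h (x \<ominus>\<^bsub>F\<^esub> y) = \<zero>\<^bsub>C\<^esub>" if "x \<in> carrier F" "y \<in> carrier F" "h x = h y" for x y
    using that lin_closed[OF hl] lin_diff[OF F.is_module C.is_module hl, of x y]
    by (simp add: a_minus_def[of C] C.M.r_neg)
  show ?thesis
    unfolding hom_relations_def
    by (auto intro!: d simp: eq lin_add[OF hl] lin_smult[OF hl] ralg_hom_mult[OF h]
        ralg_hom_one[OF h] lin_add[OF fl] lin_smult[OF fl] ralg_hom_mult[OF f] ralg_hom_one[OF f])
qed

lemma hom_relations_quot_hom:
  assumes "ralg R F" "ralg R A" "\<iota> \<in> carrier A \<rightarrow> carrier F" "ideal I F"
    and rel: "hom_relations R F A \<iota> \<subseteq> I"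
  shows "(\<lambda>a. I +>\<^bsub>F\<^esub> \<iota> a) \<in> ralg_hom R A (graded_quot F I G)"
proof -
  interpret F: ralg R F by fact
  interpret A: ralg R A by fact
  have [simp, intro]: "\<iota> a \<in> carrier F" if "a \<in> carrier A" for a
    using assms(3) that by auto
  note s = ideal_is_submodule[OF assms(1,4)]
  note eqI = coset_eqI[OF F.is_module s]
  have "I +>\<^bsub>F\<^esub> \<iota> (x \<oplus>\<^bsub>A\<^esub> y) = I +>\<^bsub>F\<^esub> (\<iota> x \<oplus>\<^bsub>F\<^esub> \<iota> y)"
    if "x \<in> carrier A" "y \<in> carrier A" for x y
  proof (rule eqI)
    show "\<iota> (x \<oplus>\<^bsub>A\<^esub> y) \<ominus>\<^bsub>F\<^esub> (\<iota> x \<oplus>\<^bsub>F\<^esub> \<iota> y) \<in> I"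
      by (rule subsetD[OF rel], unfold hom_relations_def, rule UnI1, rule UnI1, rule UnI1) (use that in blast)
  qed (use that in simp_all)
  moreover have "I +>\<^bsub>F\<^esub> \<iota> (r \<odot>\<^bsub>A\<^esub> x) = I +>\<^bsub>F\<^esub> (r \<odot>\<^bsub>F\<^esub> \<iota> x)"
    if "r \<in> carrier R" "x \<in> carrier A" for r x
  proof (rule eqI)
    show "\<iota> (r \<odot>\<^bsub>A\<^esub> x) \<ominus>\<^bsub>F\<^esub> (r \<odot>\<^bsub>F\<^esub> \<iota> x) \<in> I"
      by (rule subsetD[OF rel], unfold hom_relations_def, rule UnI1, rule UnI1, rule UnI2) (use that in blast)
  qed (use that in simp_all)
  moreover have "I +>\<^bsub>F\<^esub> \<iota> (x \<otimes>\<^bsub>A\<^esub> y) = I +>\<^bsub>F\<^esub> (\<iota> x \<otimes>\<^bsub>F\<^esub> \<iota> y)"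
    if "x \<in> carrier A" "y \<in> carrier A" for x y
  proof (rule eqI)
    show "\<iota> (x \<otimes>\<^bsub>A\<^esub> y) \<ominus>\<^bsub>F\<^esub> (\<iota> x \<otimes>\<^bsub>F\<^esub> \<iota> y) \<in> I"
      by (rule subsetD[OF rel], unfold hom_relations_def, rule UnI1, rule UnI2) (use that in blast)
  qed (use that in simp_all)
  moreover have "I +>\<^bsub>F\<^esub> \<iota> \<one>\<^bsub>A\<^esub> = I +>\<^bsub>F\<^esub> \<one>\<^bsub>F\<^esub>"
  proof (rule eqI)
    show "\<iota> \<one>\<^bsub>A\<^esub> \<ominus>\<^bsub>F\<^esub> \<one>\<^bsub>F\<^esub> \<in> I"
      by (rule subsetD[OF rel], unfold hom_relations_def, rule UnI2) simp
  qed simp_all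
  ultimately show ?thesis
    by (intro ralg_homI linI)
      (simp_all add: graded_quot_fields(1,3) graded_quot_mult[OF assms(4)]
        graded_quot_proj[OF F.is_module s])
qed

lemma
  assumes "ralg R A" "ralg R B"
  shows fp_words_ralg: "ralg R (fp_words R A B)"
    and fp_words_in1: "(\<lambda>a. basis_elt R [Inl a]) \<in> carrier A \<rightarrow> carrier (fp_words R A B)"
    and fp_words_in2: "(\<lambda>b. basis_elt R [Inr b]) \<in> carrier B \<rightarrow> carrier (fp_words R A B)"
    and fp_ideal_ideal: "ideal (fp_ideal R A B) (fp_words R A B)"
    and fp_relations_subset:
      "hom_relations R (fp_words R A B) A (\<lambda>a. basis_elt R [Inl a]) \<subseteq> fp_ideal R A B"
      "hom_relations R (fp_words R A B) B (\<lambda>b. basis_elt R [Inr b]) \<subseteq> fp_ideal R A B"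
proof -
  interpret A: ralg R A by fact
  show W: "ralg R (fp_words R A B)"
    unfolding fp_words_def by (rule free_algebra_is_ralg[OF A.R.is_cring])
  show 1: "(\<lambda>a. basis_elt R [Inl a]) \<in> carrier A \<rightarrow> carrier (fp_words R A B)"
    unfolding fp_words_def by (auto intro!: free_algebra_basis_closed A.R.is_cring)
  show 2: "(\<lambda>b. basis_elt R [Inr b]) \<in> carrier B \<rightarrow> carrier (fp_words R A B)"
    unfolding fp_words_def by (auto intro!: free_algebra_basis_closed A.R.is_cring)
  interpret W: ralg R "fp_words R A B" by (rule W)
  have sub: "hom_relations R (fp_words R A B) A (\<lambda>a. basis_elt R [Inl a]) \<union>
      hom_relations R (fp_words R A B) B (\<lambda>b. basis_elt R [Inr b]) \<subseteq> carrier (fp_words R A B)"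
    using hom_relations_closed[OF W assms(1) 1] hom_relations_closed[OF W assms(2) 2] by blast
  show "ideal (fp_ideal R A B) (fp_words R A B)"
    unfolding fp_ideal_def by (rule W.genideal_ideal[OF sub])
  show "hom_relations R (fp_words R A B) A (\<lambda>a. basis_elt R [Inl a]) \<subseteq> fp_ideal R A B"
    "hom_relations R (fp_words R A B) B (\<lambda>b. basis_elt R [Inr b]) \<subseteq> fp_ideal R A B"
    using W.genideal_self[OF sub] by (auto simp: fp_ideal_def)
qed

lemma free_product_ralg:
  "\<lbrakk>ralg R A; ralg R B\<rbrakk> \<Longrightarrow> ralg R (free_product R A B)"
  unfolding free_product_def by (rule graded_quot_is_ralg[OF fp_words_ralg fp_ideal_ideal])

lemma fp_in1_hom:
  assumes "ralg R A" "ralg R B"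
  shows "fp_in1 R A B \<in> ralg_hom R A (free_product R A B)"
  using hom_relations_quot_hom[OF fp_words_ralg[OF assms] assms(1) fp_words_in1[OF assms]
      fp_ideal_ideal[OF assms] fp_relations_subset(1)[OF assms]]
  by (simp add: free_product_def fp_in1_def[abs_def])

lemma fp_in2_hom:
  assumes "ralg R A" "ralg R B"
  shows "fp_in2 R A B \<in> ralg_hom R B (free_product R A B)"
  using hom_relations_quot_hom[OF fp_words_ralg[OF assms] assms(2) fp_words_in2[OF assms]
      fp_ideal_ideal[OF assms] fp_relations_subset(2)[OF assms]]
  by (simp add: free_product_def fp_in2_def[abs_def])

lemma fp_copair_eval:
  "fp_copair R C f g = quot_map (linear_ext R C (eval_word C (case_sum f g)))"
  by (simp add: fp_copair_def eval_word_def[abs_def])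

lemma
  assumes A: "ralg R A" and B: "ralg R B" and C: "ralg R C"
    and f: "f \<in> ralg_hom R A C" and g: "g \<in> ralg_hom R B C"
  shows fp_copair_hom: "fp_copair R C f g \<in> ralg_hom R (free_product R A B) C"
    and fp_copair_coset: "p \<in> carrier (fp_words R A B) \<Longrightarrow>
      fp_copair R C f g (fp_ideal R A B +>\<^bsub>fp_words R A B\<^esub> p) =
      linear_ext R C (eval_word C (case_sum f g)) p"
    and fp_copair_in1: "a \<in> carrier A \<Longrightarrow> fp_copair R C f g (fp_in1 R A B a) = f a"
    and fp_copair_in2: "b \<in> carrier B \<Longrightarrow> fp_copair R C f g (fp_in2 R A B b) = g b"
proof -
  interpret A: ralg R A by fact
  interpret B: ralg R B by fact
  interpret C: ralg R C by fact
  let ?W = "fp_words R A B" and ?X = "Inl ` carrier A \<union> Inr ` carrier B"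
  let ?h = "linear_ext R C (eval_word C (case_sum f g))"
  interpret W: ralg R ?W by (rule fp_words_ralg[OF A B])
  note I = fp_ideal_ideal[OF A B]
  have \<phi>: "case_sum f g \<in> ?X \<rightarrow> carrier C"
    using ralg_hom_closed[OF f] ralg_hom_closed[OF g] by auto
  have h: "?h \<in> ralg_hom R ?W C"
    unfolding fp_words_def by (rule free_algebra_eval_hom[OF C \<phi>])
  have ev: "eval_word C (case_sum f g) \<in> lists ?X \<rightarrow> carrier C"
    using eval_word_closed[OF C.is_ring \<phi>] by auto
  have h1: "?h (basis_elt R [Inl a]) = f a" if "a \<in> carrier A" for a
    using linear_ext_basis[OF C.is_module ev, of "[Inl a]"] that ralg_hom_closed[OF f that] by auto
  have h2: "?h (basis_elt R [Inr b]) = g b" if "b \<in> carrier B" for b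
    using linear_ext_basis[OF C.is_module ev, of "[Inr b]"] that ralg_hom_closed[OF g that] by auto
  have "hom_relations R ?W A (\<lambda>a. basis_elt R [Inl a]) \<subseteq> {x \<in> carrier ?W. ?h x = \<zero>\<^bsub>C\<^esub>}"
    by (rule hom_relations_in_kernel[OF W.ralg_axioms A C fp_words_in1[OF A B] h f]) (rule h1)
  moreover have "hom_relations R ?W B (\<lambda>b. basis_elt R [Inr b]) \<subseteq> {x \<in> carrier ?W. ?h x = \<zero>\<^bsub>C\<^esub>}"
    by (rule hom_relations_in_kernel[OF W.ralg_axioms B C fp_words_in2[OF A B] h g]) (rule h2)
  ultimately have "fp_ideal R A B \<subseteq> {x \<in> carrier ?W. ?h x = \<zero>\<^bsub>C\<^esub>}"
    unfolding fp_ideal_def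
    by (intro W.genideal_minimal ralg_hom_kernel_ideal[OF W.ralg_axioms C h] Un_least)
  then have van: "?h n = \<zero>\<^bsub>C\<^esub>" if "n \<in> fp_ideal R A B" for n
    using that by auto
  show "fp_copair R C f g \<in> ralg_hom R (free_product R A B) C"
    unfolding fp_copair_eval free_product_def
    by (rule quot_map_hom[OF W.ralg_axioms I C h van])
  show coset: "fp_copair R C f g (fp_ideal R A B +>\<^bsub>fp_words R A B\<^esub> p) =
      linear_ext R C (eval_word C (case_sum f g)) p" if "p \<in> carrier ?W" for p
    unfolding fp_copair_eval
    by (rule quot_map_coset[OF W.is_module ideal_is_submodule[OF W.ralg_axioms I] C.is_module
        ralg_hom_lin[OF h] van that])
  show "fp_copair R C f g (fp_in1 R A B a) = f a" if "a \<in> carrier A"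
    unfolding fp_in1_def using that fp_words_in1[OF A B] by (subst coset) (auto simp: h1)
  show "fp_copair R C f g (fp_in2 R A B b) = g b" if "b \<in> carrier B"
    unfolding fp_in2_def using that fp_words_in2[OF A B] by (subst coset) (auto simp: h2)
qed

text \<open>Every word is a product of one-letter words, and these are the images of the two inclusions.\<close>

lemma free_product_hom_eqI:
  assumes A: "ralg R A" and B: "ralg R B" and C: "ralg R C"
    and h: "h \<in> ralg_hom R (free_product R A B) C" and k: "k \<in> ralg_hom R (free_product R A B) C"
    and eq1: "\<And>a. a \<in> carrier A \<Longrightarrow> h (fp_in1 R A B a) = k (fp_in1 R A B a)"
    and eq2: "\<And>b. b \<in> carrier B \<Longrightarrow> h (fp_in2 R A B b) = k (fp_in2 R A B b)"
    and z: "z \<in> carrier (free_product R A B)"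
  shows "h z = k z"
proof -
  interpret A: ralg R A by fact
  interpret C: ralg R C by fact
  let ?W = "fp_words R A B" and ?X = "Inl ` carrier A \<union> Inr ` carrier B"
  let ?\<pi> = "\<lambda>x. fp_ideal R A B +>\<^bsub>?W\<^esub> x"
  note R_cring = A.R.is_cring
  have \<pi>: "?\<pi> \<in> ralg_hom R ?W (free_product R A B)"
    unfolding free_product_def
    by (rule graded_quot_proj_hom[OF fp_words_ralg[OF A B] fp_ideal_ideal[OF A B]])
  note h' = ralg_hom_comp[OF \<pi> h] and k' = ralg_hom_comp[OF \<pi> k]
  have word: "h (?\<pi> (basis_elt R w)) = k (?\<pi> (basis_elt R w))" if "w \<in> lists ?X" for w
    using that
  proof (induction w)
    case Nil
    show ?case
      using ralg_hom_one[OF h'] ralg_hom_one[OF k']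
      by (simp add: fp_words_def free_algebra_fields(5))
  next
    case (Cons x w)
    have c: "basis_elt R [x] \<in> carrier ?W" "basis_elt R w \<in> carrier ?W"
      using Cons.hyps unfolding fp_words_def by (auto intro!: free_algebra_basis_closed[OF R_cring])
    have split: "basis_elt R (x # w) = basis_elt R [x] \<otimes>\<^bsub>?W\<^esub> basis_elt R w"
      unfolding fp_words_def by (simp add: free_algebra_mult_basis[OF R_cring])
    have "h (?\<pi> (basis_elt R [x])) = k (?\<pi> (basis_elt R [x]))"
      using Cons.hyps eq1 eq2 by (auto simp: fp_in1_def fp_in2_def)
    then show ?case
      using Cons.IH ralg_hom_mult[OF h' c] ralg_hom_mult[OF k' c] unfolding split by simp
  qed
  obtain p where p: "p \<in> carrier ?W" "z = ?\<pi> p"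
    using z unfolding free_product_def graded_quot_fields(1) by blast
  have "h (?\<pi> p) = k (?\<pi> p)"
    using free_algebra_lin_eq[OF R_cring C.is_module, of "\<lambda>p. h (?\<pi> p)" ?X "\<lambda>p. k (?\<pi> p)" p]
      ralg_hom_lin[OF h'] ralg_hom_lin[OF k'] word p(1) by (simp add: fp_words_def)
  then show ?thesis using p by simp
qed

section \<open>Graded modules\<close>

lemma (in module) submodule_smultI:
  assumes "H \<subseteq> carrier M" "\<zero>\<^bsub>M\<^esub> \<in> H"
    and "\<And>a b. \<lbrakk>a \<in> H; b \<in> H\<rbrakk> \<Longrightarrow> a \<oplus>\<^bsub>M\<^esub> b \<in> H"
    and smult: "\<And>r a. \<lbrakk>r \<in> carrier R; a \<in> H\<rbrakk> \<Longrightarrow> r \<odot>\<^bsub>M\<^esub> a \<in> H"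
  shows "submodule H R M"
proof (rule submoduleI)
  fix a assume a: "a \<in> H"
  then have "a \<in> carrier M" using assms(1) by blast
  then have "\<ominus>\<^bsub>M\<^esub> a = (\<ominus>\<^bsub>R\<^esub> \<one>\<^bsub>R\<^esub>) \<odot>\<^bsub>M\<^esub> a"
    by (simp add: smult_l_minus)
  then show "\<ominus>\<^bsub>M\<^esub> a \<in> H"
    using smult[OF _ a] by simp
qed (use assms in auto)

locale graded_module = module R M
  for R :: "('r, 'm) ring_scheme" and M :: "('r, 'a, 'n) gralg_scheme" (structure) +
  assumes grade_submodule: "submodule (grade M n) R M"
    and grade_decomp: "x \<in> carrier M \<Longrightarrow> \<exists>!c. homog_decomp M x c"

lemma (in graded_algebra) is_graded_module: "graded_module R A"
  by (intro graded_module.intro graded_module_axioms.intro module_axioms grade_submodule grade_decomp)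

lemma (in graded_algebra) is_ralg: "ralg R A"
  by (intro ralg.intro ralg_axioms.intro module_axioms ring_axioms smult_mult_left smult_mult_right)

context graded_module
begin

lemma grade_subset: "x \<in> grade M n \<Longrightarrow> x \<in> carrier M"
  using submoduleE(1)[OF grade_submodule] by blast

lemma grade_zero: "\<zero> \<in> grade M n"
  using submodule.axioms(1)[OF grade_submodule, of n] by (metis monoid.simps(2) subgroup.one_closed)

lemma grade_add: "\<lbrakk>x \<in> grade M n; y \<in> grade M n\<rbrakk> \<Longrightarrow> x \<oplus> y \<in> grade M n"
  using submoduleE(5)[OF grade_submodule] by blast

lemma grade_minus: "x \<in> grade M n \<Longrightarrow> \<ominus> x \<in> grade M n"
  using submoduleE(3)[OF grade_submodule] by blast

lemma grade_smult: "\<lbrakk>r \<in> carrier R; x \<in> grade M n\<rbrakk> \<Longrightarrow> r \<odot> x \<in> grade M n"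
  using submoduleE(4)[OF grade_submodule] by blast

lemma homog_decompI:
  assumes "\<And>n. c n \<in> grade M n" "finite S" "\<And>n. n \<notin> S \<Longrightarrow> c n = \<zero>"
    and "x = (\<Oplus>n\<in>S. c n)"
  shows "homog_decomp M x c"
proof -
  have sub: "{n. c n \<noteq> \<zero>} \<subseteq> S"
    using assms(3) by blast
  have "(\<Oplus>n\<in>{n. c n \<noteq> \<zero>}. c n) = (\<Oplus>n\<in>S. c n)"
    using assms(2,3) sub grade_subset[OF assms(1)]
    by (intro M.add.finprod_mono_neutral_cong_left) auto
  then show ?thesis
    using assms sub finite_subset unfolding homog_decomp_def by auto
qed

lemma homog_decomp_sum:
  assumes "homog_decomp M x c" "finite S" "{n. c n \<noteq> \<zero>} \<subseteq> S"
  shows "x = (\<Oplus>n\<in>S. c n)"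
proof -
  have "(\<Oplus>n\<in>{n. c n \<noteq> \<zero>}. c n) = (\<Oplus>n\<in>S. c n)"
    using assms grade_subset unfolding homog_decomp_def
    by (intro M.add.finprod_mono_neutral_cong_left) auto
  then show ?thesis
    using assms(1) by (simp add: homog_decomp_def)
qed

lemma component_decomp: "x \<in> carrier M \<Longrightarrow> homog_decomp M x (\<lambda>n. component M n x)"
  using theI'[OF grade_decomp] by (simp add: component_def)

lemma component_eqI: "\<lbrakk>x \<in> carrier M; homog_decomp M x c\<rbrakk> \<Longrightarrow> component M n x = c n"
  using grade_decomp component_decomp by metis

lemma component_closed: "x \<in> carrier M \<Longrightarrow> component M n x \<in> grade M n"
  using component_decomp by (simp add: homog_decomp_def)

lemma component_carrier: "x \<in> carrier M \<Longrightarrow> component M n x \<in> carrier M"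
  using component_closed grade_subset by blast

lemma component_finite: "x \<in> carrier M \<Longrightarrow> finite {n. component M n x \<noteq> \<zero>}"
  using component_decomp by (simp add: homog_decomp_def)

lemma component_sum:
  "\<lbrakk>x \<in> carrier M; finite S; {n. component M n x \<noteq> \<zero>} \<subseteq> S\<rbrakk>
    \<Longrightarrow> x = (\<Oplus>n\<in>S. component M n x)"
  using homog_decomp_sum[OF component_decomp] by blast

lemma component_lin: "component M n \<in> lin R M M"
proof (rule linI)
  fix x y assume xy: "x \<in> carrier M" "y \<in> carrier M"
  let ?S = "{n. component M n x \<noteq> \<zero>} \<union> {n. component M n y \<noteq> \<zero>}"
  have fin: "finite ?S"
    using xy component_finite by simp
  have "homog_decomp M (x \<oplus> y) (\<lambda>n. component M n x \<oplus> component M n y)"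
  proof (rule homog_decompI[OF _ fin])
    show "x \<oplus> y = (\<Oplus>n\<in>?S. component M n x \<oplus> component M n y)"
      using component_sum[OF xy(1) fin] component_sum[OF xy(2) fin] component_carrier xy
      by (simp add: M.finsum_addf)
  qed (use xy component_closed grade_add in auto)
  then show "component M n (x \<oplus> y) = component M n x \<oplus> component M n y"
    using component_eqI xy by auto
next
  fix r x assume rx: "r \<in> carrier R" "x \<in> carrier M"
  let ?S = "{n. component M n x \<noteq> \<zero>}"
  have fin: "finite ?S"
    using rx component_finite by simp
  have "homog_decomp M (r \<odot> x) (\<lambda>n. r \<odot> component M n x)"
  proof (rule homog_decompI[OF _ fin])
    have "r \<odot> (\<Oplus>n\<in>?S. component M n x) = (\<Oplus>n\<in>?S. r \<odot> component M n x)"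
      using rx component_carrier by (intro finsum_smult_ldistr fin) auto
    then show "r \<odot> x = (\<Oplus>n\<in>?S. r \<odot> component M n x)"
      using component_sum[OF rx(2) fin] by simp
  qed (use rx component_closed grade_smult in auto)
  then show "component M n (r \<odot> x) = r \<odot> component M n x"
    using component_eqI rx by auto
qed (rule component_carrier)

lemma component_homog: "x \<in> grade M m \<Longrightarrow> component M n x = (if n = m then x else \<zero>)"
proof -
  assume x: "x \<in> grade M m"
  have "homog_decomp M x (\<lambda>n. if n = m then x else \<zero>)"
    using x grade_zero grade_subset[OF x] by (intro homog_decompI[where S = "{m}"]) auto
  then show ?thesis
    using component_eqI grade_subset[OF x] by blast
qed

lemma graded_induct [consumes 1, case_names homog add]:
  assumes x: "x \<in> carrier M"
    and homog: "\<And>n x. x \<in> grade M n \<Longrightarrow> P x"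
    and add: "\<And>x y. \<lbrakk>x \<in> carrier M; y \<in> carrier M; P x; P y\<rbrakk> \<Longrightarrow> P (x \<oplus> y)"
  shows "P x"
proof -
  have "P (\<Oplus>n\<in>S. component M n x)" if "finite S" for S
    using that
  proof (induction S)
    case empty
    show ?case using homog[OF grade_zero] by simp
  next
    case (insert n S)
    then show ?case
      using x component_carrier homog[OF component_closed[OF x]]
      by (subst M.finsum_insert) (auto intro!: add)
  qed
  then show ?thesis
    using component_sum[OF x component_finite[OF x]] component_finite[OF x] by force
qed

lemma lin_eq_on_homog:
  assumes "f \<in> lin R M N" "g \<in> lin R M N" "x \<in> carrier M"
    and "\<And>n x. x \<in> grade M n \<Longrightarrow> f x = g x"
  shows "f x = g x"
  using assms(3)
proof (induction rule: graded_induct)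
  case (homog n x)
  then show ?case by (rule assms(4))
next
  case (add x y)
  then show ?case
    by (simp add: lin_add[OF assms(1)] lin_add[OF assms(2)])
qed

end

text \<open>Projections \<open>pr\<close> onto the pieces show that the sum of the pieces is direct. That the pieces
  span is expressed as an induction principle.\<close>

lemma graded_moduleI:
  assumes "module R M" and sub: "\<And>n. submodule (grade M n) R M"
    and pr: "\<And>n. pr n \<in> lin R M M"
    and pr_homog: "\<And>m n x. x \<in> grade M n \<Longrightarrow> pr m x = (if m = n then x else \<zero>\<^bsub>M\<^esub>)"
    and span: "\<And>P x. \<lbrakk>x \<in> carrier M; \<And>n y. y \<in> grade M n \<Longrightarrow> P y;
        \<And>y z. \<lbrakk>y \<in> carrier M; z \<in> carrier M; P y; P z\<rbrakk> \<Longrightarrow> P (y \<oplus>\<^bsub>M\<^esub> z)\<rbrakk> \<Longrightarrow> P x"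
  shows "graded_module R M"
proof -
  interpret module R M by fact
  have gc: "x \<in> carrier M" if "x \<in> grade M n" for x n
    using submoduleE(1)[OF sub] that by blast
  have gz: "\<zero>\<^bsub>M\<^esub> \<in> grade M n" for n
    using submodule.axioms(1)[OF sub, of n] by (metis monoid.simps(2) subgroup.one_closed)
  have uniq: "pr m x = c m" if "homog_decomp M x c" for x c m
  proof -
    let ?S = "{n. c n \<noteq> \<zero>\<^bsub>M\<^esub>}"
    have c: "c n \<in> grade M n" "finite ?S" "x = (\<Oplus>\<^bsub>M\<^esub>n\<in>?S. c n)" for n
      using that by (auto simp: homog_decomp_def)
    have cc: "c n \<in> carrier M" for n
      using gc[OF c(1)] .
    have "pr m x = (\<Oplus>\<^bsub>M\<^esub>n\<in>?S. pr m (c n))"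
      using lin_finsum[OF assms(1,1) pr, of c ?S] c(1,3) gc by blast
    also have "\<dots> = (\<Oplus>\<^bsub>M\<^esub>n\<in>?S. if m = n then c n else \<zero>\<^bsub>M\<^esub>)"
      using cc pr_homog[OF c(1)] by (intro M.finsum_cong') auto
    also have "\<dots> = c m"
    proof (cases "m \<in> ?S")
      case True
      then show ?thesis
        using M.finsum_singleton[of m ?S c] c(2) cc by auto
    next
      case False
      then have "(\<Oplus>\<^bsub>M\<^esub>n\<in>?S. if m = n then c n else \<zero>\<^bsub>M\<^esub>) = \<zero>\<^bsub>M\<^esub>"
        by (intro M.add.finprod_one_eqI) auto
      then show ?thesis using False by simp
    qed
    finally show ?thesis .
  qed
  have ex: "(\<forall>n. pr n x \<in> grade M n) \<and> finite {n. pr n x \<noteq> \<zero>\<^bsub>M\<^esub>} \<and>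
      (\<forall>S. finite S \<longrightarrow> {n. pr n x \<noteq> \<zero>\<^bsub>M\<^esub>} \<subseteq> S \<longrightarrow> x = (\<Oplus>\<^bsub>M\<^esub>n\<in>S. pr n x))" (is "?P x")
    if "x \<in> carrier M" for x
    using that
  proof (rule span[where P = ?P])
    fix n y assume y: "y \<in> grade M n"
    note p = pr_homog[OF y]
    have "y = (\<Oplus>\<^bsub>M\<^esub>m\<in>S. pr m y)" if S: "finite S" "{m. pr m y \<noteq> \<zero>\<^bsub>M\<^esub>} \<subseteq> S" for S
    proof (cases "n \<in> S")
      case True
      have "(\<Oplus>\<^bsub>M\<^esub>m\<in>S. pr m y) = (\<Oplus>\<^bsub>M\<^esub>m\<in>S. if n = m then y else \<zero>\<^bsub>M\<^esub>)"
        using p gc[OF y] by (intro M.finsum_cong') auto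
      then show ?thesis
        using M.finsum_singleton[OF True S(1), of "\<lambda>_. y"] gc[OF y] by simp
    next
      case False
      then have "y = \<zero>\<^bsub>M\<^esub>" using S(2) p by (auto split: if_splits)
      moreover have "(\<Oplus>\<^bsub>M\<^esub>m\<in>S. pr m y) = \<zero>\<^bsub>M\<^esub>"
        using p \<open>y = \<zero>\<^bsub>M\<^esub>\<close> by (intro M.add.finprod_one_eqI) auto
      ultimately show ?thesis by simp
    qed
    moreover have "finite {m. pr m y \<noteq> \<zero>\<^bsub>M\<^esub>}"
      by (rule finite_subset[of _ "{n}"]) (auto simp: p)
    ultimately show "?P y"
      using p y gz by auto
  next
    fix y z assume yz: "y \<in> carrier M" "z \<in> carrier M" and P: "?P y" "?P z"
    have add: "pr n (y \<oplus>\<^bsub>M\<^esub> z) = pr n y \<oplus>\<^bsub>M\<^esub> pr n z" for n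
      using lin_add[OF pr yz] .
    have c: "pr n y \<in> carrier M" "pr n z \<in> carrier M" for n
      using lin_closed[OF pr] yz by auto
    let ?U = "{n. pr n y \<noteq> \<zero>\<^bsub>M\<^esub>} \<union> {n. pr n z \<noteq> \<zero>\<^bsub>M\<^esub>}"
    have sub': "{n. pr n (y \<oplus>\<^bsub>M\<^esub> z) \<noteq> \<zero>\<^bsub>M\<^esub>} \<subseteq> ?U"
      by (auto simp: add)
    have fU: "finite ?U" using P by auto
    have eqU: "y \<oplus>\<^bsub>M\<^esub> z = (\<Oplus>\<^bsub>M\<^esub>n\<in>S. pr n (y \<oplus>\<^bsub>M\<^esub> z))" if S: "finite S" "?U \<subseteq> S" for S
    proof -
      have "(\<Oplus>\<^bsub>M\<^esub>n\<in>S. pr n (y \<oplus>\<^bsub>M\<^esub> z)) = (\<Oplus>\<^bsub>M\<^esub>n\<in>S. pr n y) \<oplus>\<^bsub>M\<^esub> (\<Oplus>\<^bsub>M\<^esub>n\<in>S. pr n z)"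
        using c by (simp add: add M.finsum_addf)
      moreover have "y = (\<Oplus>\<^bsub>M\<^esub>n\<in>S. pr n y)" "z = (\<Oplus>\<^bsub>M\<^esub>n\<in>S. pr n z)"
        using P S by auto
      ultimately show ?thesis by simp
    qed
    have "y \<oplus>\<^bsub>M\<^esub> z = (\<Oplus>\<^bsub>M\<^esub>n\<in>S. pr n (y \<oplus>\<^bsub>M\<^esub> z))"
      if S: "finite S" "{n. pr n (y \<oplus>\<^bsub>M\<^esub> z) \<noteq> \<zero>\<^bsub>M\<^esub>} \<subseteq> S" for S
    proof -
      have "(\<Oplus>\<^bsub>M\<^esub>n\<in>S. pr n (y \<oplus>\<^bsub>M\<^esub> z)) = (\<Oplus>\<^bsub>M\<^esub>n\<in>S \<union> ?U. pr n (y \<oplus>\<^bsub>M\<^esub> z))"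
        using S fU c add by (intro M.add.finprod_mono_neutral_cong_left) auto
      then show ?thesis
        using eqU[of "S \<union> ?U"] S fU by simp
    qed
    moreover have "pr n (y \<oplus>\<^bsub>M\<^esub> z) \<in> grade M n" for n
      using P submoduleE(5)[OF sub] by (simp add: add)
    ultimately show "?P (y \<oplus>\<^bsub>M\<^esub> z)"
      using finite_subset[OF sub' fU] by blast
  qed
  show ?thesis
  proof (intro graded_module.intro graded_module_axioms.intro assms(1) sub)
    fix x assume x: "x \<in> carrier M"
    show "\<exists>!c. homog_decomp M x c"
    proof (rule ex1I[of _ "\<lambda>n. pr n x"])
      show "homog_decomp M x (\<lambda>n. pr n x)"
        using ex[OF x] by (auto simp: homog_decomp_def)
      show "c = (\<lambda>n. pr n x)" if "homog_decomp M x c" for c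
        using uniq[OF that] by auto
    qed
  qed
qed

section \<open>Tensor products of graded modules\<close>

definition bilin ::
  "('r, 'm) ring_scheme \<Rightarrow> ('r, 'a, 'n) module_scheme \<Rightarrow> ('r, 'b, 'k) module_scheme
    \<Rightarrow> ('r, 'c, 'l) module_scheme \<Rightarrow> ('a \<Rightarrow> 'b \<Rightarrow> 'c) set"
where
  "bilin R A B C = {f. (\<forall>b\<in>carrier B. (\<lambda>a. f a b) \<in> lin R A C) \<and> (\<forall>a\<in>carrier A. f a \<in> lin R B C)}"

lemma bilinI:
  "\<lbrakk>\<And>b. b \<in> carrier B \<Longrightarrow> (\<lambda>a. f a b) \<in> lin R A C; \<And>a. a \<in> carrier A \<Longrightarrow> f a \<in> lin R B C\<rbrakk>
    \<Longrightarrow> f \<in> bilin R A B C"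
  by (simp add: bilin_def)

lemma bilin_left: "\<lbrakk>f \<in> bilin R A B C; b \<in> carrier B\<rbrakk> \<Longrightarrow> (\<lambda>a. f a b) \<in> lin R A C"
  and bilin_right: "\<lbrakk>f \<in> bilin R A B C; a \<in> carrier A\<rbrakk> \<Longrightarrow> f a \<in> lin R B C"
  by (auto simp: bilin_def)

lemma bilin_closed:
  "\<lbrakk>f \<in> bilin R A B C; a \<in> carrier A; b \<in> carrier B\<rbrakk> \<Longrightarrow> f a b \<in> carrier C"
  using lin_closed[OF bilin_right] .

lemma bilin_comp:
  assumes "f \<in> lin R A A'" "g \<in> lin R B B'" "h \<in> bilin R A' B' C"
  shows "(\<lambda>a b. h (f a) (g b)) \<in> bilin R A B C"
proof (rule bilinI)
  fix b assume "b \<in> carrier B"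
  then have "g b \<in> carrier B'" using lin_closed[OF assms(2)] by simp
  then show "(\<lambda>a. h (f a) (g b)) \<in> lin R A C"
    using lin_comp[OF assms(1) bilin_left[OF assms(3)]] by simp
next
  fix a assume "a \<in> carrier A"
  then have "f a \<in> carrier A'" using lin_closed[OF assms(1)] by simp
  then show "(\<lambda>b. h (f a) (g b)) \<in> lin R B C"
    using lin_comp[OF assms(2) bilin_right[OF assms(3)]] by simp
qed

lemma bilin_sum:
  assumes "module R C" "finite S" "\<And>i. i \<in> S \<Longrightarrow> f i \<in> bilin R A B C"
  shows "(\<lambda>a b. \<Oplus>\<^bsub>C\<^esub>i\<in>S. f i a b) \<in> bilin R A B C"
  by (intro bilinI lin_sum assms(1,2)) (use bilin_left[OF assms(3)] bilin_right[OF assms(3)] in auto)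

lemma (in ralg) mult_bilin: "(\<lambda>x y. x \<otimes>\<^bsub>A\<^esub> y) \<in> bilin R A A A"
  by (intro bilinI linI) (auto simp: l_distr r_distr smult_mult_left smult_mult_right)

locale module_pair = A: module R A + B: module R B
  for R :: "('r, 'm) ring_scheme" and A :: "('r, 'a, 'n) gralg_scheme"
    and B :: "('r, 'b, 'k) gralg_scheme"
begin

abbreviation "P \<equiv> tensor_pairs R A B"
abbreviation "N \<equiv> tensor_null R A B"
abbreviation "T \<equiv> tensor_module R A B"

lemma R_cring: "cring R" by (rule A.R.is_cring)

lemma P_module: "module R P"
  unfolding tensor_pairs_def by (rule free_module_is_module[OF R_cring])

lemma pair_closed: "\<lbrakk>a \<in> carrier A; b \<in> carrier B\<rbrakk> \<Longrightarrow> basis_elt R (a, b) \<in> carrier P"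
  unfolding tensor_pairs_def by (intro basis_elt_closed[OF R_cring]) simp

lemma bilinear_relations_closed: "bilinear_relations R A B \<subseteq> carrier P"
proof -
  interpret P: module R P by (rule P_module)
  show ?thesis
    unfolding bilinear_relations_def Let_def
    by (auto intro!: P.M.minus_closed pair_closed P.M.a_closed P.smult_closed)
qed

lemma N_submodule: "submodule N R P"
proof -
  interpret P: module R P by (rule P_module)
  let ?S = "{N. submodule N R P \<and> bilinear_relations R A B \<subseteq> N}"
  have car: "carrier P \<in> ?S"
    using P.carrier_is_submodule bilinear_relations_closed by simp
  show ?thesis
    unfolding tensor_null_def
  proof (rule P.submodule_smultI)
    show "\<Inter>?S \<subseteq> carrier P" using car by blast
    show "\<zero>\<^bsub>P\<^esub> \<in> \<Inter>?S"
      using submodule.axioms(1) by (fastforce dest: subgroup.one_closed)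
    show "x \<oplus>\<^bsub>P\<^esub> y \<in> \<Inter>?S" if "x \<in> \<Inter>?S" "y \<in> \<Inter>?S" for x y
    proof (rule InterI)
      fix K assume K: "K \<in> ?S"
      with that have "x \<in> K" "y \<in> K" by (blast, blast)
      then show "x \<oplus>\<^bsub>P\<^esub> y \<in> K"
        using K P.submoduleE(5)[of K] by simp
    qed
    show "r \<odot>\<^bsub>P\<^esub> x \<in> \<Inter>?S" if "r \<in> carrier R" "x \<in> \<Inter>?S" for r x
    proof (rule InterI)
      fix K assume K: "K \<in> ?S"
      with that(2) have "x \<in> K" by blast
      then show "r \<odot>\<^bsub>P\<^esub> x \<in> K"
        using K that(1) P.submoduleE(4)[of K] by simp
    qed
  qed
qed

lemma relations_subset: "bilinear_relations R A B \<subseteq> N"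
  by (auto simp: tensor_null_def)

lemma T_module: "module R T"
  unfolding tensor_module_def by (rule graded_quot_is_module[OF P_module N_submodule])

lemma proj_lin: "(\<lambda>p. N +>\<^bsub>P\<^esub> p) \<in> lin R P T"
  unfolding tensor_module_def by (rule graded_quot_proj_lin[OF P_module N_submodule])

lemma T_carrier: "carrier T = (\<lambda>p. N +>\<^bsub>P\<^esub> p) ` carrier P"
  unfolding tensor_module_def by (rule graded_quot_fields)

lemma tens_closed: "\<lbrakk>a \<in> carrier A; b \<in> carrier B\<rbrakk> \<Longrightarrow> tens R A B a b \<in> carrier T"
  unfolding tens_def by (intro lin_closed[OF proj_lin] pair_closed)

lemma tens_bilin: "tens R A B \<in> bilin R A B T"
proof -
  interpret P: module R P by (rule P_module)
  interpret T: module R T by (rule T_module)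
  have eq: "N +>\<^bsub>P\<^esub> x = N +>\<^bsub>P\<^esub> y" if "x \<ominus>\<^bsub>P\<^esub> y \<in> bilinear_relations R A B" "x \<in> carrier P" "y \<in> carrier P" for x y
    using that relations_subset by (intro coset_eqI[OF P_module N_submodule]) auto
  note pl = lin_add[OF proj_lin] lin_smult[OF proj_lin]
  show ?thesis
  proof (intro bilinI linI tens_closed)
    fix a a' b assume c: "a \<in> carrier A" "a' \<in> carrier A" "b \<in> carrier B"
    have "N +>\<^bsub>P\<^esub> basis_elt R (a \<oplus>\<^bsub>A\<^esub> a', b) = N +>\<^bsub>P\<^esub> (basis_elt R (a, b) \<oplus>\<^bsub>P\<^esub> basis_elt R (a', b))"
    proof (rule eq)
      show "basis_elt R (a \<oplus>\<^bsub>A\<^esub> a', b) \<ominus>\<^bsub>P\<^esub> (basis_elt R (a, b) \<oplus>\<^bsub>P\<^esub> basis_elt R (a', b))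
        \<in> bilinear_relations R A B"
        unfolding bilinear_relations_def Let_def
        by (rule UnI1, rule UnI1, rule UnI1) (use c in blast)
    qed (use c in \<open>simp_all add: pair_closed\<close>)
    then show "tens R A B (a \<oplus>\<^bsub>A\<^esub> a') b = tens R A B a b \<oplus>\<^bsub>T\<^esub> tens R A B a' b"
      using c by (simp add: tens_def pl pair_closed)
  next
    fix a b b' assume c: "a \<in> carrier A" "b \<in> carrier B" "b' \<in> carrier B"
    have "N +>\<^bsub>P\<^esub> basis_elt R (a, b \<oplus>\<^bsub>B\<^esub> b') = N +>\<^bsub>P\<^esub> (basis_elt R (a, b) \<oplus>\<^bsub>P\<^esub> basis_elt R (a, b'))"
    proof (rule eq)
      show "basis_elt R (a, b \<oplus>\<^bsub>B\<^esub> b') \<ominus>\<^bsub>P\<^esub> (basis_elt R (a, b) \<oplus>\<^bsub>P\<^esub> basis_elt R (a, b'))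
        \<in> bilinear_relations R A B"
        unfolding bilinear_relations_def Let_def
        by (rule UnI1, rule UnI1, rule UnI2) (use c in blast)
    qed (use c in \<open>simp_all add: pair_closed\<close>)
    then show "tens R A B a (b \<oplus>\<^bsub>B\<^esub> b') = tens R A B a b \<oplus>\<^bsub>T\<^esub> tens R A B a b'"
      using c by (simp add: tens_def pl pair_closed)
  next
    fix r a b assume c: "r \<in> carrier R" "a \<in> carrier A" "b \<in> carrier B"
    have "N +>\<^bsub>P\<^esub> basis_elt R (r \<odot>\<^bsub>A\<^esub> a, b) = N +>\<^bsub>P\<^esub> (r \<odot>\<^bsub>P\<^esub> basis_elt R (a, b))"
    proof (rule eq)
      show "basis_elt R (r \<odot>\<^bsub>A\<^esub> a, b) \<ominus>\<^bsub>P\<^esub> (r \<odot>\<^bsub>P\<^esub> basis_elt R (a, b)) \<in> bilinear_relations R A B"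
        unfolding bilinear_relations_def Let_def
        by (rule UnI1, rule UnI2) (use c in blast)
    qed (use c in \<open>simp_all add: pair_closed\<close>)
    then show "tens R A B (r \<odot>\<^bsub>A\<^esub> a) b = r \<odot>\<^bsub>T\<^esub> tens R A B a b"
      using c by (simp add: tens_def pl pair_closed)
  next
    fix r a b assume c: "r \<in> carrier R" "a \<in> carrier A" "b \<in> carrier B"
    have "N +>\<^bsub>P\<^esub> basis_elt R (a, r \<odot>\<^bsub>B\<^esub> b) = N +>\<^bsub>P\<^esub> (r \<odot>\<^bsub>P\<^esub> basis_elt R (a, b))"
    proof (rule eq)
      show "basis_elt R (a, r \<odot>\<^bsub>B\<^esub> b) \<ominus>\<^bsub>P\<^esub> (r \<odot>\<^bsub>P\<^esub> basis_elt R (a, b)) \<in> bilinear_relations R A B"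
        unfolding bilinear_relations_def Let_def
        by (rule UnI2) (use c in blast)
    qed (use c in \<open>simp_all add: pair_closed\<close>)
    then show "tens R A B a (r \<odot>\<^bsub>B\<^esub> b) = r \<odot>\<^bsub>T\<^esub> tens R A B a b"
      using c by (simp add: tens_def pl pair_closed)
  qed
qed

lemma
  assumes C: "module R C" and f: "f \<in> bilin R A B C"
  shows tensor_lift_lin: "tensor_lift R C f \<in> lin R T C"
    and tensor_lift_tens: "\<lbrakk>a \<in> carrier A; b \<in> carrier B\<rbrakk> \<Longrightarrow> tensor_lift R C f (tens R A B a b) = f a b"
proof -
  interpret P: module R P by (rule P_module)
  interpret C: module R C by (rule C)
  let ?h = "linear_ext R C (\<lambda>(a, b). f a b)"
  note fc = bilin_closed[OF f]
  have fpi: "(\<lambda>(a, b). f a b) \<in> carrier A \<times> carrier B \<rightarrow> carrier C"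
    using fc by auto
  have h: "?h \<in> lin R P C"
    unfolding tensor_pairs_def by (rule linear_ext_lin[OF C fpi])
  have hb: "?h (basis_elt R (a, b)) = f a b" if "a \<in> carrier A" "b \<in> carrier B" for a b
    using linear_ext_basis[OF C fpi, of "(a, b)"] that by simp
  let ?K = "{p \<in> carrier P. ?h p = \<zero>\<^bsub>C\<^esub>}"
  have K: "submodule ?K R P"
    by (rule P.submoduleI)
      (auto simp: lin_add[OF h] lin_smult[OF h] lin_zero[OF P_module C h] lin_minus[OF P_module C h])
  have d: "?h (x \<ominus>\<^bsub>P\<^esub> y) = \<zero>\<^bsub>C\<^esub>" if "x \<in> carrier P" "y \<in> carrier P" "?h x = ?h y" for x y
    using that lin_closed[OF h] lin_diff[OF P_module C h, of x y]
    by (simp add: a_minus_def[of C] C.M.r_neg)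
  have "bilinear_relations R A B \<subseteq> ?K"
    unfolding bilinear_relations_def Let_def
    by (auto intro!: d pair_closed P.M.minus_closed P.M.a_closed P.smult_closed
        simp: hb lin_add[OF h] lin_smult[OF h] pair_closed
        lin_add[OF bilin_left[OF f]] lin_add[OF bilin_right[OF f]]
        lin_smult[OF bilin_left[OF f]] lin_smult[OF bilin_right[OF f]])
  then have "N \<subseteq> ?K"
    using K by (auto simp: tensor_null_def)
  then have van: "?h n = \<zero>\<^bsub>C\<^esub>" if "n \<in> N" for n
    using that by auto
  show "tensor_lift R C f \<in> lin R T C"
    unfolding tensor_lift_def tensor_module_def
    by (rule quot_map_lin[OF P_module N_submodule C h van])
  show "tensor_lift R C f (tens R A B a b) = f a b" if ab: "a \<in> carrier A" "b \<in> carrier B"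
    unfolding tensor_lift_def tens_def
    using quot_map_coset[OF P_module N_submodule C h van pair_closed[OF ab]] hb[OF ab] by simp
qed

text \<open>The classes of the basis elements of the free module are the pure tensors.\<close>

lemma tensor_lin_eqI:
  assumes C: "module R C" and f: "f \<in> lin R T C" and g: "g \<in> lin R T C" and z: "z \<in> carrier T"
    and eq: "\<And>a b. \<lbrakk>a \<in> carrier A; b \<in> carrier B\<rbrakk> \<Longrightarrow> f (tens R A B a b) = g (tens R A B a b)"
  shows "f z = g z"
proof -
  obtain p where p: "p \<in> carrier P" "z = N +>\<^bsub>P\<^esub> p"
    using z by (auto simp: T_carrier)
  have "f (N +>\<^bsub>P\<^esub> p) = g (N +>\<^bsub>P\<^esub> p)"
    by (rule lin_eq_on_basis[OF R_cring C lin_comp[OF proj_lin f, unfolded tensor_pairs_def]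
          lin_comp[OF proj_lin g, unfolded tensor_pairs_def] _ p(1)[unfolded tensor_pairs_def],
          folded tensor_pairs_def])
      (use eq in \<open>auto simp: tens_def\<close>)
  then show ?thesis using p by simp
qed

end

locale graded_pair = A: graded_module R A + B: graded_module R B
  for R :: "('r, 'm) ring_scheme" and A :: "('r, 'a, 'n) gralg_scheme"
    and B :: "('r, 'b, 'k) gralg_scheme"
begin

sublocale module_pair R A B ..

definition homog_pairs :: "nat \<Rightarrow> ('a \<times> 'b) set" where
  "homog_pairs n = {(a, b). \<exists>i j. i + j = n \<and> a \<in> grade A i \<and> b \<in> grade B j}"

text \<open>Before passage to the quotient the degree-\<open>n\<close> part is itself a free module, and so it is a
  submodule and admits induction along the support.\<close>

lemma tensor_homog_eq: "tensor_homog R A B n = carrier (free_module R (homog_pairs n))"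
proof -
  have sub: "homog_pairs n \<subseteq> carrier A \<times> carrier B"
    using A.grade_subset B.grade_subset by (auto simp: homog_pairs_def)
  have "p \<in> tensor_homog R A B n \<longleftrightarrow> p \<in> carrier P \<and> {x. p x \<noteq> \<zero>\<^bsub>R\<^esub>} \<subseteq> homog_pairs n" for p
    by (auto simp: tensor_homog_def homog_pairs_def)
  then show ?thesis
    unfolding set_eq_iff tensor_pairs_def free_module_carrier using sub by blast
qed

lemma T_grade: "grade T n = (\<lambda>p. N +>\<^bsub>P\<^esub> p) ` tensor_homog R A B n"
  unfolding tensor_module_def by (rule graded_quot_fields(7)[THEN fun_cong])

lemma tensor_homog_subset: "tensor_homog R A B n \<subseteq> carrier P"
  by (auto simp: tensor_homog_def)

lemma tens_grade:
  assumes "a \<in> grade A i" "b \<in> grade B j"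
  shows "tens R A B a b \<in> grade T (i + j)"
proof -
  have "(a, b) \<in> homog_pairs (i + j)"
    using assms by (auto simp: homog_pairs_def)
  then show ?thesis
    unfolding T_grade tens_def tensor_homog_eq by (intro imageI basis_elt_closed[OF R_cring])
qed

lemma T_grade_submodule: "submodule (grade T n) R T"
proof -
  interpret T: module R T by (rule T_module)
  interpret F: module R "free_module R (homog_pairs n)" by (rule free_module_is_module[OF R_cring])
  have ops: "zero (free_module R (homog_pairs n)) = \<zero>\<^bsub>P\<^esub>" "add (free_module R (homog_pairs n)) = add P"
    "smult (free_module R (homog_pairs n)) = smult P"
    by (simp_all add: tensor_pairs_def free_module_def)
  note H = tensor_homog_eq[of n]
  have sub: "x \<in> carrier P" if "x \<in> tensor_homog R A B n" for x
    using that tensor_homog_subset by blast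
  show ?thesis
  proof (rule T.submodule_smultI)
    show "grade T n \<subseteq> carrier T"
      unfolding T_grade T_carrier using tensor_homog_subset by blast
    have "\<zero>\<^bsub>P\<^esub> \<in> tensor_homog R A B n"
      unfolding H ops[symmetric] by simp
    then show "\<zero>\<^bsub>T\<^esub> \<in> grade T n"
      unfolding T_grade using lin_zero[OF P_module T_module proj_lin] by blast
    show "x \<oplus>\<^bsub>T\<^esub> y \<in> grade T n" if xy: "x \<in> grade T n" "y \<in> grade T n" for x y
    proof -
      obtain p q where pq: "p \<in> tensor_homog R A B n" "q \<in> tensor_homog R A B n"
        "x = N +>\<^bsub>P\<^esub> p" "y = N +>\<^bsub>P\<^esub> q"
        using xy unfolding T_grade by blast
      have "p \<oplus>\<^bsub>P\<^esub> q \<in> tensor_homog R A B n"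
        using pq(1,2) F.M.a_closed unfolding H ops by blast
      then show ?thesis
        unfolding T_grade using lin_add[OF proj_lin sub[OF pq(1)] sub[OF pq(2)]] pq(3,4) by force
    qed
    show "r \<odot>\<^bsub>T\<^esub> x \<in> grade T n" if rx: "r \<in> carrier R" "x \<in> grade T n" for r x
    proof -
      obtain p where p: "p \<in> tensor_homog R A B n" "x = N +>\<^bsub>P\<^esub> p"
        using rx unfolding T_grade by blast
      have "r \<odot>\<^bsub>P\<^esub> p \<in> tensor_homog R A B n"
        using rx(1) p(1) F.smult_closed unfolding H ops by blast
      then show ?thesis
        unfolding T_grade using lin_smult[OF proj_lin rx(1) sub[OF p(1)]] p(2) by force
    qed
  qed
qed

text \<open>Scalar multiples are absorbed into the pure tensors, since \<open>r (a \<otimes> b) = r a \<otimes> b\<close>.\<close>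

lemma tensor_grade_induct [consumes 1, case_names tens add]:
  assumes z: "z \<in> grade T n"
    and tens: "\<And>i j a b. \<lbrakk>i + j = n; a \<in> grade A i; b \<in> grade B j\<rbrakk> \<Longrightarrow> Q (tens R A B a b)"
    and add: "\<And>x y. \<lbrakk>x \<in> grade T n; y \<in> grade T n; Q x; Q y\<rbrakk> \<Longrightarrow> Q (x \<oplus>\<^bsub>T\<^esub> y)"
  shows "Q z"
proof -
  obtain p where p: "p \<in> carrier (free_module R (homog_pairs n))" "z = N +>\<^bsub>P\<^esub> p"
    using z by (auto simp: T_grade tensor_homog_eq)
  interpret T: module R T by (rule T_module)
  have ops: "zero (free_module R (homog_pairs n)) = \<zero>\<^bsub>P\<^esub>" "add (free_module R (homog_pairs n)) = add P"
    "smult (free_module R (homog_pairs n)) = smult P"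
    by (simp_all add: tensor_pairs_def free_module_def)
  have sub: "x \<in> carrier P" if "x \<in> carrier (free_module R (homog_pairs n))" for x
    using that tensor_homog_subset tensor_homog_eq by blast
  have g: "N +>\<^bsub>P\<^esub> x \<in> grade T n" if "x \<in> carrier (free_module R (homog_pairs n))" for x
    using that by (auto simp: T_grade tensor_homog_eq)
  have "Q (N +>\<^bsub>P\<^esub> p)"
    using R_cring p(1)
  proof (induction rule: free_module_induct)
    case zero
    have "tens R A B \<zero>\<^bsub>A\<^esub> \<zero>\<^bsub>B\<^esub> = \<zero>\<^bsub>T\<^esub>"
      using lin_zero[OF B.module_axioms T_module bilin_right[OF tens_bilin]] by simp
    then show ?case
      using tens[of 0 n "\<zero>\<^bsub>A\<^esub>" "\<zero>\<^bsub>B\<^esub>"] A.grade_zero B.grade_zero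
        lin_zero[OF P_module T_module proj_lin] by (simp add: ops)
  next
    case (step q r x)
    obtain a b i j where x: "x = (a, b)" "i + j = n" "a \<in> grade A i" "b \<in> grade B j"
      using step.hyps(3) by (auto simp: homog_pairs_def)
    have c: "a \<in> carrier A" "b \<in> carrier B"
      using x A.grade_subset B.grade_subset by auto
    have e: "N +>\<^bsub>P\<^esub> (q \<oplus>\<^bsub>P\<^esub> r \<odot>\<^bsub>P\<^esub> basis_elt R x) =
        (N +>\<^bsub>P\<^esub> q) \<oplus>\<^bsub>T\<^esub> tens R A B (r \<odot>\<^bsub>A\<^esub> a) b"
      using step.hyps(2) sub[OF step.hyps(1)] c pair_closed[OF c] module.smult_closed[OF P_module]
      by (simp add: x(1) lin_add[OF proj_lin] lin_smult[OF proj_lin]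
          lin_smult[OF bilin_left[OF tens_bilin]] flip: tens_def)
    have ra: "r \<odot>\<^bsub>A\<^esub> a \<in> grade A i"
      using A.grade_smult step.hyps(2) x(3) by blast
    have "Q ((N +>\<^bsub>P\<^esub> q) \<oplus>\<^bsub>T\<^esub> tens R A B (r \<odot>\<^bsub>A\<^esub> a) b)"
      using tens[OF x(2) ra x(4)] step g[OF step.hyps(1)] tens_grade[OF ra x(4)] x(2)
      by (intro add) auto
    then show ?case
      unfolding ops e .
  qed
  then show ?thesis using p by simp
qed

lemma tens_homog_span:
  assumes a: "a \<in> carrier A" and b: "b \<in> carrier B"
    and tens: "\<And>i j a b. \<lbrakk>a \<in> grade A i; b \<in> grade B j\<rbrakk> \<Longrightarrow> Q (tens R A B a b)"
    and add: "\<And>x y. \<lbrakk>x \<in> carrier T; y \<in> carrier T; Q x; Q y\<rbrakk> \<Longrightarrow> Q (x \<oplus>\<^bsub>T\<^esub> y)"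
  shows "Q (tens R A B a b)"
  using a
proof (induction rule: A.graded_induct)
  case (homog i a)
  note ac = A.grade_subset[OF homog]
  show ?case
    using b
  proof (induction rule: B.graded_induct)
    case (homog j b)
    then show ?case using tens \<open>a \<in> grade A i\<close> by blast
  next
    case (add x y)
    then show ?case
      using ac assms(4) tens_closed by (simp add: lin_add[OF bilin_right[OF tens_bilin]])
  qed
next
  case (add x y)
  then show ?case
    using b assms(4) tens_closed by (simp add: lin_add[OF bilin_left[OF tens_bilin]])
qed

lemma tensor_induct [consumes 1, case_names tens add]:
  assumes z: "z \<in> carrier T"
    and tens: "\<And>i j a b. \<lbrakk>a \<in> grade A i; b \<in> grade B j\<rbrakk> \<Longrightarrow> Q (tens R A B a b)"
    and add: "\<And>x y. \<lbrakk>x \<in> carrier T; y \<in> carrier T; Q x; Q y\<rbrakk> \<Longrightarrow> Q (x \<oplus>\<^bsub>T\<^esub> y)"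
  shows "Q z"
proof -
  interpret P: module R P by (rule P_module)
  obtain p where p: "p \<in> carrier P" "z = N +>\<^bsub>P\<^esub> p"
    using z by (auto simp: T_carrier)
  note TP = tensor_pairs_def[of R A B, symmetric]
  have "Q (N +>\<^bsub>P\<^esub> p)"
    using R_cring p(1)[unfolded tensor_pairs_def]
  proof (induction rule: free_module_induct)
    case zero
    have "tens R A B \<zero>\<^bsub>A\<^esub> \<zero>\<^bsub>B\<^esub> = \<zero>\<^bsub>T\<^esub>"
      using lin_zero[OF B.module_axioms T_module bilin_right[OF tens_bilin]] by simp
    then show ?case
      using tens[OF A.grade_zero[of 0] B.grade_zero[of 0]]
        lin_zero[OF P_module T_module proj_lin] by (simp add: TP)
  next
    case (step q r x)
    then obtain a b where x: "x = (a, b)" and c: "a \<in> carrier A" "b \<in> carrier B"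
      by auto
    have qc: "q \<in> carrier P" using step.hyps(1) by (simp add: TP)
    have e: "N +>\<^bsub>P\<^esub> (q \<oplus>\<^bsub>P\<^esub> r \<odot>\<^bsub>P\<^esub> basis_elt R x) =
        (N +>\<^bsub>P\<^esub> q) \<oplus>\<^bsub>T\<^esub> tens R A B (r \<odot>\<^bsub>A\<^esub> a) b"
      using step.hyps(2) qc c pair_closed[OF c] P.smult_closed
      by (simp add: x(1) lin_add[OF proj_lin] lin_smult[OF proj_lin]
          lin_smult[OF bilin_left[OF tens_bilin]] flip: tens_def)
    have ra: "r \<odot>\<^bsub>A\<^esub> a \<in> carrier A" using step.hyps(2) c by simp
    have "Q (tens R A B (r \<odot>\<^bsub>A\<^esub> a) b)"
      by (rule tens_homog_span[OF ra c(2)]) (use tens add in blast)+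
    then have "Q ((N +>\<^bsub>P\<^esub> q) \<oplus>\<^bsub>T\<^esub> tens R A B (r \<odot>\<^bsub>A\<^esub> a) b)"
      using step.IH lin_closed[OF proj_lin qc] tens_closed[OF ra c(2)] by (intro add) auto
    then show ?case
      unfolding TP e .
  qed
  then show ?thesis using p by simp
qed

lemma tensor_lin_eq_homogI:
  assumes "f \<in> lin R T C" "g \<in> lin R T C" "z \<in> carrier T"
    and eq: "\<And>i j a b. \<lbrakk>a \<in> grade A i; b \<in> grade B j\<rbrakk> \<Longrightarrow> f (tens R A B a b) = g (tens R A B a b)"
  shows "f z = g z"
  using assms(3)
proof (induction rule: tensor_induct)
  case (tens i j a b)
  then show ?case by (rule eq)
next
  case (add x y)
  then show ?case by (simp add: lin_add[OF assms(1)] lin_add[OF assms(2)])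
qed

text \<open>The projection to degree \<open>n\<close>, which shows that the pieces of \<open>A \<otimes> B\<close> form a direct sum.\<close>

definition tensor_proj :: "nat \<Rightarrow> ('a \<times> 'b \<Rightarrow> 'r) set \<Rightarrow> ('a \<times> 'b \<Rightarrow> 'r) set" where
  "tensor_proj n = tensor_lift R T (\<lambda>a b. \<Oplus>\<^bsub>T\<^esub>k\<in>{..n}. tens R A B (component A k a) (component B (n - k) b))"

lemma tensor_proj_bilin:
  "(\<lambda>a b. \<Oplus>\<^bsub>T\<^esub>k\<in>{..n}. tens R A B (component A k a) (component B (n - k) b)) \<in> bilin R A B T"
  by (intro bilin_sum T_module bilin_comp[OF A.component_lin B.component_lin tens_bilin]) simp

lemma tensor_proj_lin: "tensor_proj n \<in> lin R T T"
  unfolding tensor_proj_def by (rule tensor_lift_lin[OF T_module tensor_proj_bilin])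

lemma tensor_proj_tens:
  assumes a: "a \<in> grade A i" and b: "b \<in> grade B j"
  shows "tensor_proj n (tens R A B a b) = (if n = i + j then tens R A B a b else \<zero>\<^bsub>T\<^esub>)"
proof -
  interpret T: module R T by (rule T_module)
  note c = A.grade_subset[OF a] B.grade_subset[OF b]
  let ?t = "if n = i + j then tens R A B a b else \<zero>\<^bsub>T\<^esub>"
  have z: "tens R A B \<zero>\<^bsub>A\<^esub> y = \<zero>\<^bsub>T\<^esub>" if "y \<in> carrier B" for y
    using lin_zero[OF A.module_axioms T_module bilin_left[OF tens_bilin that]] .
  have z': "tens R A B x \<zero>\<^bsub>B\<^esub> = \<zero>\<^bsub>T\<^esub>" if "x \<in> carrier A" for x
    using lin_zero[OF B.module_axioms T_module bilin_right[OF tens_bilin that]] .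
  have "tensor_proj n (tens R A B a b) = (\<Oplus>\<^bsub>T\<^esub>k\<in>{..n}. tens R A B (component A k a) (component B (n - k) b))"
    unfolding tensor_proj_def by (rule tensor_lift_tens[OF T_module tensor_proj_bilin c])
  also have "\<dots> = (\<Oplus>\<^bsub>T\<^esub>k\<in>{..n}. if i = k then ?t else \<zero>\<^bsub>T\<^esub>)"
    using c z z' tens_closed[OF c]
    by (intro T.M.finsum_cong') (auto simp: A.component_homog[OF a] B.component_homog[OF b])
  also have "\<dots> = ?t"
  proof (cases "i \<le> n")
    case True
    then show ?thesis
      using T.M.finsum_singleton[of i "{..n}" "\<lambda>_. ?t"] tens_closed[OF c] by auto
  next
    case False
    then have "(\<Oplus>\<^bsub>T\<^esub>k\<in>{..n}. if i = k then ?t else \<zero>\<^bsub>T\<^esub>) = \<zero>\<^bsub>T\<^esub>"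
      by (intro T.M.add.finprod_one_eqI) auto
    then show ?thesis using False by auto
  qed
  finally show ?thesis .
qed

lemma T_graded: "graded_module R T"
proof (rule graded_moduleI[OF T_module T_grade_submodule tensor_proj_lin])
  fix m n z assume z: "z \<in> grade T n"
  interpret T: module R T by (rule T_module)
  have gc: "x \<in> carrier T" if "x \<in> grade T n" for x
    using T.submoduleE(1)[OF T_grade_submodule] that by blast
  show "tensor_proj m z = (if m = n then z else \<zero>\<^bsub>T\<^esub>)"
    using z
  proof (induction rule: tensor_grade_induct)
    case (tens i j a b)
    then show ?case by (auto simp: tensor_proj_tens)
  next
    case (add x y)
    then show ?case
      using gc by (auto simp: lin_add[OF tensor_proj_lin])
  qed
next
  fix Q z
  assume "z \<in> carrier T" and Q: "\<And>n y. y \<in> grade T n \<Longrightarrow> Q y"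
    "\<And>y z. \<lbrakk>y \<in> carrier T; z \<in> carrier T; Q y; Q z\<rbrakk> \<Longrightarrow> Q (y \<oplus>\<^bsub>T\<^esub> z)"
  from this(1) show "Q z"
    by (induction rule: tensor_induct) (use Q tens_grade in blast)+
qed

end

section \<open>The algebra structure on a tensor product\<close>

text \<open>The sign \<open>(-1)^k\<close> as a scalar of \<open>R\<close>. In this form it can be pulled through linear maps;
  \<open>koszul_smult\<close> makes the link to \<^const>\<open>koszul\<close>.\<close>

definition sg :: "('r, 'm) ring_scheme \<Rightarrow> nat \<Rightarrow> 'r" where
  "sg R k = (if even k then \<one>\<^bsub>R\<^esub> else \<ominus>\<^bsub>R\<^esub> \<one>\<^bsub>R\<^esub>)"

lemma sg_closed: "cring R \<Longrightarrow> sg R k \<in> carrier R"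
proof -
  assume "cring R"
  then interpret cring R .
  show ?thesis by (simp add: sg_def)
qed

lemma sg_mult: "cring R \<Longrightarrow> sg R k \<otimes>\<^bsub>R\<^esub> sg R l = sg R (k + l)"
proof -
  assume "cring R"
  then interpret cring R .
  show ?thesis by (simp add: sg_def l_minus r_minus)
qed

lemma sg_cong: "even k = even l \<Longrightarrow> sg R k = sg R l"
  by (simp add: sg_def)

lemma sg_0: "sg R 0 = \<one>\<^bsub>R\<^esub>"
  by (simp add: sg_def)

lemma koszul_smult:
  assumes "module R M" "x \<in> carrier M"
  shows "koszul M k x = sg R k \<odot>\<^bsub>M\<^esub> x"
proof -
  interpret module R M by fact
  show ?thesis
    using assms(2) by (simp add: koszul_def sg_def smult_l_minus)
qed

text \<open>The sums in \<^const>\<open>tens_mult\<close> run over the supports of their arguments, and so the index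
  sets for \<open>x\<close>, \<open>y\<close> and \<open>x + y\<close> differ; all three values agree with sums over one larger set.\<close>

lemma lin_locally_finite:
  assumes N: "module R N" and M: "module R M" and g: "\<And>i. g i \<in> lin R M N"
    and f: "\<And>x. x \<in> carrier M \<Longrightarrow>
      \<exists>F\<^sub>0. finite F\<^sub>0 \<and> (\<forall>F. finite F \<longrightarrow> F\<^sub>0 \<subseteq> F \<longrightarrow> f x = (\<Oplus>\<^bsub>N\<^esub>i\<in>F. g i x))"
  shows "f \<in> lin R M N"
proof -
  interpret N: module R N by fact
  interpret M: module R M by fact
  have s: "(\<lambda>x. \<Oplus>\<^bsub>N\<^esub>i\<in>F. g i x) \<in> lin R M N" if "finite F" for F
    by (rule lin_sum[OF N that g])
  show ?thesis
  proof (rule linI)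
    fix x assume "x \<in> carrier M"
    then show "f x \<in> carrier N"
      using f[of x] lin_closed[OF s] by (metis order_refl)
  next
    fix x y assume xy: "x \<in> carrier M" "y \<in> carrier M"
    obtain F where F: "finite F" "\<forall>F'. finite F' \<longrightarrow> F \<subseteq> F' \<longrightarrow> f x = (\<Oplus>\<^bsub>N\<^esub>i\<in>F'. g i x)"
      using f[OF xy(1)] by (elim exE conjE)
    obtain G where G: "finite G" "\<forall>F'. finite F' \<longrightarrow> G \<subseteq> F' \<longrightarrow> f y = (\<Oplus>\<^bsub>N\<^esub>i\<in>F'. g i y)"
      using f[OF xy(2)] by (elim exE conjE)
    obtain H where H: "finite H" "\<forall>F'. finite F' \<longrightarrow> H \<subseteq> F' \<longrightarrow> f (x \<oplus>\<^bsub>M\<^esub> y) = (\<Oplus>\<^bsub>N\<^esub>i\<in>F'. g i (x \<oplus>\<^bsub>M\<^esub> y))"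
      using f[OF M.M.a_closed[OF xy]] by (elim exE conjE)
    let ?U = "F \<union> G \<union> H"
    have U: "finite ?U" "F \<subseteq> ?U" "G \<subseteq> ?U" "H \<subseteq> ?U"
      using F G H by auto
    show "f (x \<oplus>\<^bsub>M\<^esub> y) = f x \<oplus>\<^bsub>N\<^esub> f y"
      unfolding F(2)[rule_format, OF U(1,2)] G(2)[rule_format, OF U(1,3)]
        H(2)[rule_format, OF U(1,4)] by (rule lin_add[OF s[OF U(1)] xy])
  next
    fix r x assume rx: "r \<in> carrier R" "x \<in> carrier M"
    obtain F where F: "finite F" "\<forall>F'. finite F' \<longrightarrow> F \<subseteq> F' \<longrightarrow> f x = (\<Oplus>\<^bsub>N\<^esub>i\<in>F'. g i x)"
      using f[OF rx(2)] by (elim exE conjE)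
    obtain G where G: "finite G" "\<forall>F'. finite F' \<longrightarrow> G \<subseteq> F' \<longrightarrow> f (r \<odot>\<^bsub>M\<^esub> x) = (\<Oplus>\<^bsub>N\<^esub>i\<in>F'. g i (r \<odot>\<^bsub>M\<^esub> x))"
      using f[OF M.smult_closed[OF rx]] by (elim exE conjE)
    let ?U = "F \<union> G"
    have U: "finite ?U" "F \<subseteq> ?U" "G \<subseteq> ?U"
      using F G by auto
    show "f (r \<odot>\<^bsub>M\<^esub> x) = r \<odot>\<^bsub>N\<^esub> f x"
      unfolding F(2)[rule_format, OF U(1,2)] G(2)[rule_format, OF U(1,3)] by (rule lin_smult[OF s[OF U(1)] rx])
  qed
qed

lemma lin_cong:
  assumes "module R M" "f \<in> lin R M N" "\<And>x. x \<in> carrier M \<Longrightarrow> g x = f x"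
  shows "g \<in> lin R M N"
proof -
  interpret M: module R M by fact
  show ?thesis
    using assms(2,3) by (auto simp: lin_def Pi_iff)
qed

locale galg_pair = A: graded_algebra R A + B: graded_algebra R B
  for R :: "('r, 'm) ring_scheme" and A :: "('r, 'a, 'n) gralg_scheme"
    and B :: "('r, 'b, 'k) gralg_scheme"
begin

sublocale graded_pair R A B
  by (intro graded_pair.intro A.is_graded_module B.is_graded_module)

sublocale Ar: ralg R A by (rule A.is_ralg)
sublocale Br: ralg R B by (rule B.is_ralg)
sublocale Tm: graded_module R T by (rule T_graded)

abbreviation "TA \<equiv> tensor_algebra R A B"

lemma TA_fields:
  "carrier TA = carrier T" "add TA = add T" "zero TA = zero T" "smult TA = smult T"
  "grade TA = grade T" "one TA = tens R A B \<one>\<^bsub>A\<^esub> \<one>\<^bsub>B\<^esub>"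
  by (simp_all add: tensor_algebra_def)

lemma TA_lin: "lin R TA C = lin R T C" "lin R C TA = lin R C T"
  by (simp_all add: lin_def TA_fields)

text \<open>The summand of \<open>(a \<otimes> b)(c \<otimes> d)\<close> that belongs to the degree-\<open>i\<close> part of \<open>b\<close> and the
  degree-\<open>j\<close> part of \<open>c\<close>.\<close>

definition mult_term :: "nat \<Rightarrow> nat \<Rightarrow> 'a \<Rightarrow> 'b \<Rightarrow> 'a \<Rightarrow> 'b \<Rightarrow> ('a \<times> 'b \<Rightarrow> 'r) set" where
  "mult_term i j a b c d = sg R (i * j) \<odot>\<^bsub>T\<^esub>
     tens R A B (a \<otimes>\<^bsub>A\<^esub> component A j c) (component B i b \<otimes>\<^bsub>B\<^esub> d)"

lemma mult_term_lin:
  shows "\<lbrakk>b \<in> carrier B; c \<in> carrier A; d \<in> carrier B\<rbrakk> \<Longrightarrow> (\<lambda>a. mult_term i j a b c d) \<in> lin R A T"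
    and "\<lbrakk>a \<in> carrier A; c \<in> carrier A; d \<in> carrier B\<rbrakk> \<Longrightarrow> (\<lambda>b. mult_term i j a b c d) \<in> lin R B T"
    and "\<lbrakk>a \<in> carrier A; b \<in> carrier B; d \<in> carrier B\<rbrakk> \<Longrightarrow> (\<lambda>c. mult_term i j a b c d) \<in> lin R A T"
    and "\<lbrakk>a \<in> carrier A; b \<in> carrier B; c \<in> carrier A\<rbrakk> \<Longrightarrow> (\<lambda>d. mult_term i j a b c d) \<in> lin R B T"
proof -
  note sc = lin_scaled[OF T_module _ sg_closed[OF R_cring]]
  note Al = bilin_left[OF Ar.mult_bilin] and Arr = bilin_right[OF Ar.mult_bilin]
  note Bl = bilin_left[OF Br.mult_bilin] and Brr = bilin_right[OF Br.mult_bilin]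
  note tl = bilin_left[OF tens_bilin] and tr = bilin_right[OF tens_bilin]
  note cA = A.component_carrier and cB = B.component_carrier
  show "\<lbrakk>b \<in> carrier B; c \<in> carrier A; d \<in> carrier B\<rbrakk> \<Longrightarrow> (\<lambda>a. mult_term i j a b c d) \<in> lin R A T"
    unfolding mult_term_def by (rule sc, rule lin_comp[OF Al tl]) (simp_all add: cA cB)
  show "\<lbrakk>a \<in> carrier A; c \<in> carrier A; d \<in> carrier B\<rbrakk> \<Longrightarrow> (\<lambda>b. mult_term i j a b c d) \<in> lin R B T"
    unfolding mult_term_def by (rule sc, rule lin_comp[OF lin_comp[OF B.component_lin Bl] tr]) (simp_all add: cA cB)
  show "\<lbrakk>a \<in> carrier A; b \<in> carrier B; d \<in> carrier B\<rbrakk> \<Longrightarrow> (\<lambda>c. mult_term i j a b c d) \<in> lin R A T"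
    unfolding mult_term_def by (rule sc, rule lin_comp[OF lin_comp[OF A.component_lin Arr] tl]) (simp_all add: cA cB)
  show "\<lbrakk>a \<in> carrier A; b \<in> carrier B; c \<in> carrier A\<rbrakk> \<Longrightarrow> (\<lambda>d. mult_term i j a b c d) \<in> lin R B T"
    unfolding mult_term_def by (rule sc, rule lin_comp[OF Brr tr]) (simp_all add: cA cB)
qed

lemma mult_term_closed:
  "\<lbrakk>a \<in> carrier A; b \<in> carrier B; c \<in> carrier A; d \<in> carrier B\<rbrakk> \<Longrightarrow> mult_term i j a b c d \<in> carrier T"
  by (rule lin_closed[OF mult_term_lin(1)])

lemma mult_term_zero:
  assumes "a \<in> carrier A" "b \<in> carrier B" "c \<in> carrier A" "d \<in> carrier B"
  shows "component B i b = \<zero>\<^bsub>B\<^esub> \<Longrightarrow> mult_term i j a b c d = \<zero>\<^bsub>T\<^esub>"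
    and "component A j c = \<zero>\<^bsub>A\<^esub> \<Longrightarrow> mult_term i j a b c d = \<zero>\<^bsub>T\<^esub>"
  using assms A.component_carrier B.component_carrier
    lin_zero[OF Ar.is_module T_module bilin_left[OF tens_bilin]]
    lin_zero[OF Br.is_module T_module bilin_right[OF tens_bilin]]
  by (simp_all add: mult_term_def sg_closed[OF R_cring])

abbreviation "tm \<equiv> tens_mult R A B"

lemma tens_mult_sum:
  assumes c: "a \<in> carrier A" "b \<in> carrier B" "c \<in> carrier A" "d \<in> carrier B"
    and S: "finite S" "{i. component B i b \<noteq> \<zero>\<^bsub>B\<^esub>} \<subseteq> S"
    and U: "finite U" "{j. component A j c \<noteq> \<zero>\<^bsub>A\<^esub>} \<subseteq> U"
  shows "tm a b c d = (\<Oplus>\<^bsub>T\<^esub>i\<in>S. \<Oplus>\<^bsub>T\<^esub>j\<in>U. mult_term i j a b c d)"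
proof -
  let ?S = "{i. component B i b \<noteq> \<zero>\<^bsub>B\<^esub>}" and ?U = "{j. component A j c \<noteq> \<zero>\<^bsub>A\<^esub>}"
  have k: "koszul T (i * j) (tens R A B (a \<otimes>\<^bsub>A\<^esub> component A j c) (component B i b \<otimes>\<^bsub>B\<^esub> d)) = mult_term i j a b c d" for i j
    unfolding mult_term_def using c A.component_carrier B.component_carrier
    by (intro koszul_smult T_module tens_closed) auto
  have inner: "(\<Oplus>\<^bsub>T\<^esub>j\<in>?U. mult_term i j a b c d) = (\<Oplus>\<^bsub>T\<^esub>j\<in>U. mult_term i j a b c d)" for i
    using U c mult_term_closed mult_term_zero(2) by (intro Tm.M.add.finprod_mono_neutral_cong_left) auto
  have zero: "(\<Oplus>\<^bsub>T\<^esub>j\<in>U. mult_term i j a b c d) = \<zero>\<^bsub>T\<^esub>" if "i \<notin> ?S" for i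
    using that c mult_term_zero(1) by (intro Tm.M.add.finprod_one_eqI) auto
  have "tm a b c d = (\<Oplus>\<^bsub>T\<^esub>i\<in>?S. \<Oplus>\<^bsub>T\<^esub>j\<in>U. mult_term i j a b c d)"
    by (simp add: tens_mult_def k inner)
  also have "\<dots> = (\<Oplus>\<^bsub>T\<^esub>i\<in>S. \<Oplus>\<^bsub>T\<^esub>j\<in>U. mult_term i j a b c d)"
  proof (rule Tm.M.add.finprod_mono_neutral_cong_left[OF S])
    show "(\<lambda>i. \<Oplus>\<^bsub>T\<^esub>j\<in>U. mult_term i j a b c d) \<in> S \<rightarrow> carrier T"
      using c mult_term_closed by (auto intro!: Tm.M.finsum_closed)
  qed (use zero in auto)
  finally show ?thesis .
qed

lemma tens_mult_lin:
  shows "\<lbrakk>b \<in> carrier B; c \<in> carrier A; d \<in> carrier B\<rbrakk> \<Longrightarrow> (\<lambda>a. tm a b c d) \<in> lin R A T"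
    and "\<lbrakk>a \<in> carrier A; c \<in> carrier A; d \<in> carrier B\<rbrakk> \<Longrightarrow> (\<lambda>b. tm a b c d) \<in> lin R B T"
    and "\<lbrakk>a \<in> carrier A; b \<in> carrier B; d \<in> carrier B\<rbrakk> \<Longrightarrow> (\<lambda>c. tm a b c d) \<in> lin R A T"
    and "\<lbrakk>a \<in> carrier A; b \<in> carrier B; c \<in> carrier A\<rbrakk> \<Longrightarrow> (\<lambda>d. tm a b c d) \<in> lin R B T"
proof -
  note sum = lin_sum[OF T_module]
  {
    assume c: "b \<in> carrier B" "c \<in> carrier A" "d \<in> carrier B"
    let ?S = "{i. component B i b \<noteq> \<zero>\<^bsub>B\<^esub>}" and ?U = "{j. component A j c \<noteq> \<zero>\<^bsub>A\<^esub>}"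
    have fin: "finite ?S" "finite ?U"
      using c B.component_finite A.component_finite by auto
    have "(\<lambda>a. \<Oplus>\<^bsub>T\<^esub>i\<in>?S. \<Oplus>\<^bsub>T\<^esub>j\<in>?U. mult_term i j a b c d) \<in> lin R A T"
      by (intro sum fin mult_term_lin c)
    then show "(\<lambda>a. tm a b c d) \<in> lin R A T"
      by (rule lin_cong[OF Ar.is_module]) (intro tens_mult_sum c fin subset_refl)
  }
  {
    assume c: "a \<in> carrier A" "b \<in> carrier B" "c \<in> carrier A"
    let ?S = "{i. component B i b \<noteq> \<zero>\<^bsub>B\<^esub>}" and ?U = "{j. component A j c \<noteq> \<zero>\<^bsub>A\<^esub>}"
    have fin: "finite ?S" "finite ?U"
      using c B.component_finite A.component_finite by auto
    have "(\<lambda>d. \<Oplus>\<^bsub>T\<^esub>i\<in>?S. \<Oplus>\<^bsub>T\<^esub>j\<in>?U. mult_term i j a b c d) \<in> lin R B T"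
      by (intro sum fin mult_term_lin c)
    then show "(\<lambda>d. tm a b c d) \<in> lin R B T"
      by (rule lin_cong[OF Br.is_module]) (intro tens_mult_sum c fin subset_refl)
  }
  {
    assume c: "a \<in> carrier A" "c \<in> carrier A" "d \<in> carrier B"
    let ?U = "{j. component A j c \<noteq> \<zero>\<^bsub>A\<^esub>}"
    have fin: "finite ?U"
      using c A.component_finite by auto
    show "(\<lambda>b. tm a b c d) \<in> lin R B T"
    proof (rule lin_locally_finite[OF T_module Br.is_module, where g = "\<lambda>i b. \<Oplus>\<^bsub>T\<^esub>j\<in>?U. mult_term i j a b c d"])
      show "(\<lambda>b. \<Oplus>\<^bsub>T\<^esub>j\<in>?U. mult_term i j a b c d) \<in> lin R B T" for i
        by (intro sum fin mult_term_lin c)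
      fix b assume b: "b \<in> carrier B"
      show "\<exists>F\<^sub>0. finite F\<^sub>0 \<and> (\<forall>F. finite F \<longrightarrow> F\<^sub>0 \<subseteq> F \<longrightarrow> tm a b c d = (\<Oplus>\<^bsub>T\<^esub>i\<in>F. \<Oplus>\<^bsub>T\<^esub>j\<in>?U. mult_term i j a b c d))"
        using tens_mult_sum[OF c(1) b c(2,3) _ _ fin] B.component_finite[OF b]
        by (intro exI[of _ "{i. component B i b \<noteq> \<zero>\<^bsub>B\<^esub>}"]) auto
    qed
  }
  {
    assume c: "a \<in> carrier A" "b \<in> carrier B" "d \<in> carrier B"
    let ?S = "{i. component B i b \<noteq> \<zero>\<^bsub>B\<^esub>}"
    have fin: "finite ?S"
      using c B.component_finite by auto
    have inner: "(\<lambda>c. \<Oplus>\<^bsub>T\<^esub>j\<in>{j. component A j c \<noteq> \<zero>\<^bsub>A\<^esub>}. mult_term i j a b c d) \<in> lin R A T" for i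
    proof (rule lin_locally_finite[OF T_module Ar.is_module mult_term_lin(3)[OF c]])
      fix c' assume c': "c' \<in> carrier A"
      let ?U = "{j. component A j c' \<noteq> \<zero>\<^bsub>A\<^esub>}"
      have "(\<Oplus>\<^bsub>T\<^esub>j\<in>?U. mult_term i j a b c' d) = (\<Oplus>\<^bsub>T\<^esub>j\<in>F. mult_term i j a b c' d)" if "finite F" "?U \<subseteq> F" for F
        using that c c' mult_term_closed mult_term_zero(2) by (intro Tm.M.add.finprod_mono_neutral_cong_left) auto
      then show "\<exists>F\<^sub>0. finite F\<^sub>0 \<and> (\<forall>F. finite F \<longrightarrow> F\<^sub>0 \<subseteq> F \<longrightarrow>
          (\<Oplus>\<^bsub>T\<^esub>j\<in>?U. mult_term i j a b c' d) = (\<Oplus>\<^bsub>T\<^esub>j\<in>F. mult_term i j a b c' d))"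
        using A.component_finite[OF c'] by blast
    qed
    have "(\<lambda>c. \<Oplus>\<^bsub>T\<^esub>i\<in>?S. \<Oplus>\<^bsub>T\<^esub>j\<in>{j. component A j c \<noteq> \<zero>\<^bsub>A\<^esub>}. mult_term i j a b c d) \<in> lin R A T"
      by (rule sum[OF fin inner])
    then show "(\<lambda>c. tm a b c d) \<in> lin R A T"
      by (rule lin_cong[OF Ar.is_module]) (intro tens_mult_sum c fin subset_refl A.component_finite)
  }
qed

lemma tens_mult_homog:
  assumes c: "a \<in> carrier A" "b \<in> grade B i" "c \<in> grade A j" "d \<in> carrier B"
  shows "tm a b c d = sg R (i * j) \<odot>\<^bsub>T\<^esub> tens R A B (a \<otimes>\<^bsub>A\<^esub> c) (b \<otimes>\<^bsub>B\<^esub> d)"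
proof -
  note cc = B.grade_subset[OF c(2)] A.grade_subset[OF c(3)]
  have "tm a b c d = (\<Oplus>\<^bsub>T\<^esub>i'\<in>{i}. \<Oplus>\<^bsub>T\<^esub>j'\<in>{j}. mult_term i' j' a b c d)"
    using c cc by (intro tens_mult_sum) (auto simp: B.component_homog[OF c(2)] A.component_homog[OF c(3)])
  also have "\<dots> = mult_term i j a b c d"
    using mult_term_closed[OF c(1) cc c(4)] by simp
  finally show ?thesis
    by (simp add: mult_term_def B.component_homog[OF c(2)] A.component_homog[OF c(3)])
qed

lemma tens_mult_bilin: "\<lbrakk>a \<in> carrier A; b \<in> carrier B\<rbrakk> \<Longrightarrow> tm a b \<in> bilin R A B T"
  by (intro bilinI tens_mult_lin)

lemma TA_mult_def:
  "X \<otimes>\<^bsub>TA\<^esub> Y = tensor_lift R T (\<lambda>a b. tensor_lift R T (tm a b) Y) X"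
  by (simp add: tensor_algebra_def)

lemma inner_lin: "\<lbrakk>a \<in> carrier A; b \<in> carrier B\<rbrakk> \<Longrightarrow> tensor_lift R T (tm a b) \<in> lin R T T"
  by (intro tensor_lift_lin T_module tens_mult_bilin)

lemma inner_tens:
  "\<lbrakk>a \<in> carrier A; b \<in> carrier B; c \<in> carrier A; d \<in> carrier B\<rbrakk>
    \<Longrightarrow> tensor_lift R T (tm a b) (tens R A B c d) = tm a b c d"
  by (rule tensor_lift_tens[OF T_module tens_mult_bilin])

text \<open>Two linear maps in \<open>Y\<close> are compared on pure tensors, where they are values of
  \<^const>\<open>tens_mult\<close>.\<close>

lemma inner_bilin:
  assumes Y: "Y \<in> carrier T"
  shows "(\<lambda>a b. tensor_lift R T (tm a b) Y) \<in> bilin R A B T"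
proof -
  note il = inner_lin and it = inner_tens
  note eqI = tensor_lin_eqI[OF T_module _ _ Y]
  show ?thesis
  proof (intro bilinI linI lin_closed[OF il Y])
    fix a a' b assume c: "a \<in> carrier A" "a' \<in> carrier A" "b \<in> carrier B"
    show "tensor_lift R T (tm (a \<oplus>\<^bsub>A\<^esub> a') b) Y =
        tensor_lift R T (tm a b) Y \<oplus>\<^bsub>T\<^esub> tensor_lift R T (tm a' b) Y"
      by (rule eqI[OF il lin_plus[OF T_module il il]])
        (use c in \<open>simp_all add: it lin_add[OF tens_mult_lin(1)]\<close>)
  next
    fix r a b assume c: "r \<in> carrier R" "a \<in> carrier A" "b \<in> carrier B"
    show "tensor_lift R T (tm (r \<odot>\<^bsub>A\<^esub> a) b) Y = r \<odot>\<^bsub>T\<^esub> tensor_lift R T (tm a b) Y"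
      by (rule eqI[OF il lin_scaled[OF T_module il]])
        (use c in \<open>simp_all add: it lin_smult[OF tens_mult_lin(1)]\<close>)
  next
    fix a b b' assume c: "a \<in> carrier A" "b \<in> carrier B" "b' \<in> carrier B"
    show "tensor_lift R T (tm a (b \<oplus>\<^bsub>B\<^esub> b')) Y =
        tensor_lift R T (tm a b) Y \<oplus>\<^bsub>T\<^esub> tensor_lift R T (tm a b') Y"
      by (rule eqI[OF il lin_plus[OF T_module il il]])
        (use c in \<open>simp_all add: it lin_add[OF tens_mult_lin(2)]\<close>)
  next
    fix r a b assume c: "r \<in> carrier R" "a \<in> carrier A" "b \<in> carrier B"
    show "tensor_lift R T (tm a (r \<odot>\<^bsub>B\<^esub> b)) Y = r \<odot>\<^bsub>T\<^esub> tensor_lift R T (tm a b) Y"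
      by (rule eqI[OF il lin_scaled[OF T_module il]])
        (use c in \<open>simp_all add: it lin_smult[OF tens_mult_lin(2)]\<close>)
  qed
qed

lemma TA_mult_tens_left:
  "\<lbrakk>a \<in> carrier A; b \<in> carrier B; Y \<in> carrier T\<rbrakk>
    \<Longrightarrow> tens R A B a b \<otimes>\<^bsub>TA\<^esub> Y = tensor_lift R T (tm a b) Y"
  unfolding TA_mult_def by (rule tensor_lift_tens[OF T_module inner_bilin])

lemma TA_mult_left: "Y \<in> carrier T \<Longrightarrow> (\<lambda>X. X \<otimes>\<^bsub>TA\<^esub> Y) \<in> lin R T T"
  unfolding TA_mult_def by (rule tensor_lift_lin[OF T_module inner_bilin])

lemma TA_mult_right: "X \<in> carrier T \<Longrightarrow> (\<lambda>Y. X \<otimes>\<^bsub>TA\<^esub> Y) \<in> lin R T T"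
proof -
  assume X: "X \<in> carrier T"
  note eqI = tensor_lin_eqI[OF T_module _ _ X]
  note l = TA_mult_left
  show ?thesis
  proof (rule linI)
    fix Y Z assume YZ: "Y \<in> carrier T" "Z \<in> carrier T"
    show "X \<otimes>\<^bsub>TA\<^esub> (Y \<oplus>\<^bsub>T\<^esub> Z) = X \<otimes>\<^bsub>TA\<^esub> Y \<oplus>\<^bsub>T\<^esub> X \<otimes>\<^bsub>TA\<^esub> Z"
      by (rule eqI[OF l lin_plus[OF T_module l l]])
        (use YZ in \<open>simp_all add: TA_mult_tens_left lin_add[OF inner_lin]\<close>)
  next
    fix r Y assume rY: "r \<in> carrier R" "Y \<in> carrier T"
    show "X \<otimes>\<^bsub>TA\<^esub> (r \<odot>\<^bsub>T\<^esub> Y) = r \<odot>\<^bsub>T\<^esub> (X \<otimes>\<^bsub>TA\<^esub> Y)"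
      by (rule eqI[OF l lin_scaled[OF T_module l]])
        (use rY in \<open>simp_all add: TA_mult_tens_left lin_smult[OF inner_lin]\<close>)
  qed (rule lin_closed[OF l X])
qed

lemma TA_mult_closed: "\<lbrakk>X \<in> carrier T; Y \<in> carrier T\<rbrakk> \<Longrightarrow> X \<otimes>\<^bsub>TA\<^esub> Y \<in> carrier T"
  by (rule lin_closed[OF TA_mult_left])

lemma TA_mult_tens:
  assumes "a \<in> carrier A" "b \<in> grade B i" "c \<in> grade A j" "d \<in> carrier B"
  shows "tens R A B a b \<otimes>\<^bsub>TA\<^esub> tens R A B c d =
    sg R (i * j) \<odot>\<^bsub>T\<^esub> tens R A B (a \<otimes>\<^bsub>A\<^esub> c) (b \<otimes>\<^bsub>B\<^esub> d)"
  using assms B.grade_subset[OF assms(2)] A.grade_subset[OF assms(3)]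
  by (simp add: TA_mult_tens_left tens_closed inner_tens tens_mult_homog)

text \<open>In \<open>(a \<otimes> b)(c \<otimes> d)(e \<otimes> f)\<close> both bracketings carry the sign
  \<open>(-1)^(|b||c| + |b||e| + |d||e|)\<close>.\<close>

lemma TA_assoc:
  assumes X: "X \<in> carrier T" and Y: "Y \<in> carrier T" and Z: "Z \<in> carrier T"
  shows "(X \<otimes>\<^bsub>TA\<^esub> Y) \<otimes>\<^bsub>TA\<^esub> Z = X \<otimes>\<^bsub>TA\<^esub> (Y \<otimes>\<^bsub>TA\<^esub> Z)"
proof -
  note l = TA_mult_left and r = TA_mult_right
  have 3: "(tens R A B a b \<otimes>\<^bsub>TA\<^esub> tens R A B c d) \<otimes>\<^bsub>TA\<^esub> tens R A B e f =
      tens R A B a b \<otimes>\<^bsub>TA\<^esub> (tens R A B c d \<otimes>\<^bsub>TA\<^esub> tens R A B e f)"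
    if h: "a \<in> grade A i" "b \<in> grade B j" "c \<in> grade A i'" "d \<in> grade B j'" "e \<in> grade A i''" "f \<in> grade B j''"
    for a b c d e f i j i' j' i'' j''
  proof -
    note cA = h(1,3,5)[THEN A.grade_subset] and cB = h(2,4,6)[THEN B.grade_subset]
    note bd = B.grade_mult[OF h(2,4)] and ce = A.grade_mult[OF h(3,5)]
    have s: "sg R (j * i') \<otimes>\<^bsub>R\<^esub> sg R ((j + j') * i'') = sg R (j' * i'') \<otimes>\<^bsub>R\<^esub> sg R (j * (i' + i''))"
      unfolding sg_mult[OF R_cring] by (rule sg_cong) auto
    show ?thesis
      using cA cB
      by (simp add: TA_mult_tens[OF _ h(2,3)] TA_mult_tens[OF _ h(4,5)] TA_mult_tens[OF _ bd h(5)]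
          TA_mult_tens[OF _ h(2) ce] tens_closed sg_closed[OF R_cring] lin_smult[OF l] lin_smult[OF r]
          Tm.smult_assoc1[symmetric] s A.m_assoc B.m_assoc)
  qed
  have 2: "(tens R A B a b \<otimes>\<^bsub>TA\<^esub> tens R A B c d) \<otimes>\<^bsub>TA\<^esub> Z =
      tens R A B a b \<otimes>\<^bsub>TA\<^esub> (tens R A B c d \<otimes>\<^bsub>TA\<^esub> Z)"
    if h: "a \<in> grade A i" "b \<in> grade B j" "c \<in> grade A i'" "d \<in> grade B j'" for a b c d i j i' j'
  proof -
    note cs = tens_closed[OF A.grade_subset[OF h(1)] B.grade_subset[OF h(2)]]
      tens_closed[OF A.grade_subset[OF h(3)] B.grade_subset[OF h(4)]]
    show ?thesis
      by (rule tensor_lin_eq_homogI[OF r[OF TA_mult_closed[OF cs]] lin_comp[OF r[OF cs(2)] r[OF cs(1)]] Z])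
        (rule 3[OF h])
  qed
  have 1: "(tens R A B a b \<otimes>\<^bsub>TA\<^esub> Y) \<otimes>\<^bsub>TA\<^esub> Z = tens R A B a b \<otimes>\<^bsub>TA\<^esub> (Y \<otimes>\<^bsub>TA\<^esub> Z)"
    if h: "a \<in> grade A i" "b \<in> grade B j" for a b i j
  proof -
    note cs = tens_closed[OF A.grade_subset[OF h(1)] B.grade_subset[OF h(2)]]
    show ?thesis
      by (rule tensor_lin_eq_homogI[OF lin_comp[OF r[OF cs] l[OF Z]] lin_comp[OF l[OF Z] r[OF cs]] Y])
        (rule 2[OF h])
  qed
  show ?thesis
    by (rule tensor_lin_eq_homogI[OF lin_comp[OF l[OF Y] l[OF Z]] l[OF TA_mult_closed[OF Y Z]] X])
      (rule 1)
qed

lemma TA_one: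
  assumes X: "X \<in> carrier T"
  shows "tens R A B \<one>\<^bsub>A\<^esub> \<one>\<^bsub>B\<^esub> \<otimes>\<^bsub>TA\<^esub> X = X"
    and "X \<otimes>\<^bsub>TA\<^esub> tens R A B \<one>\<^bsub>A\<^esub> \<one>\<^bsub>B\<^esub> = X"
proof -
  have o: "tens R A B \<one>\<^bsub>A\<^esub> \<one>\<^bsub>B\<^esub> \<in> carrier T"
    by (intro tens_closed) auto
  show "tens R A B \<one>\<^bsub>A\<^esub> \<one>\<^bsub>B\<^esub> \<otimes>\<^bsub>TA\<^esub> X = X"
  proof (rule tensor_lin_eq_homogI[OF TA_mult_right[OF o] lin_id X])
    fix i j a b assume h: "a \<in> grade A i" "b \<in> grade B j"
    note c = A.grade_subset[OF h(1)] B.grade_subset[OF h(2)]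
    show "tens R A B \<one>\<^bsub>A\<^esub> \<one>\<^bsub>B\<^esub> \<otimes>\<^bsub>TA\<^esub> tens R A B a b = tens R A B a b"
      using c by (simp add: TA_mult_tens[OF _ B.grade_one h(1)] sg_0 tens_closed)
  qed
  show "X \<otimes>\<^bsub>TA\<^esub> tens R A B \<one>\<^bsub>A\<^esub> \<one>\<^bsub>B\<^esub> = X"
  proof (rule tensor_lin_eq_homogI[OF TA_mult_left[OF o] lin_id X])
    fix i j a b assume h: "a \<in> grade A i" "b \<in> grade B j"
    note c = A.grade_subset[OF h(1)] B.grade_subset[OF h(2)]
    show "tens R A B a b \<otimes>\<^bsub>TA\<^esub> tens R A B \<one>\<^bsub>A\<^esub> \<one>\<^bsub>B\<^esub> = tens R A B a b"
      using c by (simp add: TA_mult_tens[OF _ h(2) A.grade_one] sg_0 tens_closed)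
  qed
qed

lemma TA_grade_mult:
  assumes "X \<in> grade T m" "Y \<in> grade T n"
  shows "X \<otimes>\<^bsub>TA\<^esub> Y \<in> grade T (m + n)"
  using assms(1)
proof (induction rule: tensor_grade_induct)
  case (tens i j a b)
  note ab = tens
  note c = A.grade_subset[OF tens(2)] B.grade_subset[OF tens(3)]
  show ?case
    using assms(2)
  proof (induction rule: tensor_grade_induct)
    case (tens k l e f)
    have deg: "i + k + (j + l) = m + n"
      using tens(1) ab(1) by simp
    have "tens R A B (a \<otimes>\<^bsub>A\<^esub> e) (b \<otimes>\<^bsub>B\<^esub> f) \<in> grade T (m + n)"
      using tens_grade[OF A.grade_mult[OF ab(2) tens(2)] B.grade_mult[OF ab(3) tens(3)]]
      unfolding deg .
    then show ?case
      using TA_mult_tens[OF c(1) ab(3) tens(2) B.grade_subset[OF tens(3)]]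
        Tm.grade_smult sg_closed[OF R_cring] by simp
  next
    case (add x y)
    then show ?case
      using Tm.grade_subset Tm.grade_add tens_closed[OF c]
      by (simp add: lin_add[OF TA_mult_right[OF tens_closed[OF c]]])
  qed
next
  case (add x y)
  then show ?case
    using Tm.grade_subset Tm.grade_add
    by (simp add: lin_add[OF TA_mult_left[OF Tm.grade_subset[OF assms(2)]]])
qed

lemma TA_module: "module R TA"
  using T_module by (rule module_surj[where \<pi> = "\<lambda>x. x"]) (simp_all add: TA_fields)

lemma TA_ralg: "ralg R TA"
proof -
  interpret TA: module R TA by (rule TA_module)
  have o: "tens R A B \<one>\<^bsub>A\<^esub> \<one>\<^bsub>B\<^esub> \<in> carrier T"
    by (intro tens_closed) auto
  show ?thesis
    by (intro ralg.intro ralg_axioms.intro TA_module ringI monoidI TA.M.abelian_group_axioms)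
      (simp_all add: TA_fields o TA_mult_closed TA_assoc TA_one lin_add[OF TA_mult_left]
        lin_add[OF TA_mult_right] lin_smult[OF TA_mult_left] lin_smult[OF TA_mult_right])
qed

lemma TA_homog_decomp: "homog_decomp TA x c \<longleftrightarrow> homog_decomp T x c"
  by (simp add: homog_decomp_def finsum_def TA_fields)

lemma TA_submodule: "submodule (grade T n) R TA"
  using T_grade_submodule by (simp add: submodule_def submodule_axioms_def TA_fields)

lemma TA_graded_algebra: "graded_algebra R TA"
proof -
  interpret TA: ralg R TA by (rule TA_ralg)
  show ?thesis
    by (intro graded_algebra.intro graded_algebra_axioms.intro TA_module TA.ring_axioms
        TA.smult_mult_left TA.smult_mult_right)
      (simp_all add: TA_fields TA_submodule TA_homog_decomp Tm.grade_decomp TA_grade_mult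
        tens_grade[OF A.grade_one B.grade_one, simplified])
qed

end

section \<open>Homomorphisms out of a tensor product\<close>

lemma ralg_hom_cong:
  assumes "ralg R A" "f \<in> ralg_hom R A C" "\<And>x. x \<in> carrier A \<Longrightarrow> g x = f x"
  shows "g \<in> ralg_hom R A C"
proof -
  interpret A: ralg R A by fact
  show ?thesis
    using assms(3)
    by (intro ralg_homI lin_cong[OF A.is_module ralg_hom_lin[OF assms(2)]])
      (simp_all add: ralg_hom_mult[OF assms(2)] ralg_hom_one[OF assms(2)])
qed

lemma (in graded_module) grade_finsum:
  assumes "\<And>i. i \<in> S \<Longrightarrow> f i \<in> grade M n"
  shows "(\<Oplus>i\<in>S. f i) \<in> grade M n"
proof (cases "finite S")
  case True
  then show ?thesis
    using assms
  proof (induction S)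
    case empty
    show ?case using grade_zero by simp
  next
    case (insert x S)
    then show ?case
      using grade_subset[of _ n] by (subst M.finsum_insert) (auto intro!: grade_add)
  qed
next
  case False
  then show ?thesis using grade_zero by (simp add: M.finsum_infinite)
qed

text \<open>A word in homogeneous letters is evaluated to a product whose degree is the sum of the degrees
  of the letters.\<close>

lemma fp_copair_grade:
  assumes A: "ralg R A" and B: "ralg R B" and C: "graded_algebra R C"
    and f: "f \<in> ralg_hom R A C" "\<And>i a. a \<in> grade A i \<Longrightarrow> f a \<in> grade C i"
    and g: "g \<in> ralg_hom R B C" "\<And>i b. b \<in> grade B i \<Longrightarrow> g b \<in> grade C i"
    and z: "z \<in> grade (free_product R A B) n"
  shows "fp_copair R C f g z \<in> grade C n"
proof -
  interpret C: graded_algebra R C by fact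
  interpret Cg: graded_module R C by (rule C.is_graded_module)
  let ?ev = "eval_word C (case_sum f g)"
  obtain p where p: "p \<in> fp_homog R A B n" "z = fp_ideal R A B +>\<^bsub>fp_words R A B\<^esub> p"
    using z by (auto simp: free_product_def graded_quot_fields)
  have pc: "p \<in> carrier (fp_words R A B)"
    using p(1) by (simp add: fp_homog_def)
  then have pr: "p w \<in> carrier R" for w
    by (simp add: fp_words_def free_algebra_fields free_module_carrier)
  have ev: "?ev w \<in> grade C (sum_list ds)"
    if "list_all2 (\<lambda>l d. case l of Inl a \<Rightarrow> a \<in> grade A d | Inr b \<Rightarrow> b \<in> grade B d) w ds" for w ds
    using that
  proof (induction rule: list_all2_induct)
    case Nil
    show ?case by (simp add: C.grade_one)
  next
    case (Cons l w d ds)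
    then show ?case
      using f(2) g(2) by (auto split: sum.splits intro!: C.grade_mult)
  qed
  have "p w \<odot>\<^bsub>C\<^esub> ?ev w \<in> grade C n" if "p w \<noteq> \<zero>\<^bsub>R\<^esub>" for w
  proof -
    obtain ds where "sum_list ds = n"
      "list_all2 (\<lambda>l d. case l of Inl a \<Rightarrow> a \<in> grade A d | Inr b \<Rightarrow> b \<in> grade B d) w ds"
      using p(1) \<open>p w \<noteq> \<zero>\<^bsub>R\<^esub>\<close> by (auto simp: fp_homog_def)
    then show ?thesis
      using ev pr Cg.grade_smult by blast
  qed
  then have "linear_ext R C ?ev p \<in> grade C n"
    unfolding linear_ext_def by (intro Cg.grade_finsum) simp
  then show ?thesis
    unfolding p(2) fp_copair_coset[OF A B C.is_ralg f(1) g(1) pc] .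
qed

context galg_pair
begin

definition tensor_copair :: "('r, 'c, 'l) gralg_scheme \<Rightarrow> ('a \<Rightarrow> 'c) \<Rightarrow> ('b \<Rightarrow> 'c) \<Rightarrow> ('a \<times> 'b \<Rightarrow> 'r) set \<Rightarrow> 'c" where
  "tensor_copair C f g = tensor_lift R C (\<lambda>a b. f a \<otimes>\<^bsub>C\<^esub> g b)"

lemma tensor_copair_bilin:
  assumes "ralg R C" "f \<in> lin R A C" "g \<in> lin R B C"
  shows "(\<lambda>a b. f a \<otimes>\<^bsub>C\<^esub> g b) \<in> bilin R A B C"
  using bilin_comp[OF assms(2,3) ralg.mult_bilin[OF assms(1)]] .

lemma tensor_copair_lin:
  assumes "ralg R C" "f \<in> lin R A C" "g \<in> lin R B C"
  shows "tensor_copair C f g \<in> lin R T C"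
  unfolding tensor_copair_def by (rule tensor_lift_lin[OF ralg.is_module[OF assms(1)] tensor_copair_bilin[OF assms]])

lemma tensor_copair_tens:
  assumes "ralg R C" "f \<in> lin R A C" "g \<in> lin R B C" "a \<in> carrier A" "b \<in> carrier B"
  shows "tensor_copair C f g (tens R A B a b) = f a \<otimes>\<^bsub>C\<^esub> g b"
  unfolding tensor_copair_def
  by (rule tensor_lift_tens[OF ralg.is_module[OF assms(1)] tensor_copair_bilin[OF assms(1-3)] assms(4,5)])

text \<open>Multiplying out \<open>f a \<cdot> g b \<cdot> f c \<cdot> g d\<close> requires moving \<open>g b\<close> past \<open>f c\<close>, which costs
  exactly the sign in the product \<open>(a \<otimes> b)(c \<otimes> d)\<close>.\<close>

lemma tensor_copair_hom:
  assumes C: "ralg R C" and f: "f \<in> ralg_hom R A C" and g: "g \<in> ralg_hom R B C"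
    and comm: "\<And>i j a b. \<lbrakk>a \<in> grade A i; b \<in> grade B j\<rbrakk>
      \<Longrightarrow> g b \<otimes>\<^bsub>C\<^esub> f a = sg R (i * j) \<odot>\<^bsub>C\<^esub> (f a \<otimes>\<^bsub>C\<^esub> g b)"
  shows "tensor_copair C f g \<in> ralg_hom R TA C"
proof -
  interpret C: ralg R C by fact
  note fl = ralg_hom_lin[OF f] and gl = ralg_hom_lin[OF g]
  let ?h = "tensor_copair C f g"
  note h = tensor_copair_lin[OF C fl gl] and ht = tensor_copair_tens[OF C fl gl]
  note Cl = bilin_left[OF C.mult_bilin] and Cr = bilin_right[OF C.mult_bilin]
  note tc = tens_closed[OF A.grade_subset B.grade_subset]
  have 2: "?h (tens R A B a b \<otimes>\<^bsub>TA\<^esub> tens R A B c d) = ?h (tens R A B a b) \<otimes>\<^bsub>C\<^esub> ?h (tens R A B c d)"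
    if h': "a \<in> grade A i" "b \<in> grade B j" "c \<in> grade A k" "d \<in> grade B l" for a b c d i j k l
  proof -
    note cA = h'(1,3)[THEN A.grade_subset] and cB = h'(2,4)[THEN B.grade_subset]
    note fc = lin_closed[OF fl] and gc = lin_closed[OF gl]
    have e: "?h (tens R A B a b \<otimes>\<^bsub>TA\<^esub> tens R A B c d) = sg R (j * k) \<odot>\<^bsub>C\<^esub> (f (a \<otimes>\<^bsub>A\<^esub> c) \<otimes>\<^bsub>C\<^esub> g (b \<otimes>\<^bsub>B\<^esub> d))"
      using cA cB by (simp add: TA_mult_tens[OF cA(1) h'(2,3) cB(2)] lin_smult[OF h] tens_closed ht sg_closed[OF R_cring])
    have "f a \<otimes>\<^bsub>C\<^esub> g b \<otimes>\<^bsub>C\<^esub> (f c \<otimes>\<^bsub>C\<^esub> g d) = f a \<otimes>\<^bsub>C\<^esub> (g b \<otimes>\<^bsub>C\<^esub> f c) \<otimes>\<^bsub>C\<^esub> g d"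
      using cA cB fc gc by (simp add: C.m_assoc)
    also have "\<dots> = sg R (j * k) \<odot>\<^bsub>C\<^esub> ((f a \<otimes>\<^bsub>C\<^esub> f c) \<otimes>\<^bsub>C\<^esub> (g b \<otimes>\<^bsub>C\<^esub> g d))"
      using cA cB fc gc
      by (simp add: comm[OF h'(3,2)] mult.commute[of k j] C.smult_mult_left C.smult_mult_right C.m_assoc sg_closed[OF R_cring])
    finally show ?thesis
      using cA cB unfolding e by (simp add: ht ralg_hom_mult[OF f] ralg_hom_mult[OF g])
  qed
  have 1: "?h (tens R A B a b \<otimes>\<^bsub>TA\<^esub> Y) = ?h (tens R A B a b) \<otimes>\<^bsub>C\<^esub> ?h Y"
    if h': "a \<in> grade A i" "b \<in> grade B j" and Y: "Y \<in> carrier T" for a b i j Y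
    by (rule tensor_lin_eq_homogI[OF lin_comp[OF TA_mult_right[OF tc[OF h']] h]
          lin_comp[OF h Cr[OF lin_closed[OF h tc[OF h']]]] Y])
      (rule 2[OF h'])
  show ?thesis
  proof (rule ralg_homI)
    show "?h \<in> lin R TA C" using h by (simp add: TA_lin)
    fix X Y assume XY: "X \<in> carrier TA" "Y \<in> carrier TA"
    then have c: "X \<in> carrier T" "Y \<in> carrier T" by (simp_all add: TA_fields)
    show "?h (X \<otimes>\<^bsub>TA\<^esub> Y) = ?h X \<otimes>\<^bsub>C\<^esub> ?h Y"
      by (rule tensor_lin_eq_homogI[OF lin_comp[OF TA_mult_left[OF c(2)] h]
            lin_comp[OF h Cl[OF lin_closed[OF h c(2)]]] c(1)])
        (rule 1[OF _ _ c(2)])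
  next
    show "?h \<one>\<^bsub>TA\<^esub> = \<one>\<^bsub>C\<^esub>"
      by (simp add: TA_fields ht ralg_hom_one[OF f] ralg_hom_one[OF g])
  qed
qed

lemma tens1_hom: "(\<lambda>a. tens R A B a \<one>\<^bsub>B\<^esub>) \<in> ralg_hom R A TA"
proof (rule ralg_homI)
  show l: "(\<lambda>a. tens R A B a \<one>\<^bsub>B\<^esub>) \<in> lin R A TA"
    using bilin_left[OF tens_bilin] by (simp add: TA_lin)
  fix x y assume xy: "x \<in> carrier A" "y \<in> carrier A"
  note l' = l[unfolded TA_lin]
  show "tens R A B (x \<otimes>\<^bsub>A\<^esub> y) \<one>\<^bsub>B\<^esub> = tens R A B x \<one>\<^bsub>B\<^esub> \<otimes>\<^bsub>TA\<^esub> tens R A B y \<one>\<^bsub>B\<^esub>"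
  proof (rule A.lin_eq_on_homog[OF lin_comp[OF bilin_right[OF Ar.mult_bilin xy(1)] l']
        lin_comp[OF l' TA_mult_right[OF lin_closed[OF l' xy(1)]]] xy(2)])
    fix n y assume y: "y \<in> grade A n"
    then show "tens R A B (x \<otimes>\<^bsub>A\<^esub> y) \<one>\<^bsub>B\<^esub> = tens R A B x \<one>\<^bsub>B\<^esub> \<otimes>\<^bsub>TA\<^esub> tens R A B y \<one>\<^bsub>B\<^esub>"
      using xy(1) A.grade_subset[OF y]
      by (simp add: TA_mult_tens[OF _ B.grade_one y] sg_0 tens_closed)
  qed
next
  show "tens R A B \<one>\<^bsub>A\<^esub> \<one>\<^bsub>B\<^esub> = \<one>\<^bsub>TA\<^esub>" by (simp add: TA_fields)
qed

lemma tens2_hom: "(\<lambda>b. tens R A B \<one>\<^bsub>A\<^esub> b) \<in> ralg_hom R B TA"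
proof (rule ralg_homI)
  show l: "(\<lambda>b. tens R A B \<one>\<^bsub>A\<^esub> b) \<in> lin R B TA"
    using bilin_right[OF tens_bilin] by (simp add: TA_lin)
  fix x y assume xy: "x \<in> carrier B" "y \<in> carrier B"
  note l' = l[unfolded TA_lin]
  show "tens R A B \<one>\<^bsub>A\<^esub> (x \<otimes>\<^bsub>B\<^esub> y) = tens R A B \<one>\<^bsub>A\<^esub> x \<otimes>\<^bsub>TA\<^esub> tens R A B \<one>\<^bsub>A\<^esub> y"
  proof (rule B.lin_eq_on_homog[OF lin_comp[OF bilin_left[OF Br.mult_bilin xy(2)] l']
        lin_comp[OF l' TA_mult_left[OF lin_closed[OF l' xy(2)]]] xy(1)])
    fix n x assume x: "x \<in> grade B n"
    then show "tens R A B \<one>\<^bsub>A\<^esub> (x \<otimes>\<^bsub>B\<^esub> y) = tens R A B \<one>\<^bsub>A\<^esub> x \<otimes>\<^bsub>TA\<^esub> tens R A B \<one>\<^bsub>A\<^esub> y"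
      using xy(2) B.grade_subset[OF x]
      by (simp add: TA_mult_tens[OF _ x A.grade_one] sg_0 tens_closed)
  qed
next
  show "tens R A B \<one>\<^bsub>A\<^esub> \<one>\<^bsub>B\<^esub> = \<one>\<^bsub>TA\<^esub>" by (simp add: TA_fields)
qed

lemma tens1_tens2:
  "\<lbrakk>a \<in> carrier A; b \<in> carrier B\<rbrakk>
    \<Longrightarrow> tens R A B a \<one>\<^bsub>B\<^esub> \<otimes>\<^bsub>TA\<^esub> tens R A B \<one>\<^bsub>A\<^esub> b = tens R A B a b"
  by (simp add: TA_mult_tens[OF _ B.grade_one A.grade_one] sg_0 tens_closed)

lemma tens2_tens1:
  assumes "a \<in> grade A i" "b \<in> grade B j"
  shows "tens R A B \<one>\<^bsub>A\<^esub> b \<otimes>\<^bsub>TA\<^esub> tens R A B a \<one>\<^bsub>B\<^esub> =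
    sg R (i * j) \<odot>\<^bsub>TA\<^esub> (tens R A B a \<one>\<^bsub>B\<^esub> \<otimes>\<^bsub>TA\<^esub> tens R A B \<one>\<^bsub>A\<^esub> b)"
  using A.grade_subset[OF assms(1)] B.grade_subset[OF assms(2)]
  by (simp add: TA_mult_tens[OF _ assms(2,1)] tens1_tens2 TA_fields mult.commute)

definition fp_to_tensor :: "(('a + 'b) list \<Rightarrow> 'r) set \<Rightarrow> ('a \<times> 'b \<Rightarrow> 'r) set" where
  "fp_to_tensor = fp_copair R TA (\<lambda>a. tens R A B a \<one>\<^bsub>B\<^esub>) (\<lambda>b. tens R A B \<one>\<^bsub>A\<^esub> b)"

lemma fp_to_tensor_hom: "fp_to_tensor \<in> ralg_hom R (free_product R A B) TA"
  unfolding fp_to_tensor_def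
  by (rule fp_copair_hom[OF Ar.ralg_axioms Br.ralg_axioms TA_ralg tens1_hom tens2_hom])

lemma fp_to_tensor_grade:
  assumes "z \<in> grade (free_product R A B) n"
  shows "fp_to_tensor z \<in> grade T n"
proof -
  have "fp_to_tensor z \<in> grade TA n"
    unfolding fp_to_tensor_def
    by (rule fp_copair_grade[OF Ar.ralg_axioms Br.ralg_axioms TA_graded_algebra tens1_hom _ tens2_hom _ assms])
      (use tens_grade[OF _ B.grade_one] tens_grade[OF A.grade_one] in \<open>simp_all add: TA_fields\<close>)
  then show ?thesis by (simp add: TA_fields)
qed

text \<open>Both sides are homomorphisms, the right-hand side because \<open>f\<close> and \<open>g\<close> commute, and they agree
  on the two inclusions.\<close>

lemma fp_copair_factor:
  assumes C: "ralg R C" and f: "f \<in> ralg_hom R A C" and g: "g \<in> ralg_hom R B C"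
    and comm: "\<And>i j a b. \<lbrakk>a \<in> grade A i; b \<in> grade B j\<rbrakk>
      \<Longrightarrow> g b \<otimes>\<^bsub>C\<^esub> f a = sg R (i * j) \<odot>\<^bsub>C\<^esub> (f a \<otimes>\<^bsub>C\<^esub> g b)"
    and z: "z \<in> carrier (free_product R A B)"
  shows "fp_copair R C f g z = tensor_copair C f g (fp_to_tensor z)"
proof (rule free_product_hom_eqI[OF Ar.ralg_axioms Br.ralg_axioms C _ _ _ _ z])
  interpret C: ralg R C by fact
  note fl = ralg_hom_lin[OF f] and gl = ralg_hom_lin[OF g]
  note ax = Ar.ralg_axioms Br.ralg_axioms
  show "fp_copair R C f g \<in> ralg_hom R (free_product R A B) C"
    by (rule fp_copair_hom[OF ax C f g])
  show "(\<lambda>z. tensor_copair C f g (fp_to_tensor z)) \<in> ralg_hom R (free_product R A B) C"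
    by (rule ralg_hom_comp[OF fp_to_tensor_hom tensor_copair_hom[OF C f g comm]])
  show "fp_copair R C f g (fp_in1 R A B a) = tensor_copair C f g (fp_to_tensor (fp_in1 R A B a))"
    if "a \<in> carrier A" for a
    using that lin_closed[OF fl that]
    by (simp add: fp_copair_in1[OF ax C f g] fp_to_tensor_def tensor_copair_tens[OF C fl gl] ralg_hom_one[OF g]
        fp_copair_in1[OF ax TA_ralg tens1_hom tens2_hom])
  show "fp_copair R C f g (fp_in2 R A B b) = tensor_copair C f g (fp_to_tensor (fp_in2 R A B b))"
    if "b \<in> carrier B" for b
    using that lin_closed[OF gl that]
    by (simp add: fp_copair_in2[OF ax C f g] fp_to_tensor_def tensor_copair_tens[OF C fl gl] ralg_hom_one[OF f]
        fp_copair_in2[OF ax TA_ralg tens1_hom tens2_hom])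
qed

end

section \<open>The underlying Hopf algebra of a comonoid\<close>

lemma graded_linear_iff:
  "f \<in> graded_linear R A B \<longleftrightarrow> f \<in> lin R A B \<and> (\<forall>n. \<forall>x\<in>grade A n. f x \<in> grade B n)"
  by (auto simp: graded_linear_def lin_def image_subset_iff)

lemma galg_hom_iff:
  "f \<in> galg_hom R A B \<longleftrightarrow> f \<in> ralg_hom R A B \<and> (\<forall>n. \<forall>x\<in>grade A n. f x \<in> grade B n)"
  by (auto simp: galg_hom_def ralg_hom_def graded_linear_iff)

locale conn_comonoid = connected_graded_algebra R A
  for R :: "('r, 'm) ring_scheme" and A :: "('r, 'a, 'n) gralg_scheme" (structure) +
  fixes \<Phi> :: "'a \<Rightarrow> (('a + 'a) list \<Rightarrow> 'r) set"
  assumes comonoid: "comonoid R A \<Phi>"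
begin

sublocale galg_pair R A A
  by (intro galg_pair.intro graded_algebra_axioms)

abbreviation "FP \<equiv> free_product R A A"
abbreviation "e \<equiv> trivial_map R A A"

lemma A_ralg: "ralg R A" by (rule Ar.ralg_axioms)

lemma FP_ralg: "ralg R FP"
  by (rule free_product_ralg[OF A_ralg A_ralg])

lemma Phi_hom: "\<Phi> \<in> ralg_hom R A FP"
  and Phi_grade: "x \<in> grade A n \<Longrightarrow> \<Phi> x \<in> grade FP n"
  using comonoid by (auto simp: comonoid_def galg_hom_iff)

lemma grade_0_scalar: "x \<in> grade A 0 \<Longrightarrow> \<exists>r\<in>carrier R. x = r \<odot> \<one>"
  using connected unfolding bij_betw_def by blast

text \<open>By connectedness the composite \<open>A \<rightarrow> R \<rightarrow> A\<close> is the projection to degree \<open>0\<close>.\<close>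

lemma e_component: "x \<in> carrier A \<Longrightarrow> e x = component A 0 x"
proof -
  assume x: "x \<in> carrier A"
  obtain r where r: "r \<in> carrier R" "component A 0 x = r \<odot> \<one>"
    using grade_0_scalar[OF A.component_closed[OF x]] by blast
  have "inj_on (\<lambda>r. r \<odot> \<one>) (carrier R)"
    using connected by (simp add: bij_betw_def)
  then have "augmentation R A x = r"
    unfolding augmentation_def using r by (intro the_equality) (auto dest: inj_onD)
  then show ?thesis
    by (simp add: trivial_map_def r(2))
qed

lemma e_homog: "x \<in> grade A n \<Longrightarrow> e x = (if n = 0 then x else \<zero>)"
  using A.component_homog[of x n 0] A.grade_subset[of x n] by (simp add: e_component)

lemma e_lin: "e \<in> lin R A A"
  by (rule lin_cong[OF Ar.is_module A.component_lin[of 0]]) (rule e_component)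

lemma e_scalar: "x \<in> carrier A \<Longrightarrow> \<exists>r\<in>carrier R. e x = r \<odot> \<one>"
  using grade_0_scalar[OF A.component_closed] by (simp add: e_component)

lemma e_grade: "x \<in> grade A n \<Longrightarrow> e x \<in> grade A n"
  by (cases "n = 0") (simp_all add: e_homog A.grade_zero)

lemma e_hom: "e \<in> ralg_hom R A A"
proof (rule ralg_homI[OF e_lin])
  fix x y assume xy: "x \<in> carrier A" "y \<in> carrier A"
  note Al = bilin_left[OF Ar.mult_bilin] and Arr = bilin_right[OF Ar.mult_bilin]
  note ec = lin_closed[OF e_lin]
  have 1: "e (x \<otimes> y) = e x \<otimes> e y" if x: "x \<in> grade A m" and y: "y \<in> carrier A" for x y m
  proof (rule A.lin_eq_on_homog[OF lin_comp[OF Arr[OF A.grade_subset[OF x]] e_lin]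
        lin_comp[OF e_lin Arr[OF ec[OF A.grade_subset[OF x]]]] y])
    fix n y assume y: "y \<in> grade A n"
    note c = A.grade_subset[OF x] A.grade_subset[OF y]
    show "e (x \<otimes> y) = e x \<otimes> e y"
      using c by (simp add: e_homog[OF x] e_homog[OF y] e_homog[OF grade_mult[OF x y]])
  qed
  show "e (x \<otimes> y) = e x \<otimes> e y"
    by (rule A.lin_eq_on_homog[OF lin_comp[OF Al[OF xy(2)] e_lin] lin_comp[OF e_lin Al[OF ec[OF xy(2)]]] xy(1)])
      (rule 1[OF _ xy(2)])
next
  show "e \<one> = \<one>"
    by (simp add: e_homog[OF grade_one])
qed

lemma e_central: "\<lbrakk>x \<in> carrier A; y \<in> carrier A\<rbrakk> \<Longrightarrow> e x \<otimes> y = y \<otimes> e x"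
  using e_scalar[of x] by (auto simp: smult_mult_left smult_mult_right)

text \<open>The element \<open>e a\<close> is zero unless \<open>a\<close> has degree \<open>0\<close>, in which case the sign is \<open>1\<close>.\<close>

lemma e_graded_central:
  assumes "a \<in> grade A i" "b \<in> carrier A"
  shows "e a \<otimes> b = sg R (j * i) \<odot> (b \<otimes> e a)"
    and "b \<otimes> e a = sg R (i * j) \<odot> (e a \<otimes> b)"
  using assms e_central[OF A.grade_subset[OF assms(1)] assms(2)] lin_closed[OF e_lin A.grade_subset[OF assms(1)]]
  by (auto simp: e_homog sg_0 sg_closed[OF R_cring])

definition \<Delta> :: "'a \<Rightarrow> ('a \<times> 'a \<Rightarrow> 'r) set" where
  "\<Delta> x = fp_to_tensor (\<Phi> x)"

lemma Delta_hom: "\<Delta> \<in> ralg_hom R A TA"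
  unfolding \<Delta>_def[abs_def] by (rule ralg_hom_comp[OF Phi_hom fp_to_tensor_hom])

lemma Delta_lin: "\<Delta> \<in> lin R A T"
  using ralg_hom_lin[OF Delta_hom] by (simp add: TA_lin)

lemma Delta_grade: "x \<in> grade A n \<Longrightarrow> \<Delta> x \<in> grade T n"
  unfolding \<Delta>_def by (rule fp_to_tensor_grade[OF Phi_grade])

lemma Delta_closed: "x \<in> carrier A \<Longrightarrow> \<Delta> x \<in> carrier T"
  by (rule lin_closed[OF Delta_lin])

lemma hopf_coproduct_eq: "hopf_coproduct R A \<Phi> x = \<Delta> x"
  by (simp add: hopf_coproduct_def \<Delta>_def fp_to_tensor_def)

subsection \<open>Convolution\<close>

text \<open>\<open>M f g\<close> is \<open>\<mu> \<circ> (f \<otimes> g)\<close> and \<open>conv f g\<close> is the convolution product of \<open>f\<close> and \<open>g\<close>.\<close>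

abbreviation M :: "('a \<Rightarrow> 'a) \<Rightarrow> ('a \<Rightarrow> 'a) \<Rightarrow> ('a \<times> 'a \<Rightarrow> 'r) set \<Rightarrow> 'a" where
  "M f g \<equiv> tensor_copair A f g"

definition conv :: "('a \<Rightarrow> 'a) \<Rightarrow> ('a \<Rightarrow> 'a) \<Rightarrow> 'a \<Rightarrow> 'a" where
  "conv f g x = M f g (\<Delta> x)"

lemmas M_lin = tensor_copair_lin[OF A_ralg] and M_tens = tensor_copair_tens[OF A_ralg]

lemma convolution_eq:
  assumes "f \<in> lin R A A" "g \<in> lin R A A" "x \<in> carrier A"
  shows "convolution R A \<Phi> f g x = conv f g x"
proof -
  have b: "(\<lambda>a b. tens R A A (f a) (g b)) \<in> bilin R A A TA"
    using bilin_comp[OF assms(1,2) tens_bilin] by (simp add: bilin_def TA_lin)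
  have "mult_map R A (tensor_map R A A f g z) = M f g z" if z: "z \<in> carrier T" for z
  proof (rule tensor_lin_eqI[OF Ar.is_module _ M_lin[OF assms(1,2)] z])
    have t: "tensor_map R A A f g \<in> lin R T T"
      using tensor_lift_lin[OF TA_module b] by (simp add: tensor_map_def TA_lin)
    show "(\<lambda>z. mult_map R A (tensor_map R A A f g z)) \<in> lin R T A"
      unfolding mult_map_def by (rule lin_comp[OF t tensor_lift_lin[OF Ar.is_module Ar.mult_bilin]])
    fix a b assume ab: "a \<in> carrier A" "b \<in> carrier A"
    then show "mult_map R A (tensor_map R A A f g (tens R A A a b)) = M f g (tens R A A a b)"
      using lin_closed[OF assms(1)] lin_closed[OF assms(2)]
      by (simp add: tensor_map_def tensor_lift_tens[OF TA_module b] mult_map_def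
          tensor_lift_tens[OF Ar.is_module Ar.mult_bilin] M_tens[OF assms(1,2)])
  qed
  then show ?thesis
    using Delta_closed[OF assms(3)] by (simp add: convolution_def hopf_coproduct_eq conv_def)
qed

lemma conv_lin: "\<lbrakk>f \<in> lin R A A; g \<in> lin R A A\<rbrakk> \<Longrightarrow> conv f g \<in> lin R A A"
  unfolding conv_def[abs_def] by (rule lin_comp[OF Delta_lin M_lin])

lemma M_eq_on_grade:
  assumes "f \<in> lin R A A" "g \<in> lin R A A" "f' \<in> lin R A A" "g' \<in> lin R A A" "z \<in> grade T n"
    and eq: "\<And>i j a b. \<lbrakk>i + j = n; a \<in> grade A i; b \<in> grade A j\<rbrakk> \<Longrightarrow> f a \<otimes> g b = f' a \<otimes> g' b"
  shows "M f g z = M f' g' z"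
  using assms(5)
proof (induction rule: tensor_grade_induct)
  case (tens i j a b)
  then show ?case
    using eq A.grade_subset by (simp add: M_tens assms(1-4))
next
  case (add x y)
  then show ?case
    using Tm.grade_subset by (simp add: lin_add[OF M_lin] assms(1-4))
qed

lemma M_grade:
  assumes "f \<in> graded_linear R A A" "g \<in> graded_linear R A A" "z \<in> grade T n"
  shows "M f g z \<in> grade A n"
proof -
  have l: "f \<in> lin R A A" "g \<in> lin R A A"
    using assms by (auto simp: graded_linear_iff)
  show ?thesis
    using assms(3)
  proof (induction rule: tensor_grade_induct)
    case (tens i j a b)
    then have "f a \<otimes> g b \<in> grade A (i + j)"
      using assms(1,2) by (intro grade_mult) (auto simp: graded_linear_iff)
    then show ?case
      using tens A.grade_subset by (simp add: M_tens[OF l])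
  next
    case (add x y)
    then show ?case
      using Tm.grade_subset A.grade_add by (simp add: lin_add[OF M_lin[OF l]])
  qed
qed

lemma conv_graded:
  "\<lbrakk>f \<in> graded_linear R A A; g \<in> graded_linear R A A\<rbrakk> \<Longrightarrow> conv f g \<in> graded_linear R A A"
  using conv_lin M_grade[OF _ _ Delta_grade] by (auto simp: graded_linear_iff conv_def)

lemma conv_eq_homog:
  assumes "f \<in> lin R A A" "g \<in> lin R A A" "f' \<in> lin R A A" "g' \<in> lin R A A" "x \<in> grade A n"
    and "\<And>i j a b. \<lbrakk>i + j = n; a \<in> grade A i; b \<in> grade A j\<rbrakk> \<Longrightarrow> f a \<otimes> g b = f' a \<otimes> g' b"
  shows "conv f g x = conv f' g' x"
  unfolding conv_def by (rule M_eq_on_grade[OF assms(1-4) Delta_grade[OF assms(5)] assms(6)])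

lemma conv_cong:
  assumes "f \<in> lin R A A" "g \<in> lin R A A" "f' \<in> lin R A A" "g' \<in> lin R A A" "x \<in> carrier A"
    and "\<And>x. x \<in> carrier A \<Longrightarrow> f x = f' x" "\<And>x. x \<in> carrier A \<Longrightarrow> g x = g' x"
  shows "conv f g x = conv f' g' x"
  unfolding conv_def
  by (rule tensor_lin_eqI[OF Ar.is_module M_lin[OF assms(1,2)] M_lin[OF assms(3,4)] Delta_closed[OF assms(5)]])
    (simp add: M_tens assms)

lemma conv_add_left:
  assumes "f \<in> lin R A A" "f' \<in> lin R A A" "g \<in> lin R A A" "x \<in> carrier A"
  shows "conv (\<lambda>x. f x \<oplus> f' x) g x = conv f g x \<oplus> conv f' g x"
proof -
  note p = lin_plus[OF Ar.is_module assms(1,2)]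
  show ?thesis
    unfolding conv_def
    by (rule tensor_lin_eqI[OF Ar.is_module M_lin[OF p assms(3)]
          lin_plus[OF Ar.is_module M_lin[OF assms(1,3)] M_lin[OF assms(2,3)]] Delta_closed[OF assms(4)]])
      (simp add: M_tens assms(1-3) p lin_closed[OF assms(1)] lin_closed[OF assms(2)] lin_closed[OF assms(3)] l_distr)
qed

lemma conv_add_right:
  assumes "f \<in> lin R A A" "g \<in> lin R A A" "g' \<in> lin R A A" "x \<in> carrier A"
  shows "conv f (\<lambda>x. g x \<oplus> g' x) x = conv f g x \<oplus> conv f g' x"
proof -
  note p = lin_plus[OF Ar.is_module assms(2,3)]
  show ?thesis
    unfolding conv_def
    by (rule tensor_lin_eqI[OF Ar.is_module M_lin[OF assms(1) p]
          lin_plus[OF Ar.is_module M_lin[OF assms(1,2)] M_lin[OF assms(1,3)]] Delta_closed[OF assms(4)]])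
      (simp add: M_tens assms(1-3) p lin_closed[OF assms(1)] lin_closed[OF assms(2)] lin_closed[OF assms(3)] r_distr)
qed

text \<open>This is the link between the comonoid structure and the underlying Hopf algebra: homomorphisms
  with commuting images multiply in the same way in both.\<close>

lemma hom_pair_convolution:
  assumes f: "f \<in> ralg_hom R A A" and g: "g \<in> ralg_hom R A A"
    and comm: "\<And>i j a b. \<lbrakk>a \<in> grade A i; b \<in> grade A j\<rbrakk>
      \<Longrightarrow> g b \<otimes> f a = sg R (i * j) \<odot> (f a \<otimes> g b)"
    and x: "x \<in> carrier A"
  shows "fp_copair R A f g (\<Phi> x) = conv f g x"
  unfolding conv_def \<Delta>_def
  by (rule fp_copair_factor[OF A_ralg f g comm ralg_hom_closed[OF Phi_hom x]])

lemma id_hom: "id \<in> ralg_hom R A A" and id_lin: "id \<in> lin R A A"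
  using ralg_hom_id lin_id by (auto simp: id_def)

lemma counit_right: "x \<in> carrier A \<Longrightarrow> conv id e x = x"
  using hom_pair_convolution[OF id_hom e_hom] comonoid e_graded_central(1)[OF _ A.grade_subset]
  by (simp add: comonoid_def)

lemma counit_left: "x \<in> carrier A \<Longrightarrow> conv e id x = x"
  using hom_pair_convolution[OF e_hom id_hom] comonoid e_graded_central(2)[OF _ A.grade_subset]
  by (simp add: comonoid_def)

text \<open>Since \<open>e b\<close> is a scalar, \<open>f a \<cdot> e b = f (a \<cdot> e b)\<close>, and the sum of the terms \<open>a \<cdot> e b\<close> over
  \<open>\<Delta> x\<close> is \<open>x\<close>.\<close>

lemma conv_unit_right:
  assumes f: "f \<in> lin R A A" and x: "x \<in> carrier A"
  shows "conv f e x = f x"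
proof -
  have "M f e z = f (M id e z)" if z: "z \<in> carrier T" for z
  proof (rule tensor_lin_eqI[OF Ar.is_module M_lin[OF f e_lin] lin_comp[OF M_lin[OF id_lin e_lin] f] z])
    fix a b assume ab: "a \<in> carrier A" "b \<in> carrier A"
    obtain r where r: "r \<in> carrier R" "e b = r \<odot> \<one>"
      using e_scalar[OF ab(2)] by blast
    show "M f e (tens R A A a b) = f (M id e (tens R A A a b))"
      using ab r lin_closed[OF f ab(1)]
      by (simp add: M_tens f e_lin id_lin smult_mult_right lin_smult[OF f])
  qed
  then show ?thesis
    using counit_right[OF x] Delta_closed[OF x] by (simp add: conv_def)
qed

lemma conv_unit_left:
  assumes f: "f \<in> lin R A A" and x: "x \<in> carrier A"
  shows "conv e f x = f x"
proof -
  have "M e f z = f (M e id z)" if z: "z \<in> carrier T" for z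
  proof (rule tensor_lin_eqI[OF Ar.is_module M_lin[OF e_lin f] lin_comp[OF M_lin[OF e_lin id_lin] f] z])
    fix a b assume ab: "a \<in> carrier A" "b \<in> carrier A"
    obtain r where r: "r \<in> carrier R" "e a = r \<odot> \<one>"
      using e_scalar[OF ab(1)] by blast
    show "M e f (tens R A A a b) = f (M e id (tens R A A a b))"
      using ab r lin_closed[OF f ab(2)]
      by (simp add: M_tens f e_lin id_lin smult_mult_left lin_smult[OF f])
  qed
  then show ?thesis
    using counit_left[OF x] Delta_closed[OF x] by (simp add: conv_def)
qed

subsection \<open>Coassociativity\<close>

text \<open>Coassociativity tested on three homomorphisms into an algebra \<open>C\<close>. Both iterated coproducts are
  followed by the map \<open>A \<ast> (A \<ast> A) \<rightarrow> C\<close> with components \<open>i1\<close>, \<open>i2\<close>, \<open>i3\<close>, and the composites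
  are identified on generators.\<close>

lemma Phi_coassoc:
  assumes C: "ralg R C" and i1: "i1 \<in> ralg_hom R A C" and i2: "i2 \<in> ralg_hom R A C"
    and i3: "i3 \<in> ralg_hom R A C" and x: "x \<in> carrier A"
  shows "fp_copair R C (\<lambda>a. fp_copair R C i1 i2 (\<Phi> a)) i3 (\<Phi> x) =
    fp_copair R C i1 (\<lambda>a. fp_copair R C i2 i3 (\<Phi> a)) (\<Phi> x)"
proof -
  let ?P1 = "free_product R FP A" and ?P2 = "free_product R A FP"
  note P1 = free_product_ralg[OF FP_ralg A_ralg] and P2 = free_product_ralg[OF A_ralg FP_ralg]
  let ?g12 = "fp_copair R C i1 i2" and ?g23 = "fp_copair R C i2 i3"
  note g12 = fp_copair_hom[OF A_ralg A_ralg C i1 i2] and g23 = fp_copair_hom[OF A_ralg A_ralg C i2 i3]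
  let ?H = "fp_copair R C i1 ?g23"
  note H = fp_copair_hom[OF A_ralg FP_ralg C i1 g23]
  note H1 = fp_copair_in1[OF A_ralg FP_ralg C i1 g23] and H2 = fp_copair_in2[OF A_ralg FP_ralg C i1 g23]
  note in12 = fp_in1_hom[OF A_ralg FP_ralg] and in22 = fp_in2_hom[OF A_ralg FP_ralg]
  note in11 = fp_in1_hom[OF FP_ralg A_ralg] and in21 = fp_in2_hom[OF FP_ralg A_ralg]
  note j1 = fp_in1_hom[OF A_ralg A_ralg] and j2 = fp_in2_hom[OF A_ralg A_ralg]
  let ?U = "fp_copair R ?P2 (fp_in1 R A FP) (\<lambda>a. fp_in2 R A FP (fp_in1 R A A a))"
  note k1 = ralg_hom_comp[OF j1 in22] and k2 = ralg_hom_comp[OF j2 in22]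
  note U = fp_copair_hom[OF A_ralg A_ralg P2 in12 k1]
  let ?as = "fp_assoc R A A A"
  have as_eq: "?as = fp_copair R ?P2 ?U (\<lambda>a. fp_in2 R A FP (fp_in2 R A A a))"
    by (simp add: fp_assoc_def Let_def comp_def)
  have as: "?as \<in> ralg_hom R ?P1 ?P2"
    unfolding as_eq by (rule fp_copair_hom[OF FP_ralg A_ralg P2 U k2])
  let ?m1 = "fp_map R FP A \<Phi> id" and ?m2 = "fp_map R A FP id \<Phi>"
  note l1 = ralg_hom_comp[OF Phi_hom in11] and l2 = ralg_hom_comp[OF Phi_hom in22]
  have m1_eq: "?m1 = fp_copair R ?P1 (\<lambda>a. fp_in1 R FP A (\<Phi> a)) (fp_in2 R FP A)"
    and m2_eq: "?m2 = fp_copair R ?P2 (fp_in1 R A FP) (\<lambda>a. fp_in2 R A FP (\<Phi> a))"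
    by (simp_all add: fp_map_def comp_def)
  have m1: "?m1 \<in> ralg_hom R FP ?P1"
    unfolding m1_eq by (rule fp_copair_hom[OF A_ralg A_ralg P1 l1 in21])
  have m2: "?m2 \<in> ralg_hom R FP ?P2"
    unfolding m2_eq by (rule fp_copair_hom[OF A_ralg A_ralg P2 in12 l2])
  note n1 = ralg_hom_comp[OF Phi_hom g12] and n2 = ralg_hom_comp[OF Phi_hom g23]
  note Px = ralg_hom_closed[OF Phi_hom]
  have HU: "?H (?U w) = ?g12 w" if w: "w \<in> carrier FP" for w
  proof (rule free_product_hom_eqI[OF A_ralg A_ralg C ralg_hom_comp[OF U H] g12 _ _ w])
    fix a assume a: "a \<in> carrier A"
    show "?H (?U (fp_in1 R A A a)) = ?g12 (fp_in1 R A A a)"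
      using a by (simp add: fp_copair_in1[OF A_ralg A_ralg P2 in12 k1] H1 fp_copair_in1[OF A_ralg A_ralg C i1 i2])
    show "?H (?U (fp_in2 R A A a)) = ?g12 (fp_in2 R A A a)"
      using a ralg_hom_closed[OF j1 a]
      by (simp add: fp_copair_in2[OF A_ralg A_ralg P2 in12 k1] H2 fp_copair_in2[OF A_ralg A_ralg C i1 i2]
          fp_copair_in1[OF A_ralg A_ralg C i2 i3])
  qed
  have left: "?H (?as (?m1 w)) = fp_copair R C (\<lambda>a. ?g12 (\<Phi> a)) i3 w" if w: "w \<in> carrier FP" for w
  proof (rule free_product_hom_eqI[OF A_ralg A_ralg C ralg_hom_comp[OF ralg_hom_comp[OF m1 as] H]
        fp_copair_hom[OF A_ralg A_ralg C n1 i3] _ _ w])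
    fix a assume a: "a \<in> carrier A"
    show "?H (?as (?m1 (fp_in1 R A A a))) = fp_copair R C (\<lambda>a. ?g12 (\<Phi> a)) i3 (fp_in1 R A A a)"
      using a Px[OF a] unfolding m1_eq as_eq
      by (simp add: fp_copair_in1[OF A_ralg A_ralg P1 l1 in21] fp_copair_in1[OF FP_ralg A_ralg P2 U k2] HU
          fp_copair_in1[OF A_ralg A_ralg C n1 i3])
    show "?H (?as (?m1 (fp_in2 R A A a))) = fp_copair R C (\<lambda>a. ?g12 (\<Phi> a)) i3 (fp_in2 R A A a)"
      using a ralg_hom_closed[OF j2 a] unfolding m1_eq as_eq
      by (simp add: fp_copair_in2[OF A_ralg A_ralg P1 l1 in21] fp_copair_in2[OF FP_ralg A_ralg P2 U k2] H2
          fp_copair_in2[OF A_ralg A_ralg C n1 i3] fp_copair_in2[OF A_ralg A_ralg C i2 i3])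
  qed
  have right: "?H (?m2 w) = fp_copair R C i1 (\<lambda>a. ?g23 (\<Phi> a)) w" if w: "w \<in> carrier FP" for w
  proof (rule free_product_hom_eqI[OF A_ralg A_ralg C ralg_hom_comp[OF m2 H]
        fp_copair_hom[OF A_ralg A_ralg C i1 n2] _ _ w])
    fix a assume a: "a \<in> carrier A"
    show "?H (?m2 (fp_in1 R A A a)) = fp_copair R C i1 (\<lambda>a. ?g23 (\<Phi> a)) (fp_in1 R A A a)"
      using a unfolding m2_eq
      by (simp add: fp_copair_in1[OF A_ralg A_ralg P2 in12 l2] H1 fp_copair_in1[OF A_ralg A_ralg C i1 n2])
    show "?H (?m2 (fp_in2 R A A a)) = fp_copair R C i1 (\<lambda>a. ?g23 (\<Phi> a)) (fp_in2 R A A a)"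
      using a Px[OF a] unfolding m2_eq
      by (simp add: fp_copair_in2[OF A_ralg A_ralg P2 in12 l2] H2 fp_copair_in2[OF A_ralg A_ralg C i1 n2])
  qed
  have "?as (?m1 (\<Phi> x)) = ?m2 (\<Phi> x)"
    using comonoid x by (simp add: comonoid_def)
  then show ?thesis
    using left[OF Px[OF x]] right[OF Px[OF x]] by simp
qed

text \<open>Let \<open>j1\<close>, \<open>j2\<close>, \<open>j3\<close> be the inclusions of the three factors of \<open>C = (A \<otimes> A) \<otimes> A\<close>. The two
  bracketings of the product of \<open>j1\<close>, \<open>j2\<close>, \<open>j3\<close> agree by coassociativity of \<open>\<Phi>\<close>. Since the images
  of the inclusions commute in the graded sense, each bracketing can be computed with \<open>\<Delta>\<close> in place
  of \<open>\<Phi>\<close>. The linear map \<open>(a \<otimes> b) \<otimes> c \<mapsto> f a \<cdot> g b \<cdot> h c\<close> sends the results to the two sides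
  of the equation.\<close>

lemma conv_assoc:
  assumes f: "f \<in> lin R A A" and g: "g \<in> lin R A A" and h: "h \<in> lin R A A" and x: "x \<in> carrier A"
  shows "conv (conv f g) h x = conv f (conv g h) x"
proof -
  interpret TT: galg_pair R TA A
    by (intro galg_pair.intro TA_graded_algebra graded_algebra_axioms)
  let ?C = "tensor_algebra R TA A" and ?T3 = "tensor_module R TA A"
  note C = TT.TA_ralg
  interpret C: ralg R ?C by (rule C)
  interpret TAr: ralg R TA by (rule TA_ralg)
  let ?t = "tens R A A" and ?t' = "tens R TA A"
  let ?J = "\<lambda>z. ?t' z \<one>" and ?j3 = "\<lambda>c. ?t' \<one>\<^bsub>TA\<^esub> c"
  let ?j1 = "\<lambda>a. ?J (?t a \<one>)" and ?j2 = "\<lambda>b. ?J (?t \<one> b)"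
  note J = TT.tens1_hom and j3 = TT.tens2_hom
  note j1 = ralg_hom_comp[OF tens1_hom J] and j2 = ralg_hom_comp[OF tens2_hom J]
  note JD = ralg_hom_comp[OF Delta_hom J]
  note Cl = bilin_left[OF C.mult_bilin] and Cr = bilin_right[OF C.mult_bilin]
  have TAc: "z \<in> carrier T \<Longrightarrow> z \<in> carrier TA" for z by (simp add: TA_fields)
  have gTA: "z \<in> grade T n \<Longrightarrow> z \<in> grade TA n" for z n by (simp add: TA_fields)
  have J_comm: "?j3 c \<otimes>\<^bsub>?C\<^esub> ?J z = sg R (n * k) \<odot>\<^bsub>?C\<^esub> (?J z \<otimes>\<^bsub>?C\<^esub> ?j3 c)"
    if "z \<in> grade T n" "c \<in> grade A k" for z c n k
    by (rule TT.tens2_tens1[OF gTA[OF that(1)] that(2)])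
  have J_j3: "?J z \<otimes>\<^bsub>?C\<^esub> ?j3 c = ?t' z c" if "z \<in> carrier T" "c \<in> carrier A" for z c
    by (rule TT.tens1_tens2[OF TAc[OF that(1)] that(2)])

  \<comment> \<open>\<open>J\<close> is multiplicative, so \<open>J \<circ> \<Delta>\<close> is the product of the first two inclusions\<close>
  have J12: "?J (\<Delta> a) = fp_copair R ?C ?j1 ?j2 (\<Phi> a)" if a: "a \<in> carrier A" for a
    unfolding \<Delta>_def
  proof (rule free_product_hom_eqI[OF A_ralg A_ralg C ralg_hom_comp[OF fp_to_tensor_hom J]
        fp_copair_hom[OF A_ralg A_ralg C j1 j2] _ _ ralg_hom_closed[OF Phi_hom a]])
    fix a assume a: "a \<in> carrier A"
    show "?J (fp_to_tensor (fp_in1 R A A a)) = fp_copair R ?C ?j1 ?j2 (fp_in1 R A A a)"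
      using a by (simp add: fp_to_tensor_def fp_copair_in1[OF A_ralg A_ralg TA_ralg tens1_hom tens2_hom]
          fp_copair_in1[OF A_ralg A_ralg C j1 j2])
    show "?J (fp_to_tensor (fp_in2 R A A a)) = fp_copair R ?C ?j1 ?j2 (fp_in2 R A A a)"
      using a by (simp add: fp_to_tensor_def fp_copair_in2[OF A_ralg A_ralg TA_ralg tens1_hom tens2_hom]
          fp_copair_in2[OF A_ralg A_ralg C j1 j2])
  qed
  let ?K = "\<lambda>b. fp_copair R ?C ?j2 ?j3 (\<Phi> b)"
  note K = ralg_hom_comp[OF Phi_hom fp_copair_hom[OF A_ralg A_ralg C j2 j3]]
  have t_grade: "?t a \<one> \<in> grade T i" "?t \<one> a \<in> grade T i" if "a \<in> grade A i" for a i
    using tens_grade[OF that grade_one] tens_grade[OF grade_one that] by auto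
  have j23: "?j3 c \<otimes>\<^bsub>?C\<^esub> ?j2 b = sg R (i * j) \<odot>\<^bsub>?C\<^esub> (?j2 b \<otimes>\<^bsub>?C\<^esub> ?j3 c)"
    if "b \<in> grade A i" "c \<in> grade A j" for b c i j
    by (rule J_comm[OF t_grade(2)[OF that(1)] that(2)])
  have K_eq: "?K b = tensor_copair ?C ?j2 ?j3 (\<Delta> b)" if b: "b \<in> carrier A" for b
    unfolding \<Delta>_def by (rule fp_copair_factor[OF C j2 j3 j23 ralg_hom_closed[OF Phi_hom b]])
  note p23 = tensor_copair_lin[OF C ralg_hom_lin[OF j2] ralg_hom_lin[OF j3]]
    and p23t = tensor_copair_tens[OF C ralg_hom_lin[OF j2] ralg_hom_lin[OF j3]]
  \<comment> \<open>\<open>K b\<close> is a sum of terms \<open>j2 c \<cdot> j3 d\<close>, and \<open>j1 a\<close> is moved past \<open>j3 d\<close> and then past \<open>j2 c\<close>\<close>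
  have K_comm: "?K b \<otimes>\<^bsub>?C\<^esub> ?j1 a = sg R (i * j) \<odot>\<^bsub>?C\<^esub> (?j1 a \<otimes>\<^bsub>?C\<^esub> ?K b)"
    if a: "a \<in> grade A i" and b: "b \<in> grade A j" for a b i j
  proof -
    note ac = A.grade_subset[OF a]
    note j1c = ralg_hom_closed[OF j1 ac]
    have "tensor_copair ?C ?j2 ?j3 z \<otimes>\<^bsub>?C\<^esub> ?j1 a = sg R (i * j) \<odot>\<^bsub>?C\<^esub> (?j1 a \<otimes>\<^bsub>?C\<^esub> tensor_copair ?C ?j2 ?j3 z)"
      if "z \<in> grade T j" for z
      using that
    proof (induction rule: tensor_grade_induct)
      case (tens k l c d)
      note cc = A.grade_subset[OF tens(2)] and dc = A.grade_subset[OF tens(3)]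
      note j2c = ralg_hom_closed[OF j2 cc] and j3c = ralg_hom_closed[OF j3 dc]
      have ji: "?j3 d \<otimes>\<^bsub>?C\<^esub> ?j1 a = sg R (i * l) \<odot>\<^bsub>?C\<^esub> (?j1 a \<otimes>\<^bsub>?C\<^esub> ?j3 d)"
        by (rule J_comm[OF t_grade(1)[OF a] tens(3)])
      have tt: "?t \<one> c \<otimes>\<^bsub>TA\<^esub> ?t a \<one> = sg R (i * k) \<odot>\<^bsub>TA\<^esub> (?t a \<one> \<otimes>\<^bsub>TA\<^esub> ?t \<one> c)"
        by (rule tens2_tens1[OF a tens(2)])
      have tc: "?t \<one> c \<in> carrier TA" "?t a \<one> \<in> carrier TA"
        using cc ac by (simp_all add: TA_fields tens_closed)
      have jj: "?j2 c \<otimes>\<^bsub>?C\<^esub> ?j1 a = sg R (i * k) \<odot>\<^bsub>?C\<^esub> (?j1 a \<otimes>\<^bsub>?C\<^esub> ?j2 c)"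
        using tc by (simp add: tt lin_smult[OF ralg_hom_lin[OF J]] sg_closed[OF R_cring]
            flip: ralg_hom_mult[OF J])
      have s: "sg R (i * l) \<otimes>\<^bsub>R\<^esub> sg R (i * k) = sg R (i * j)"
        unfolding sg_mult[OF R_cring] using tens(1) by (simp add: algebra_simps flip: tens(1))
      have "?j2 c \<otimes>\<^bsub>?C\<^esub> ?j3 d \<otimes>\<^bsub>?C\<^esub> ?j1 a = sg R (i * l) \<odot>\<^bsub>?C\<^esub> ((?j2 c \<otimes>\<^bsub>?C\<^esub> ?j1 a) \<otimes>\<^bsub>?C\<^esub> ?j3 d)"
        using j1c j2c j3c by (simp add: C.m_assoc ji C.smult_mult_right sg_closed[OF R_cring])
      also have "\<dots> = sg R (i * j) \<odot>\<^bsub>?C\<^esub> (?j1 a \<otimes>\<^bsub>?C\<^esub> (?j2 c \<otimes>\<^bsub>?C\<^esub> ?j3 d))"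
        using j1c j2c j3c
        by (simp add: jj C.smult_mult_left C.m_assoc sg_closed[OF R_cring] s flip: C.smult_assoc1)
      finally show ?case
        using cc dc by (simp add: p23t)
    next
      case (add y z)
      then show ?case
        using j1c Tm.grade_subset lin_closed[OF p23] sg_closed[OF R_cring]
        by (simp add: lin_add[OF p23] C.l_distr C.r_distr C.smult_r_distr)
    qed
    then show ?thesis
      unfolding K_eq[OF A.grade_subset[OF b]] using Delta_grade[OF b] by blast
  qed
  have "tensor_copair ?C (\<lambda>a. ?J (\<Delta> a)) ?j3 (\<Delta> x) = fp_copair R ?C (\<lambda>a. ?J (\<Delta> a)) ?j3 (\<Phi> x)"
    unfolding \<Delta>_def[of x]
    by (rule fp_copair_factor[OF C JD j3 J_comm[OF Delta_grade] ralg_hom_closed[OF Phi_hom x], symmetric])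
  also have "\<dots> = fp_copair R ?C (\<lambda>a. fp_copair R ?C ?j1 ?j2 (\<Phi> a)) ?j3 (\<Phi> x)"
  proof (rule free_product_hom_eqI[OF A_ralg A_ralg C fp_copair_hom[OF A_ralg A_ralg C JD j3] _ _ _ ralg_hom_closed[OF Phi_hom x]])
    note J12h = ralg_hom_comp[OF Phi_hom fp_copair_hom[OF A_ralg A_ralg C j1 j2]]
    show "fp_copair R ?C (\<lambda>a. fp_copair R ?C ?j1 ?j2 (\<Phi> a)) ?j3 \<in> ralg_hom R FP ?C"
      by (rule fp_copair_hom[OF A_ralg A_ralg C J12h j3])
    fix a assume a: "a \<in> carrier A"
    show "fp_copair R ?C (\<lambda>a. ?J (\<Delta> a)) ?j3 (fp_in1 R A A a) =
      fp_copair R ?C (\<lambda>a. fp_copair R ?C ?j1 ?j2 (\<Phi> a)) ?j3 (fp_in1 R A A a)"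
      using a J12[OF a] by (simp add: fp_copair_in1[OF A_ralg A_ralg C JD j3] fp_copair_in1[OF A_ralg A_ralg C J12h j3])
    show "fp_copair R ?C (\<lambda>a. ?J (\<Delta> a)) ?j3 (fp_in2 R A A a) =
      fp_copair R ?C (\<lambda>a. fp_copair R ?C ?j1 ?j2 (\<Phi> a)) ?j3 (fp_in2 R A A a)"
      using a by (simp add: fp_copair_in2[OF A_ralg A_ralg C JD j3] fp_copair_in2[OF A_ralg A_ralg C J12h j3])
  qed
  also have "\<dots> = fp_copair R ?C ?j1 ?K (\<Phi> x)"
    by (rule Phi_coassoc[OF C j1 j2 j3 x])
  also have "\<dots> = tensor_copair ?C ?j1 ?K (\<Delta> x)"
    unfolding \<Delta>_def by (rule fp_copair_factor[OF C j1 K K_comm ralg_hom_closed[OF Phi_hom x]])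
  finally have D: "tensor_copair ?C (\<lambda>a. ?J (\<Delta> a)) ?j3 (\<Delta> x) = tensor_copair ?C ?j1 ?K (\<Delta> x)" .

  \<comment> \<open>\<open>\<tau>\<close> is \<open>f \<otimes> g \<otimes> h\<close> followed by multiplication\<close>
  have Mfg: "M f g \<in> lin R TA A"
    using M_lin[OF f g] by (simp add: TA_lin)
  let ?\<tau> = "TT.tensor_copair A (M f g) h"
  note \<tau> = TT.tensor_copair_lin[OF A_ralg Mfg h]
  have \<tau>t: "?\<tau> (?t' z c) = M f g z \<otimes> h c" if "z \<in> carrier T" "c \<in> carrier A" for z c
    by (rule TT.tensor_copair_tens[OF A_ralg Mfg h TAc[OF that(1)] that(2)])
  have \<tau>C: "?\<tau> \<in> lin R ?C A"
    using \<tau> by (simp add: TT.TA_lin)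
  have "?\<tau> (tensor_copair ?C (\<lambda>a. ?J (\<Delta> a)) ?j3 z) = M (conv f g) h z" if z: "z \<in> carrier T" for z
  proof (rule tensor_lin_eqI[OF Ar.is_module
        lin_comp[OF tensor_copair_lin[OF C ralg_hom_lin[OF JD] ralg_hom_lin[OF j3]] \<tau>C]
        M_lin[OF conv_lin[OF f g] h] z])
    fix a b assume ab: "a \<in> carrier A" "b \<in> carrier A"
    show "?\<tau> (tensor_copair ?C (\<lambda>a. ?J (\<Delta> a)) ?j3 (?t a b)) = M (conv f g) h (?t a b)"
      using ab Delta_closed[OF ab(1)]
      by (simp add: tensor_copair_tens[OF C ralg_hom_lin[OF JD] ralg_hom_lin[OF j3]] J_j3 \<tau>t conv_def[symmetric]
          M_tens[OF conv_lin[OF f g] h])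
  qed
  then have l: "?\<tau> (tensor_copair ?C (\<lambda>a. ?J (\<Delta> a)) ?j3 (\<Delta> x)) = conv (conv f g) h x"
    using Delta_closed[OF x] by (simp add: conv_def[of "conv f g"])
  have inner: "?\<tau> (?j1 a \<otimes>\<^bsub>?C\<^esub> tensor_copair ?C ?j2 ?j3 w) = f a \<otimes> M g h w"
    if a: "a \<in> carrier A" and w: "w \<in> carrier T" for a w
  proof (rule tensor_lin_eqI[OF Ar.is_module lin_comp[OF lin_comp[OF p23 Cr[OF ralg_hom_closed[OF j1 a]]] \<tau>C]
        lin_comp[OF M_lin[OF g h] bilin_right[OF Ar.mult_bilin lin_closed[OF f a]]] w])
    fix c d assume cd: "c \<in> carrier A" "d \<in> carrier A"
    have tc: "?t a \<one> \<in> carrier TA" "?t \<one> c \<in> carrier TA"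
      using a cd by (simp_all add: TA_fields tens_closed)
    have "?j1 a \<otimes>\<^bsub>?C\<^esub> (?j2 c \<otimes>\<^bsub>?C\<^esub> ?j3 d) = ?J (?t a \<one> \<otimes>\<^bsub>TA\<^esub> ?t \<one> c) \<otimes>\<^bsub>?C\<^esub> ?j3 d"
      using ralg_hom_closed[OF j1 a] ralg_hom_closed[OF j2 cd(1)] ralg_hom_closed[OF j3 cd(2)] tc
      by (simp add: C.m_assoc ralg_hom_mult[OF J])
    also have "\<dots> = ?t' (?t a c) d"
      using a cd by (simp add: tens1_tens2 J_j3 tens_closed)
    finally show "?\<tau> (?j1 a \<otimes>\<^bsub>?C\<^esub> tensor_copair ?C ?j2 ?j3 (?t c d)) = f a \<otimes> M g h (?t c d)"
      using a cd lin_closed[OF f] lin_closed[OF g] lin_closed[OF h]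
      by (simp add: p23t \<tau>t tens_closed M_tens f g h m_assoc)
  qed
  have "?\<tau> (tensor_copair ?C ?j1 ?K z) = M f (conv g h) z" if z: "z \<in> carrier T" for z
  proof (rule tensor_lin_eqI[OF Ar.is_module
        lin_comp[OF tensor_copair_lin[OF C ralg_hom_lin[OF j1] ralg_hom_lin[OF K]] \<tau>C]
        M_lin[OF f conv_lin[OF g h]] z])
    fix a b assume ab: "a \<in> carrier A" "b \<in> carrier A"
    show "?\<tau> (tensor_copair ?C ?j1 ?K (?t a b)) = M f (conv g h) (?t a b)"
      using ab inner[OF ab(1) Delta_closed[OF ab(2)]]
      by (simp add: tensor_copair_tens[OF C ralg_hom_lin[OF j1] ralg_hom_lin[OF K]] K_eq
          M_tens[OF f conv_lin[OF g h]] conv_def)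
  qed
  then have r: "?\<tau> (tensor_copair ?C ?j1 ?K (\<Delta> x)) = conv f (conv g h) x"
    using Delta_closed[OF x] by (simp add: conv_def[of f])
  show ?thesis
    using D l r by simp
qed

end

section \<open>Existence and uniqueness of the antipode\<close>

context conn_comonoid
begin

text \<open>The difference \<open>\<epsilon> - id\<close> kills degree \<open>0\<close>, so that its \<open>k\<close>-th convolution power kills all
  degrees below \<open>k\<close>. Hence \<open>id = \<epsilon> - (\<epsilon> - id)\<close> is inverted by a geometric series that is a finite
  sum in each degree.\<close>

definition aug_diff :: "'a \<Rightarrow> 'a" where
  "aug_diff x = e x \<ominus> x"

lemma aug_diff_lin: "aug_diff \<in> lin R A A"
  unfolding aug_diff_def[abs_def] a_minus_def
  by (rule lin_plus[OF Ar.is_module e_lin lin_uminus[OF Ar.is_module lin_id]])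

lemma aug_diff_graded: "aug_diff \<in> graded_linear R A A"
  using aug_diff_lin e_grade A.grade_add A.grade_minus by (auto simp: graded_linear_iff aug_diff_def a_minus_def)

lemma e_graded: "e \<in> graded_linear R A A"
  using e_lin e_grade by (auto simp: graded_linear_iff)

lemma aug_diff_0: "x \<in> grade A 0 \<Longrightarrow> aug_diff x = \<zero>"
  using A.grade_subset[of x 0] by (simp add: aug_diff_def e_homog a_minus_def M.r_neg)

lemma id_plus_aug_diff: "x \<in> carrier A \<Longrightarrow> id x \<oplus> aug_diff x = e x"
  using lin_closed[OF e_lin, of x] by (simp add: aug_diff_def a_minus_def M.a_comm M.r_neg2)

text \<open>The partial sums of the geometric series.\<close>

primrec approx :: "nat \<Rightarrow> 'a \<Rightarrow> 'a" where
  "approx 0 = e"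
| "approx (Suc n) = (\<lambda>x. e x \<oplus> conv aug_diff (approx n) x)"

lemma approx_lin: "approx n \<in> lin R A A"
  by (induction n) (simp_all add: e_lin conv_lin aug_diff_lin lin_plus[OF Ar.is_module])

lemma approx_graded: "approx n \<in> graded_linear R A A"
proof (induction n)
  case 0
  show ?case by (simp add: e_graded)
next
  case (Suc n)
  then show ?case
    using conv_graded[OF aug_diff_graded Suc] e_grade A.grade_add approx_lin[of "Suc n"]
    by (auto simp: graded_linear_iff)
qed

text \<open>The recursion multiplies by \<^const>\<open>aug_diff\<close> on the left. The limit is also a right
  inverse because, by associativity, the partial sums commute with \<^const>\<open>aug_diff\<close>.\<close>

lemma approx_commute: "x \<in> carrier A \<Longrightarrow> conv (approx n) aug_diff x = conv aug_diff (approx n) x"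
proof (induction n arbitrary: x)
  case 0
  then show ?case by (simp add: conv_unit_left conv_unit_right aug_diff_lin)
next
  case (Suc n)
  note c = conv_lin[OF aug_diff_lin approx_lin]
  have "conv (approx (Suc n)) aug_diff x = conv e aug_diff x \<oplus> conv (conv aug_diff (approx n)) aug_diff x"
    using conv_add_left[OF e_lin c aug_diff_lin Suc.prems] by simp
  also have "conv (conv aug_diff (approx n)) aug_diff x = conv aug_diff (conv (approx n) aug_diff) x"
    by (rule conv_assoc[OF aug_diff_lin approx_lin aug_diff_lin Suc.prems])
  also have "\<dots> = conv aug_diff (conv aug_diff (approx n)) x"
    by (rule conv_cong[OF aug_diff_lin conv_lin[OF approx_lin aug_diff_lin] aug_diff_lin c Suc.prems]) (simp_all add: Suc.IH)
  also have "conv e aug_diff x \<oplus> \<dots> = conv aug_diff (approx (Suc n)) x"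
    using conv_add_right[OF aug_diff_lin e_lin c Suc.prems]
    by (simp add: conv_unit_left conv_unit_right aug_diff_lin Suc.prems)
  finally show ?case .
qed

text \<open>In \<open>conv aug_diff f\<close> only values of \<open>f\<close> in degrees below that of the argument occur,
  because \<^const>\<open>aug_diff\<close> kills degree \<open>0\<close>.\<close>

lemma approx_step: "\<lbrakk>x \<in> grade A m; m \<le> n\<rbrakk> \<Longrightarrow> approx (Suc n) x = approx n x"
proof (induction n arbitrary: m x)
  case 0
  then show ?case
    using A.grade_subset[of x 0] lin_closed[OF e_lin, of x]
    by (simp add: conv_unit_right aug_diff_lin aug_diff_0)
next
  case (Suc n)
  have "conv aug_diff (approx (Suc n)) x = conv aug_diff (approx n) x"
  proof (rule conv_eq_homog[OF aug_diff_lin approx_lin aug_diff_lin approx_lin Suc.prems(1)])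
    fix i j a b assume h: "i + j = m" "a \<in> grade A i" "b \<in> grade A j"
    show "aug_diff a \<otimes> approx (Suc n) b = aug_diff a \<otimes> approx n b"
    proof (cases "i = 0")
      case True
      then show ?thesis
        using h aug_diff_0 A.grade_subset[OF h(3)] lin_closed[OF approx_lin] by (simp del: approx.simps)
    next
      case False
      then show ?thesis
        using Suc.IH[OF h(3)] h(1) Suc.prems(2) by (simp del: approx.simps)
    qed
  qed
  then show ?case by simp
qed

lemma approx_stable: "\<lbrakk>x \<in> grade A m; m \<le> n\<rbrakk> \<Longrightarrow> approx n x = approx m x"
proof (induction n)
  case 0
  then show ?case by simp
next
  case (Suc n)
  show ?case
  proof (cases "m = Suc n")
    case False
    then have "m \<le> n" using Suc.prems(2) by simp
    then show ?thesis
      using approx_step[OF Suc.prems(1)] Suc.IH[OF Suc.prems(1)] by simp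
  qed simp
qed

text \<open>The limit of the series: on degree \<open>m\<close> the partial sums are constant from the \<open>m\<close>-th on.\<close>

definition chi :: "'a \<Rightarrow> 'a" where
  "chi x = (\<Oplus>m\<in>{m. component A m x \<noteq> \<zero>}. approx m (component A m x))"

lemma chi_sum:
  assumes "x \<in> carrier A" "finite F" "{m. component A m x \<noteq> \<zero>} \<subseteq> F"
  shows "chi x = (\<Oplus>m\<in>F. approx m (component A m x))"
  unfolding chi_def
  using assms lin_zero[OF Ar.is_module Ar.is_module approx_lin] lin_closed[OF approx_lin] A.component_carrier
  by (intro M.add.finprod_mono_neutral_cong_left) auto

lemma chi_lin: "chi \<in> lin R A A"
proof (rule lin_locally_finite[OF Ar.is_module Ar.is_module lin_comp[OF A.component_lin approx_lin]])
  fix x assume x: "x \<in> carrier A"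
  show "\<exists>F\<^sub>0. finite F\<^sub>0 \<and> (\<forall>F. finite F \<longrightarrow> F\<^sub>0 \<subseteq> F \<longrightarrow> chi x = (\<Oplus>i\<in>F. approx i (component A i x)))"
    using chi_sum[OF x] A.component_finite[OF x]
    by (intro exI[of _ "{m. component A m x \<noteq> \<zero>}"]) simp
qed

lemma chi_homog: "x \<in> grade A m \<Longrightarrow> chi x = approx m x"
proof -
  assume x: "x \<in> grade A m"
  note xc = A.grade_subset[OF x]
  have "chi x = (\<Oplus>k\<in>{m}. approx k (component A k x))"
    using A.component_homog[OF x] by (intro chi_sum xc) auto
  then show ?thesis
    using lin_closed[OF approx_lin xc] xc A.component_homog[OF x] by simp
qed

lemma chi_graded: "chi \<in> graded_linear R A A"
  using chi_lin chi_homog approx_graded by (auto simp: graded_linear_iff)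

lemma conv_aug_diff_chi:
  assumes x: "x \<in> grade A n"
  shows "e x \<oplus> conv aug_diff chi x = chi x" and "e x \<oplus> conv chi aug_diff x = chi x"
proof -
  have s: "chi a = approx n a" if "a \<in> grade A i" "i \<le> n" for a i
    using chi_homog[OF that(1)] approx_stable[OF that] by simp
  have e1: "conv aug_diff chi x = conv aug_diff (approx n) x"
    by (rule conv_eq_homog[OF aug_diff_lin chi_lin aug_diff_lin approx_lin x]) (use s in auto)
  have e2: "conv chi aug_diff x = conv (approx n) aug_diff x"
    by (rule conv_eq_homog[OF chi_lin aug_diff_lin approx_lin aug_diff_lin x]) (use s in auto)
  have "e x \<oplus> conv aug_diff (approx n) x = chi x"
    using approx_step[OF x order_refl] chi_homog[OF x] by simp
  then show "e x \<oplus> conv aug_diff chi x = chi x" "e x \<oplus> conv chi aug_diff x = chi x"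
    unfolding e1 e2 approx_commute[OF A.grade_subset[OF x]] by auto
qed

text \<open>On each degree \<open>chi = \<epsilon> + (\<epsilon> - id) \<ast> chi\<close>. Comparison with
  \<open>chi = \<epsilon> \<ast> chi = id \<ast> chi + (\<epsilon> - id) \<ast> chi\<close> gives \<open>id \<ast> chi = \<epsilon>\<close>.\<close>

lemma conv_id_chi:
  assumes "x \<in> carrier A"
  shows "conv id chi x = e x" and "conv chi id x = e x"
proof -
  note idu = lin_plus[OF Ar.is_module id_lin aug_diff_lin]
  have 1: "conv id chi x = e x" if x: "x \<in> grade A n" for x n
  proof -
    note xc = A.grade_subset[OF x]
    have c: "conv id chi x \<in> carrier A" "conv aug_diff chi x \<in> carrier A" "e x \<in> carrier A"
      using lin_closed[OF conv_lin[OF id_lin chi_lin] xc] lin_closed[OF conv_lin[OF aug_diff_lin chi_lin] xc]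
        lin_closed[OF e_lin xc] by auto
    have "conv id chi x \<oplus> conv aug_diff chi x = conv (\<lambda>x. id x \<oplus> aug_diff x) chi x"
      by (rule conv_add_left[OF id_lin aug_diff_lin chi_lin xc, symmetric])
    also have "\<dots> = conv e chi x"
      by (rule conv_cong[OF idu chi_lin e_lin chi_lin xc id_plus_aug_diff refl])
    also have "\<dots> = e x \<oplus> conv aug_diff chi x"
      using conv_unit_left[OF chi_lin xc] conv_aug_diff_chi(1)[OF x] by simp
    finally show ?thesis
      using c by (simp add: M.add.right_cancel)
  qed
  have 2: "conv chi id x = e x" if x: "x \<in> grade A n" for x n
  proof -
    note xc = A.grade_subset[OF x]
    have c: "conv chi id x \<in> carrier A" "conv chi aug_diff x \<in> carrier A" "e x \<in> carrier A"
      using lin_closed[OF conv_lin[OF chi_lin id_lin] xc] lin_closed[OF conv_lin[OF chi_lin aug_diff_lin] xc]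
        lin_closed[OF e_lin xc] by auto
    have "conv chi id x \<oplus> conv chi aug_diff x = conv chi (\<lambda>x. id x \<oplus> aug_diff x) x"
      by (rule conv_add_right[OF chi_lin id_lin aug_diff_lin xc, symmetric])
    also have "\<dots> = conv chi e x"
      by (rule conv_cong[OF chi_lin idu chi_lin e_lin xc refl id_plus_aug_diff])
    also have "\<dots> = e x \<oplus> conv chi aug_diff x"
      using conv_unit_right[OF chi_lin xc] conv_aug_diff_chi(2)[OF x] by simp
    finally show ?thesis
      using c by (simp add: M.add.right_cancel)
  qed
  show "conv id chi x = e x"
    by (rule A.lin_eq_on_homog[OF conv_lin[OF id_lin chi_lin] e_lin assms 1])
  show "conv chi id x = e x"
    by (rule A.lin_eq_on_homog[OF conv_lin[OF chi_lin id_lin] e_lin assms 2])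
qed

lemma is_antipode_iff:
  "is_antipode R A \<Phi> f \<longleftrightarrow> f \<in> graded_linear R A A \<and> (\<forall>x\<in>grade A 0. f x = x) \<and>
    (\<forall>x\<in>carrier A. conv id f x = e x) \<and> (\<forall>x\<in>carrier A. conv f id x = e x)"
  unfolding is_antipode_def using convolution_eq id_lin by (auto simp: graded_linear_iff)

text \<open>The uniqueness of inverses in a monoid: \<open>f = f \<ast> (id \<ast> g) = (f \<ast> id) \<ast> g = g\<close>.\<close>

lemma is_antipode_unique:
  assumes f: "is_antipode R A \<Phi> f" and g: "is_antipode R A \<Phi> g" and x: "x \<in> carrier A"
  shows "f x = g x"
proof -
  have fl: "f \<in> lin R A A" and gl: "g \<in> lin R A A"
    using f g by (auto simp: is_antipode_iff graded_linear_iff)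
  have "f x = conv f e x"
    using conv_unit_right[OF fl x] by simp
  also have "\<dots> = conv f (conv id g) x"
    by (rule conv_cong[OF fl e_lin fl conv_lin[OF id_lin gl] x]) (use g in \<open>simp_all add: is_antipode_iff\<close>)
  also have "\<dots> = conv (conv f id) g x"
    by (rule conv_assoc[OF fl id_lin gl x, symmetric])
  also have "\<dots> = conv e g x"
    by (rule conv_cong[OF conv_lin[OF fl id_lin] gl e_lin gl x]) (use f in \<open>simp_all add: is_antipode_iff\<close>)
  also have "\<dots> = g x"
    by (rule conv_unit_left[OF gl x])
  finally show ?thesis .
qed

lemma is_antipode_cong:
  assumes f: "is_antipode R A \<Phi> f" and eq: "\<And>x. x \<in> carrier A \<Longrightarrow> g x = f x"
  shows "is_antipode R A \<Phi> g"
proof -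
  have fl: "f \<in> lin R A A"
    using f by (auto simp: is_antipode_iff graded_linear_iff)
  have gl: "g \<in> lin R A A"
    by (rule lin_cong[OF Ar.is_module fl eq])
  have "conv id g x = conv id f x" if "x \<in> carrier A" for x
    by (rule conv_cong[OF id_lin gl id_lin fl that]) (simp_all add: eq)
  moreover have "conv g id x = conv f id x" if "x \<in> carrier A" for x
    by (rule conv_cong[OF gl id_lin fl id_lin that]) (simp_all add: eq)
  ultimately show ?thesis
    using f gl eq[OF A.grade_subset] by (simp add: is_antipode_iff graded_linear_iff)
qed

lemma chi_is_antipode: "is_antipode R A \<Phi> chi"
  using chi_graded conv_id_chi chi_homog[of _ 0] by (simp add: is_antipode_iff e_homog)

lemma antipode_is_antipode: "is_antipode R A \<Phi> (antipode R A \<Phi>)"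
proof -
  let ?r = "restrict chi (carrier A)"
  have "is_antipode R A \<Phi> ?r"
    by (rule is_antipode_cong[OF chi_is_antipode]) simp
  moreover have "g = ?r" if "g \<in> extensional (carrier A)" "is_antipode R A \<Phi> g" for g
    using is_antipode_unique[OF that(2) \<open>is_antipode R A \<Phi> ?r\<close>] that(1)
    by (rule extensionalityI[OF _ restrict_extensional, rotated])
  ultimately have "antipode R A \<Phi> = ?r"
    unfolding antipode_def by (intro the_equality) auto
  then show ?thesis
    using \<open>is_antipode R A \<Phi> ?r\<close> by simp
qed

lemma antipode_eqI: "\<lbrakk>is_antipode R A \<Phi> f; x \<in> carrier A\<rbrakk> \<Longrightarrow> antipode R A \<Phi> x = f x"
  using is_antipode_unique[OF antipode_is_antipode] .

section \<open>The antipode and commutativity\<close>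

lemma graded_commutative_sg:
  "graded_commutative A \<longleftrightarrow>
    (\<forall>p q. \<forall>x\<in>grade A p. \<forall>y\<in>grade A q. x \<otimes> y = sg R (p * q) \<odot> (y \<otimes> x))"
  using koszul_smult[OF Ar.is_module] A.grade_subset
  by (auto simp: graded_commutative_def)

text \<open>In a commutative algebra all images commute, so the cogroup identities for \<open>\<nu>\<close> are convolution
  identities.\<close>

lemma commutative_inverse_is_antipode:
  assumes comm: "graded_commutative A" and inv: "cogroup_inverse R A \<Phi> \<nu>"
  shows "is_antipode R A \<Phi> \<nu>"
proof -
  have \<nu>: "\<nu> \<in> ralg_hom R A A" "\<And>n x. x \<in> grade A n \<Longrightarrow> \<nu> x \<in> grade A n"
    using inv by (auto simp: cogroup_inverse_def galg_hom_iff)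
  have c: "y \<otimes> x = sg R (p * q) \<odot> (x \<otimes> y)" if "x \<in> grade A p" "y \<in> grade A q" for x y p q
    using comm that unfolding graded_commutative_sg mult.commute[of p q] by blast
  have "conv id \<nu> x = e x" if "x \<in> carrier A" for x
  proof -
    have "fp_copair R A id \<nu> (\<Phi> x) = conv id \<nu> x"
      by (rule hom_pair_convolution[OF id_hom \<nu>(1) _ that])
        (unfold id_apply, erule c, erule \<nu>(2))
    then show ?thesis using inv that by (simp add: cogroup_inverse_def)
  qed
  moreover have "conv \<nu> id x = e x" if "x \<in> carrier A" for x
  proof -
    have "fp_copair R A \<nu> id (\<Phi> x) = conv \<nu> id x"
      by (rule hom_pair_convolution[OF \<nu>(1) id_hom _ that])
        (unfold id_apply, rule c, erule \<nu>(2))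
    then show ?thesis using inv that by (simp add: cogroup_inverse_def)
  qed
  moreover have "\<nu> x = x" if "x \<in> grade A 0" for x
    using grade_0_scalar[OF that] by (auto simp: lin_smult[OF ralg_hom_lin[OF \<nu>(1)]] ralg_hom_one[OF \<nu>(1)])
  ultimately show ?thesis
    using \<nu> by (simp add: is_antipode_iff graded_linear_iff ralg_hom_lin)
qed

text \<open>By the counit axiom \<open>\<Delta> x\<close> is \<open>1 \<otimes> x\<close> plus terms whose second factor has degree less than
  \<open>n\<close>. The lemma states this through linear functionals, which avoids choosing a representation of
  \<open>\<Delta> x\<close> as a sum; the next one does so for \<open>x \<otimes> 1\<close> and the first factor.\<close>

lemma lin_Delta_first:
  assumes h: "h \<in> lin R T A" and x: "x \<in> grade A n"
    and van: "\<And>i j a b. \<lbrakk>i + j = n; j < n; a \<in> grade A i; b \<in> grade A j\<rbrakk> \<Longrightarrow> h (tens R A A a b) = \<zero>"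
  shows "h (\<Delta> x) = h (tens R A A \<one> x)"
proof -
  define m where "m = M e id"
  note m_lin = M_lin[OF e_lin id_lin, folded m_def] and m_tens = M_tens[OF e_lin id_lin, folded m_def]
  note g = lin_comp[OF m_lin lin_comp[OF bilin_right[OF tens_bilin one_closed] h]]
  have "h z = h (tens R A A \<one> (m z))" if "z \<in> grade T n" for z
    using that
  proof (induction rule: tensor_grade_induct)
    case (tens i j a b)
    note c = A.grade_subset[OF tens(2)] A.grade_subset[OF tens(3)]
    show ?case
    proof (cases "i = 0")
      case True
      then obtain r where r: "r \<in> carrier R" "a = r \<odot> \<one>"
        using grade_0_scalar tens(2) by blast
      have "tens R A A \<one> (e a \<otimes> b) = tens R A A a b"
        using True tens(2) c r
        by (simp add: e_homog smult_mult_left lin_smult[OF bilin_left[OF tens_bilin]]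
            lin_smult[OF bilin_right[OF tens_bilin]])
      then show ?thesis
        using c by (simp add: m_tens)
    next
      case False
      then have "h (tens R A A a b) = \<zero>"
        using van[OF tens(1) _ tens(2,3)] tens(1) by simp
      moreover have "m (tens R A A a b) = \<zero>"
        using False c by (simp add: m_tens e_homog[OF tens(2)])
      ultimately show ?thesis
        using lin_zero[OF Ar.is_module Ar.is_module lin_comp[OF bilin_right[OF tens_bilin one_closed] h]] by simp
    qed
  next
    case (add y z)
    then show ?case
      using Tm.grade_subset by (simp add: lin_add[OF g] lin_add[OF h])
  qed
  then show ?thesis
    using Delta_grade[OF x] counit_left[OF A.grade_subset[OF x]] by (simp add: conv_def m_def)
qed

lemma lin_Delta_second:
  assumes h: "h \<in> lin R T A" and x: "x \<in> grade A n"
    and van: "\<And>i j a b. \<lbrakk>i + j = n; i < n; a \<in> grade A i; b \<in> grade A j\<rbrakk> \<Longrightarrow> h (tens R A A a b) = \<zero>"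
  shows "h (\<Delta> x) = h (tens R A A x \<one>)"
proof -
  define m where "m = M id e"
  note m_lin = M_lin[OF id_lin e_lin, folded m_def] and m_tens = M_tens[OF id_lin e_lin, folded m_def]
  note g = lin_comp[OF m_lin lin_comp[OF bilin_left[OF tens_bilin one_closed] h]]
  have "h z = h (tens R A A (m z) \<one>)" if "z \<in> grade T n" for z
    using that
  proof (induction rule: tensor_grade_induct)
    case (tens i j a b)
    note c = A.grade_subset[OF tens(2)] A.grade_subset[OF tens(3)]
    show ?case
    proof (cases "j = 0")
      case True
      then obtain r where r: "r \<in> carrier R" "b = r \<odot> \<one>"
        using grade_0_scalar tens(3) by blast
      have "tens R A A (a \<otimes> e b) \<one> = tens R A A a b"
        using True tens(3) c r
        by (simp add: e_homog smult_mult_right lin_smult[OF bilin_left[OF tens_bilin]]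
            lin_smult[OF bilin_right[OF tens_bilin]])
      then show ?thesis
        using c by (simp add: m_tens)
    next
      case False
      then have "h (tens R A A a b) = \<zero>"
        using van[OF tens(1) _ tens(2,3)] tens(1) by simp
      moreover have "m (tens R A A a b) = \<zero>"
        using False c by (simp add: m_tens e_homog[OF tens(3)])
      ultimately show ?thesis
        using lin_zero[OF Ar.is_module Ar.is_module lin_comp[OF bilin_left[OF tens_bilin one_closed] h]] by simp
    qed
  next
    case (add y z)
    then show ?case
      using Tm.grade_subset by (simp add: lin_add[OF g] lin_add[OF h])
  qed
  then show ?thesis
    using Delta_grade[OF x] counit_right[OF A.grade_subset[OF x]] by (simp add: conv_def m_def)
qed

lemma minus_self_eq: "\<lbrakk>x \<in> carrier A; y \<in> carrier A; x \<ominus> y = \<zero>\<rbrakk> \<Longrightarrow> x = y"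
  by (metis a_minus_def M.minus_equality M.minus_minus M.a_inv_closed)

text \<open>Induction on the total degree \<open>n\<close>. The bilinear map \<open>D\<close> measures the failure of
  \<open>m (a \<otimes> b) = a \<cdot> f b\<close> to be multiplicative. It vanishes on \<open>(a \<otimes> b, c \<otimes> d)\<close> if \<open>f b\<close>
  and \<open>c\<close> commute, and on \<open>(\<Delta> x, \<Delta> y)\<close>; only the pair \<open>(1 \<otimes> x, y \<otimes> 1)\<close> is left, and there the vanishing of
  \<open>D\<close> says that \<open>f x\<close> and \<open>y\<close> commute.\<close>

lemma hom_antipode_commutative:
  assumes f: "is_antipode R A \<Phi> f" and hom: "f \<in> ralg_hom R A A"
  shows "graded_commutative A"
proof -
  define m where "m = M id f"
  have fl: "f \<in> lin R A A" and fg: "\<And>n x. x \<in> grade A n \<Longrightarrow> f x \<in> grade A n"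
    and fe: "\<And>x. x \<in> carrier A \<Longrightarrow> m (\<Delta> x) = e x"
    using f by (auto simp: is_antipode_iff graded_linear_iff conv_def m_def)
  let ?t = "tens R A A"
  note Ml = M_lin[OF id_lin fl, folded m_def] and Mt = M_tens[OF id_lin fl, folded m_def]
  note fc = lin_closed[OF fl] and Mc = lin_closed[OF Ml]
  note Al = bilin_left[OF Ar.mult_bilin] and Arr = bilin_right[OF Ar.mult_bilin]
  note gs = A.grade_subset
  let ?comm = "\<lambda>x y k. x \<otimes> y = sg R k \<odot> (y \<otimes> x)"
  let ?D = "\<lambda>z w. m (z \<otimes>\<^bsub>TA\<^esub> w) \<ominus> m z \<otimes> m w"
  have Dl: "(\<lambda>z. ?D z w) \<in> lin R T A" if w: "w \<in> carrier T" for w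
    unfolding a_minus_def
    by (rule lin_plus[OF Ar.is_module lin_comp[OF TA_mult_left[OF w] Ml]
          lin_uminus[OF Ar.is_module lin_comp[OF Ml Al[OF Mc[OF w]]]]])
  have Dr: "(\<lambda>w. ?D z w) \<in> lin R T A" if z: "z \<in> carrier T" for z
    unfolding a_minus_def
    by (rule lin_plus[OF Ar.is_module lin_comp[OF TA_mult_right[OF z] Ml]
          lin_uminus[OF Ar.is_module lin_comp[OF Ml Arr[OF Mc[OF z]]]]])
  have "\<forall>p q x y. p + q = n \<longrightarrow> x \<in> grade A p \<longrightarrow> y \<in> grade A q \<longrightarrow> ?comm x y (p * q)" for n
  proof (induction n rule: less_induct)
    case (less n)
    have IH: "?comm x y (p * q)" if "p + q < n" "x \<in> grade A p" "y \<in> grade A q" for p q x y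
      using less that by blast
    have D0: "?D (?t a b) (?t c d) = \<zero>"
      if h: "a \<in> grade A i" "b \<in> grade A j" "c \<in> grade A k" "d \<in> grade A l" and lt: "j + k < n"
      for a b c d i j k l
    proof -
      note cc = h(1-4)[THEN gs]
      have "m (?t a b \<otimes>\<^bsub>TA\<^esub> ?t c d) = a \<otimes> (sg R (j * k) \<odot> (c \<otimes> f b)) \<otimes> f d"
        using cc fc
        by (simp add: TA_mult_tens[OF cc(1) h(2,3) cc(4)] lin_smult[OF Ml] sg_closed[OF R_cring] tens_closed Mt
            ralg_hom_mult[OF hom] m_assoc smult_mult_left smult_mult_right)
      also have "\<dots> = m (?t a b) \<otimes> m (?t c d)"
        using cc fc by (simp add: IH[OF lt fg[OF h(2)] h(3), symmetric] Mt m_assoc)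
      finally show ?thesis
        using cc by (simp add: M.r_neg a_minus_def Mc tens_closed)
    qed
    have C1: "?comm (f x) y (p * q)" if n: "p + q = n" and x: "x \<in> grade A p" and y: "y \<in> grade A q"
      for p q x y
    proof -
      note xc = gs[OF x] and yc = gs[OF y]
      have Dz: "?D (?t a b) w = \<zero>"
        if h: "a \<in> grade A i" "b \<in> grade A j" "j < p" "w \<in> grade T q" for a b w i j
        using h(4)
      proof (induction rule: tensor_grade_induct)
        case (tens k l c d)
        show ?case
          by (rule D0[OF h(1,2) tens(2,3)]) (use h(3) tens(1) n in simp)
      next
        case (add v w)
        note tc = tens_closed[OF gs[OF h(1)] gs[OF h(2)]]
        show ?case
          using add Tm.grade_subset by (simp add: lin_add[OF Dr[OF tc]])
      qed
      have "?D (\<Delta> x) (\<Delta> y) = \<zero>"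
        using xc yc fe lin_closed[OF e_lin]
        by (simp add: ralg_hom_mult[OF Delta_hom, symmetric] ralg_hom_mult[OF e_hom] a_minus_def M.r_neg)
      moreover have "?D (\<Delta> x) (\<Delta> y) = ?D (?t \<one> x) (\<Delta> y)"
        by (rule lin_Delta_first[OF Dl[OF Delta_closed[OF yc]] x]) (rule Dz[OF _ _ _ Delta_grade[OF y]])
      moreover have "?D (?t \<one> x) (\<Delta> y) = ?D (?t \<one> x) (?t y \<one>)"
        by (rule lin_Delta_second[OF Dr[OF tens_closed[OF one_closed xc]] y])
          (rule D0[OF grade_one x], assumption, assumption, use n in linarith)
      ultimately have "?D (?t \<one> x) (?t y \<one>) = \<zero>"
        by simp
      then have "m (?t \<one> x \<otimes>\<^bsub>TA\<^esub> ?t y \<one>) = m (?t \<one> x) \<otimes> m (?t y \<one>)"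
        by (rule minus_self_eq[rotated 2]) (use xc yc in \<open>simp_all add: Mc tens_closed TA_mult_closed\<close>)
      then show ?thesis
        using xc yc fc
        by (simp add: TA_mult_tens[OF one_closed x y one_closed] lin_smult[OF Ml] sg_closed[OF R_cring] tens_closed Mt
            ralg_hom_one[OF hom])
    qed
    show ?case
    proof (intro allI impI)
      fix p q x y assume n: "p + q = n" and x: "x \<in> grade A p" and y: "y \<in> grade A q"
      note xc = gs[OF x] and yc = gs[OF y]
      note sc = sg_closed[OF R_cring]
      show "?comm x y (p * q)"
      proof (cases "p = 0")
        case True
        then obtain r where "r \<in> carrier R" "x = r \<odot> \<one>"
          using grade_0_scalar x by blast
        then show ?thesis
          using True yc by (simp add: smult_mult_left smult_mult_right sg_0)
      next
        case False
        \<comment> \<open>\<open>m (\<Delta> x) = 0\<close> writes \<open>x\<close> as a sum of products \<open>- a \<cdot> f b\<close> with \<open>a\<close> of degree less than \<open>p\<close>; here \<open>b\<close> may have degree \<open>p\<close>, where the claim on \<open>f b\<close> above is needed\<close>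
        let ?h = "\<lambda>z. m z \<otimes> y \<ominus> sg R (p * q) \<odot> (y \<otimes> m z)"
        have hl: "?h \<in> lin R T A"
          unfolding a_minus_def
          by (rule lin_plus[OF Ar.is_module lin_comp[OF Ml Al[OF yc]]
                lin_uminus[OF Ar.is_module lin_scaled[OF Ar.is_module lin_comp[OF Ml Arr[OF yc]] sc]]])
        have "?h (\<Delta> x) = ?h (?t x \<one>)"
        proof (rule lin_Delta_second[OF hl x])
          fix i j a b assume h: "i + j = p" "i < p" "a \<in> grade A i" "b \<in> grade A j"
          note cc = gs[OF h(3)] gs[OF h(4)]
          have fb: "?comm (f b) y (j * q)"
          proof (cases "j = p")
            case True
            then show ?thesis using C1[OF n _ y] h(4) by simp
          next
            case False
            then show ?thesis using IH[OF _ fg[OF h(4)] y] h(1) n by simp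
          qed
          have ay: "?comm a y (i * q)"
            using IH[OF _ h(3) y] h(2) n by simp
          have s: "sg R (j * q) \<otimes>\<^bsub>R\<^esub> sg R (i * q) = sg R (p * q)"
            unfolding sg_mult[OF R_cring] by (simp add: algebra_simps flip: h(1))
          have "a \<otimes> f b \<otimes> y = sg R (j * q) \<odot> ((a \<otimes> y) \<otimes> f b)"
            using cc fc yc by (simp add: m_assoc fb smult_mult_right sc)
          also have "\<dots> = sg R (p * q) \<odot> (y \<otimes> (a \<otimes> f b))"
            using cc fc yc by (simp add: ay smult_mult_left m_assoc sc s flip: smult_assoc1)
          finally show "?h (?t a b) = \<zero>"
            using cc fc yc by (simp add: Mt sc a_minus_def M.r_neg)
        qed
        moreover have "?h (\<Delta> x) = \<zero>"
          using False yc by (simp add: fe[OF xc] e_homog[OF x] sc a_minus_def)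
        moreover have "?h (?t x \<one>) = x \<otimes> y \<ominus> sg R (p * q) \<odot> (y \<otimes> x)"
          using xc by (simp add: Mt ralg_hom_one[OF hom])
        ultimately show ?thesis
          using minus_self_eq[of "x \<otimes> y" "sg R (p * q) \<odot> (y \<otimes> x)"] xc yc sc by simp
      qed
    qed
  qed
  then have "?comm x y (p * q)" if "x \<in> grade A p" "y \<in> grade A q" for x y p q
    using that refl[of "p + q"] by blast
  then show ?thesis
    unfolding graded_commutative_sg by blast
qed

end

theorem theorem1p3:
  fixes R :: "('r, 'm) ring_scheme"
    and A :: "('r, 'a, 'n) gralg_scheme"
    and \<Phi> :: "'a \<Rightarrow> (('a + 'a) list \<Rightarrow> 'r) set"
    and \<nu> :: "'a \<Rightarrow> 'a"
  assumes "cring R"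
    and "cogroup R A \<Phi>"
    and "cogroup_inverse R A \<Phi> \<nu>"
  shows "((\<forall>x\<in>carrier A. \<nu> x = antipode R A \<Phi> x) \<longleftrightarrow> antipode R A \<Phi> \<in> galg_hom R A A) \<and>
         (antipode R A \<Phi> \<in> galg_hom R A A \<longleftrightarrow> graded_commutative A)"
proof -
  interpret conn_comonoid R A \<Phi>
    using assms(2) by (auto simp: conn_comonoid_def conn_comonoid_axioms_def cogroup_def comonoid_def)
  let ?\<chi> = "antipode R A \<Phi>"
  have i_ii: "?\<chi> \<in> galg_hom R A A" if eq: "\<forall>x\<in>carrier A. \<nu> x = ?\<chi> x"
  proof -
    have "\<nu> \<in> ralg_hom R A A" "\<And>n x. x \<in> grade A n \<Longrightarrow> \<nu> x \<in> grade A n"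
      using assms(3) by (auto simp: cogroup_inverse_def galg_hom_iff)
    then show ?thesis
      using ralg_hom_cong[OF A_ralg, of \<nu> A ?\<chi>] eq A.grade_subset by (auto simp: galg_hom_iff)
  qed
  have ii_iii: "graded_commutative A" if "?\<chi> \<in> galg_hom R A A"
    using hom_antipode_commutative[OF antipode_is_antipode] that by (simp add: galg_hom_iff)
  have iii_i: "\<forall>x\<in>carrier A. \<nu> x = ?\<chi> x" if "graded_commutative A"
    using antipode_eqI[OF commutative_inverse_is_antipode[OF that assms(3)]] by simp
  show ?thesis
    using i_ii ii_iii iii_i by blast
qed

end
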